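(* There is an algorithm that, given any strings $A$ and $B$ of length $n$ and a string $P$, solves the STR-IC-LCS problem (that is, computes an STR-IC-LCS of $A$, $B$ and $P$) in $O(n^2)$ time and $O((\ell+1)(n-\ell+1))$ space, where $\ell=\mathrm{lcs}(A,B)$ is the length of a longest common subsequence of $A$ and $B$.
   Context: Strings are over an alphabet $\Sigma$. A subsequence of a string is obtained by deleting zero or more characters; a substring is a contiguous block; a common subsequence of $A$ and $B$ is a string that is a subsequence of both. $\mathrm{lcs}(A,B)$ denotes the length of a longest common subsequence of $A$ and $B$. A string $Z$ is an STR-IC-LCS of $A$ and $B$ including $P$ (an STR-IC-LCS of $A$, $B$ and $P$) if $Z$ is a longest string such that (1) $P$ is a substring of $Z$ and (2) $Z$ is a common subsequence of $A$ and $B$. If no such string exists, the solution is by convention $Z=\bot$ with $|\bot|=-1$. The STR-IC-LCS problem is: given $A,B$ of length $n$ and $P$, compute an STR-IC-LCS of $A$, $B$ and $P$. It is assumed that $|P|\le n$ (otherwise there is no solution). Time and working space are measured in the usual word RAM model (word size $\log_2 n$, space counted in words). *)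

theory Defs
  imports Complex_Main "HOL-Library.Sublist" "HOL-Library.Landau_Symbols"
begin

section \<open>Longest common subsequences, with and without an inclusion constraint\<close>

definition common_subseq :: "'a list \<Rightarrow> 'a list \<Rightarrow> 'a list \<Rightarrow> bool" where
  "common_subseq A B Z \<longleftrightarrow> subseq Z A \<and> subseq Z B"

definition lcs :: "'a list \<Rightarrow> 'a list \<Rightarrow> nat" where
  "lcs A B = Max (length ` {Z. common_subseq A B Z})"

text \<open>In the library, \<^const>\<open>sublist\<close> is the contiguous (substring) relation and
  \<^const>\<open>subseq\<close> the scattered one.\<close>

definition str_ic_candidate :: "'a list \<Rightarrow> 'a list \<Rightarrow> 'a list \<Rightarrow> 'a list \<Rightarrow> bool" where
  "str_ic_candidate A B P Z \<longleftrightarrow> sublist P Z \<and> common_subseq A B Z"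

text \<open>\<^term>\<open>None\<close> plays the role of the conventional solution \<open>\<bottom>\<close>.\<close>

fun is_str_ic_lcs :: "'a list \<Rightarrow> 'a list \<Rightarrow> 'a list \<Rightarrow> 'a list option \<Rightarrow> bool" where
  "is_str_ic_lcs A B P (Some Z) \<longleftrightarrow>
     str_ic_candidate A B P Z \<and> (\<forall>Z'. str_ic_candidate A B P Z' \<longrightarrow> length Z' \<le> length Z)"
| "is_str_ic_lcs A B P None \<longleftrightarrow> (\<nexists>Z. str_ic_candidate A B P Z)"


section \<open>Word RAM\<close>

text \<open>
  A machine of word size \<open>w\<close> works on words, i.e. numbers below \<open>2 ^ w\<close>, with arithmetic
  modulo \<open>2 ^ w\<close>.  It has registers and a random access memory addressed by words.  A program
  is a fixed list of instructions, hence uses only a constant number of registers, and is the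
  same for all inputs and word sizes.
\<close>

datatype binop = Add | Sub | Mul | Div | Mod | And | Or | Xor | Shl | Shr

datatype instr =
    Const nat nat
  | Move nat nat
  | Op binop nat nat nat
  | Load nat nat
  | Store nat nat
  | Jump nat
  | JumpEq nat nat nat
  | JumpLess nat nat nat

record config =
  pc :: nat
  reg :: "nat \<Rightarrow> nat"
  mem :: "nat \<Rightarrow> nat"

context
  includes bit_operations_syntax
begin

fun binop_val :: "nat \<Rightarrow> binop \<Rightarrow> nat \<Rightarrow> nat \<Rightarrow> nat" where
  "binop_val w Add x y = (x + y) mod 2 ^ w"
| "binop_val w Sub x y = (x + 2 ^ w - y) mod 2 ^ w"
| "binop_val w Mul x y = (x * y) mod 2 ^ w"
| "binop_val w Div x y = x div y"
| "binop_val w Mod x y = x mod y"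
| "binop_val w And x y = x AND y"
| "binop_val w Or x y = x OR y"
| "binop_val w Xor x y = x XOR y"
| "binop_val w Shl x y = (x * 2 ^ y) mod 2 ^ w"
| "binop_val w Shr x y = x div 2 ^ y"

end

fun exec :: "nat \<Rightarrow> instr \<Rightarrow> config \<Rightarrow> config" where
  "exec w (Const d k) c = c\<lparr>pc := Suc (pc c), reg := (reg c)(d := k mod 2 ^ w)\<rparr>"
| "exec w (Move d a) c = c\<lparr>pc := Suc (pc c), reg := (reg c)(d := reg c a)\<rparr>"
| "exec w (Op f d a b) c =
     c\<lparr>pc := Suc (pc c), reg := (reg c)(d := binop_val w f (reg c a) (reg c b))\<rparr>"
| "exec w (Load d a) c = c\<lparr>pc := Suc (pc c), reg := (reg c)(d := mem c (reg c a))\<rparr>"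
| "exec w (Store a b) c = c\<lparr>pc := Suc (pc c), mem := (mem c)(reg c a := reg c b)\<rparr>"
| "exec w (Jump l) c = c\<lparr>pc := l\<rparr>"
| "exec w (JumpEq a b l) c = c\<lparr>pc := (if reg c a = reg c b then l else Suc (pc c))\<rparr>"
| "exec w (JumpLess a b l) c = c\<lparr>pc := (if reg c a < reg c b then l else Suc (pc c))\<rparr>"

fun accessed :: "instr \<Rightarrow> config \<Rightarrow> nat set" where
  "accessed (Load d a) c = {reg c a}"
| "accessed (Store a b) c = {reg c a}"
| "accessed _ c = {}"

text \<open>A program halts when the program counter leaves it.\<close>

definition halted :: "instr list \<Rightarrow> config \<Rightarrow> bool" where
  "halted prog c \<longleftrightarrow> length prog \<le> pc c"

definition step :: "nat \<Rightarrow> instr list \<Rightarrow> config \<Rightarrow> config" where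
  "step w prog c = (if halted prog c then c else exec w (prog ! pc c) c)"

text \<open>\<open>runs w prog c t s c'\<close>: started in \<open>c\<close>, the program halts in \<open>c'\<close> after exactly \<open>t\<close> steps
  (each instruction costs one unit), accessing no memory word other than the first \<open>s\<close> ones.\<close>

definition runs :: "nat \<Rightarrow> instr list \<Rightarrow> config \<Rightarrow> nat \<Rightarrow> nat \<Rightarrow> config \<Rightarrow> bool" where
  "runs w prog c t s c' \<longleftrightarrow>
     (step w prog ^^ t) c = c' \<and> halted prog c' \<and>
     (\<forall>u<t. let d = (step w prog ^^ u) c
            in \<not> halted prog d \<and> accessed (prog ! pc d) d \<subseteq> {..<s})"

text \<open>Input convention: registers 0, 1 and 2 hold the lengths of the three strings, which are
  stored consecutively from address 0, one character per word; everything else is 0.\<close>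

definition input_config :: "nat list \<Rightarrow> nat list \<Rightarrow> nat list \<Rightarrow> config" where
  "input_config A B P =
     \<lparr>pc = 0,
      reg = (\<lambda>_. 0)(0 := length A, 1 := length B, 2 := length P),
      mem = (\<lambda>i. if i < length (A @ B @ P) then (A @ B @ P) ! i else 0)\<rparr>"

text \<open>Output convention: register 0 is 0 for \<open>\<bottom>\<close>; otherwise the output string has its start address
  in register 1 and its length in register 2.\<close>

definition result_of :: "config \<Rightarrow> nat list option" where
  "result_of c = (if reg c 0 = 0 then None
                  else Some (map (mem c) [reg c 1 ..< reg c 1 + reg c 2]))"

text \<open>The memory words holding the input and the output are included in the space \<open>s\<close>.\<close>

definition computes ::
  "nat \<Rightarrow> instr list \<Rightarrow> nat list \<Rightarrow> nat list \<Rightarrow> nat list \<Rightarrow> nat \<Rightarrow> nat \<Rightarrow> nat list option \<Rightarrow> bool" where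
  "computes w prog A B P t s Z \<longleftrightarrow>
     (\<exists>c. runs w prog (input_config A B P) t s c \<and> result_of c = Z \<and>
          length (A @ B @ P) \<le> s \<and> (Z \<noteq> None \<longrightarrow> reg c 1 + reg c 2 \<le> s))"

end

theory Submission imports Defs begin

text \<open>
  The program needs only linear space.  For an end position \<open>i\<close> in \<open>A\<close> let \<open>a i\<close> be the largest start of an
  embedding of \<open>P\<close> into \<open>A\<close> that ends at \<open>i\<close>, and define \<open>b j\<close> for \<open>B\<close> likewise.  An optimal solution
  has length \<open>lcs (A[..a i]) (B[..b j]) + |P| + lcs (A[i..]) (B[j..])\<close> for the best pair \<open>(i, j)\<close>.  A row-wise
  dynamic program in which every pair \<open>(i, j)\<close> is a possible source, with value
  \<open>lcs (A[..a i]) (B[..b j]) + |P|\<close>, computes this maximum.  Both tables that it needs are traversed with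
  increasing row index, because \<open>a\<close> is monotone, so single rows of them suffice.  Values and sources are packed
  into one number, with the value in the leading position, so that the maximum also tells an optimal pair.  The
  two longest common subsequences around \<open>P\<close> are then written out by Hirschberg's bisection,
  which uses the same packed dynamic program to find where an optimal path crosses the middle row.  Finally
  \<open>(l + 1) * (n - l + 1)\<close> is at least \<open>n + 1\<close> for \<open>l \<le> n\<close>.
\<close>

section \<open>Structured programs\<close>

text \<open>One start per end position suffices by an exchange: with the end of an embedding of
  \<open>P\<close> kept fixed, moving its start to the right only enlarges the prefix that precedes
  it. Only the two ends remain to be chosen, independently in \<open>A\<close> and \<open>B\<close>.
  The value 0 is reserved for "no source" and "no embedding"; this is why ranks, prefix lengths and
  starts are all stored as successors. Ranks are linear in n and labels lie below
  \<open>(n + 1)^2\<close>, so every packed number stays within \<open>4 * (n + 1) ^ 3\<close> and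
  fits into a word of O(log n) bits. The obstacle is that the claim is about one fixed list of
  machine instructions, with wraparound arithmetic and no call stack. The algorithm is therefore
  written in a small structured language whose semantics admits only exact arithmetic and addresses
  below the space bound, and which keeps a clock. A compiler to the machine is proved correct once;
  the rest is reasoning with weakest preconditions, and the recursion of the bisection runs on an
  explicit stack.\<close>

datatype exp = Num nat | Reg nat | Mem exp | Bin binop exp exp
datatype cond = Less exp exp | Eq exp exp
datatype com = Skip | Assign nat exp | Put exp exp | Seq com com | Ifte cond com com | Loop cond com

text \<open>Exact arithmetic on naturals instead of arithmetic modulo \<open>2 ^ w\<close>;
  \<open>aok\<close> describes where the two agree. Bitwise operators and shifts never satisfy
  \<open>aok\<close>, so 0 is a mere default for them.\<close>

fun aval :: "binop \<Rightarrow> nat \<Rightarrow> nat \<Rightarrow> nat" where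
  "aval Add x y = x + y"
| "aval Sub x y = x - y"
| "aval Mul x y = x * y"
| "aval Div x y = x div y"
| "aval Mod x y = x mod y"
| "aval _ x y = 0"

fun aok :: "nat \<Rightarrow> binop \<Rightarrow> nat \<Rightarrow> nat \<Rightarrow> bool" where
  "aok w Add x y \<longleftrightarrow> x + y < 2 ^ w"
| "aok w Sub x y \<longleftrightarrow> y \<le> x \<and> x < 2 ^ w"
| "aok w Mul x y \<longleftrightarrow> x * y < 2 ^ w"
| "aok w Div x y \<longleftrightarrow> True"
| "aok w Mod x y \<longleftrightarrow> True"
| "aok w _ x y \<longleftrightarrow> False"

fun ev :: "exp \<Rightarrow> (nat \<Rightarrow> nat) \<Rightarrow> (nat \<Rightarrow> nat) \<Rightarrow> nat" where
  "ev (Num k) r m = k"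
| "ev (Reg x) r m = r x"
| "ev (Mem e) r m = m (ev e r m)"
| "ev (Bin f a b) r m = aval f (ev a r m) (ev b r m)"

text \<open>Besides the absence of overflow this demands that every address read lies below
  \<open>s\<close>, so that a derivation in the semantics carries the space bound with it.\<close>

fun ok :: "nat \<Rightarrow> nat \<Rightarrow> exp \<Rightarrow> (nat \<Rightarrow> nat) \<Rightarrow> (nat \<Rightarrow> nat) \<Rightarrow> bool" where
  "ok w s (Num k) r m \<longleftrightarrow> k < 2 ^ w"
| "ok w s (Reg x) r m \<longleftrightarrow> True"
| "ok w s (Mem e) r m \<longleftrightarrow> ok w s e r m \<and> ev e r m < s"
| "ok w s (Bin f a b) r m \<longleftrightarrow> ok w s a r m \<and> ok w s b r m \<and> aok w f (ev a r m) (ev b r m)"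

fun esz :: "exp \<Rightarrow> nat" where
  "esz (Num k) = 1"
| "esz (Reg x) = 1"
| "esz (Mem e) = esz e + 1"
| "esz (Bin f a b) = esz a + esz b + 1"

fun evars :: "exp \<Rightarrow> nat set" where
  "evars (Num k) = {}"
| "evars (Reg x) = {x}"
| "evars (Mem e) = evars e"
| "evars (Bin f a b) = evars a \<union> evars b"

fun cev :: "cond \<Rightarrow> (nat \<Rightarrow> nat) \<Rightarrow> (nat \<Rightarrow> nat) \<Rightarrow> bool" where
  "cev (Less a b) r m \<longleftrightarrow> ev a r m < ev b r m"
| "cev (Eq a b) r m \<longleftrightarrow> ev a r m = ev b r m"

fun cfst :: "cond \<Rightarrow> exp" where "cfst (Less a b) = a" | "cfst (Eq a b) = a"
fun csnd :: "cond \<Rightarrow> exp" where "csnd (Less a b) = b" | "csnd (Eq a b) = b"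
fun cjump :: "cond \<Rightarrow> nat \<Rightarrow> nat \<Rightarrow> nat \<Rightarrow> instr" where
  "cjump (Less a b) = JumpLess" | "cjump (Eq a b) = JumpEq"

definition cok :: "nat \<Rightarrow> nat \<Rightarrow> cond \<Rightarrow> (nat \<Rightarrow> nat) \<Rightarrow> (nat \<Rightarrow> nat) \<Rightarrow> bool" where
  "cok w s b r m \<longleftrightarrow> ok w s (cfst b) r m \<and> ok w s (csnd b) r m"
definition csz :: "cond \<Rightarrow> nat" where
  "csz b = esz (cfst b) + esz (csnd b)"

text \<open>Registers from 100 on are reserved for intermediate values of expressions.\<close>

definition tmp :: nat where "tmp = 100"

fun legal :: "com \<Rightarrow> bool" where
  "legal Skip \<longleftrightarrow> True"
| "legal (Assign x e) \<longleftrightarrow> x < tmp \<and> evars e \<subseteq> {..<tmp}"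
| "legal (Put a b) \<longleftrightarrow> evars a \<union> evars b \<subseteq> {..<tmp}"
| "legal (Seq c d) \<longleftrightarrow> legal c \<and> legal d"
| "legal (Ifte b c d) \<longleftrightarrow> evars (cfst b) \<union> evars (csnd b) \<subseteq> {..<tmp} \<and> legal c \<and> legal d"
| "legal (Loop b c) \<longleftrightarrow> evars (cfst b) \<union> evars (csnd b) \<subseteq> {..<tmp} \<and> legal c"

text \<open>Registers from \<open>d\<close> on serve as an evaluation stack: the value ends up in
  \<open>d\<close> and nothing below \<open>d\<close> changes, so a left operand survives in
  \<open>d\<close> while the right one is computed from \<open>Suc d\<close> on.\<close>

fun cexp :: "nat \<Rightarrow> exp \<Rightarrow> instr list" where
  "cexp d (Num k) = [Const d k]"
| "cexp d (Reg x) = [Move d x]"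
| "cexp d (Mem e) = cexp d e @ [Load d d]"
| "cexp d (Bin f a b) = cexp d a @ cexp (Suc d) b @ [Op f d d (Suc d)]"

definition ccond :: "cond \<Rightarrow> instr list" where
  "ccond b = cexp tmp (cfst b) @ cexp (Suc tmp) (csnd b)"

text \<open>Jump targets are absolute, hence the load address \<open>p\<close>. A conditional jump
  is taken when the test holds, so the code of the else branch comes first.\<close>

fun ccom :: "nat \<Rightarrow> com \<Rightarrow> instr list" where
  "ccom p Skip = []"
| "ccom p (Assign x e) = cexp tmp e @ [Move x tmp]"
| "ccom p (Put a b) = cexp tmp a @ cexp (Suc tmp) b @ [Store tmp (Suc tmp)]"
| "ccom p (Seq c d) = (let cs = ccom p c in cs @ ccom (p + length cs) d)"
| "ccom p (Ifte b c d) =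
     (let ds = ccom (p + csz b + 1) d; q = p + csz b + 1 + length ds + 1; cs = ccom q c in
      ccond b @ [cjump b tmp (Suc tmp) q] @ ds @ [Jump (q + length cs)] @ cs)"
| "ccom p (Loop b c) =
     (let cs = ccom (p + csz b + 2) c in
      ccond b @ [cjump b tmp (Suc tmp) (p + csz b + 2), Jump (p + csz b + 2 + length cs + 1)] @
      cs @ [Jump p])"

text \<open>The third component of a state is a clock that bounds the number of machine steps.\<close>

type_synonym state = "(nat \<Rightarrow> nat) \<times> (nat \<Rightarrow> nat) \<times> nat"

text \<open>A test is charged \<open>csz b + 2\<close>: its two expressions, the conditional jump
  and one unconditional jump. In a loop the latter goes back to the test or leaves the loop; in
  \<open>Ifte\<close> only the else branch makes it, so the then branch is overcharged by
  one.\<close>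

inductive big :: "nat \<Rightarrow> nat \<Rightarrow> com \<Rightarrow> state \<Rightarrow> state \<Rightarrow> bool" for w s where
  big_Skip: "big w s Skip \<sigma> \<sigma>"
| big_Assign: "ok w s e r m \<Longrightarrow>
    big w s (Assign x e) (r, m, t) (r(x := ev e r m), m, t + esz e + 1)"
| big_Put: "ok w s a r m \<Longrightarrow> ok w s b r m \<Longrightarrow> ev a r m < s \<Longrightarrow>
    big w s (Put a b) (r, m, t) (r, m(ev a r m := ev b r m), t + esz a + esz b + 1)"
| big_Seq: "big w s c \<sigma> \<sigma>' \<Longrightarrow> big w s d \<sigma>' \<sigma>'' \<Longrightarrow> big w s (Seq c d) \<sigma> \<sigma>''"
| big_IfT: "cok w s b r m \<Longrightarrow> cev b r m \<Longrightarrow> big w s c (r, m, t + csz b + 2) \<sigma> \<Longrightarrow>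
    big w s (Ifte b c d) (r, m, t) \<sigma>"
| big_IfF: "cok w s b r m \<Longrightarrow> \<not> cev b r m \<Longrightarrow> big w s d (r, m, t + csz b + 2) \<sigma> \<Longrightarrow>
    big w s (Ifte b c d) (r, m, t) \<sigma>"
| big_LoopT: "cok w s b r m \<Longrightarrow> cev b r m \<Longrightarrow> big w s c (r, m, t + csz b + 2) \<sigma> \<Longrightarrow>
    big w s (Loop b c) \<sigma> \<sigma>' \<Longrightarrow> big w s (Loop b c) (r, m, t) \<sigma>'"
| big_LoopF: "cok w s b r m \<Longrightarrow> \<not> cev b r m \<Longrightarrow>
    big w s (Loop b c) (r, m, t) (r, m, t + csz b + 2)"

section \<open>Correctness of the compiler\<close>

definition reach :: "nat \<Rightarrow> instr list \<Rightarrow> nat \<Rightarrow> nat \<Rightarrow> config \<Rightarrow> config \<Rightarrow> bool" where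
  "reach w prog s k c c' \<longleftrightarrow> (step w prog ^^ k) c = c' \<and>
     (\<forall>u<k. \<not> halted prog ((step w prog ^^ u) c) \<and>
        accessed (prog ! pc ((step w prog ^^ u) c)) ((step w prog ^^ u) c) \<subseteq> {..<s})"

lemma reach_0: "reach w prog s 0 c c"
  by (simp add: reach_def)

lemma reach_1:
  assumes "pc c < length prog" "accessed (prog ! pc c) c \<subseteq> {..<s}" "exec w (prog ! pc c) c = c'"
  shows "reach w prog s 1 c c'"
  using assms by (simp add: reach_def step_def halted_def)

text \<open>The reason for \<open>reach\<close> beside \<open>runs\<close>: it does not ask the last
  configuration to be halted, so the runs of consecutive code fragments compose.\<close>

lemma reach_trans:
  assumes "reach w prog s k c c'" "reach w prog s l c' c''"
  shows "reach w prog s (k + l) c c''"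
proof -
  have *: "(step w prog ^^ (k + u)) c = (step w prog ^^ u) c'" for u
    using assms(1) by (simp add: reach_def funpow_add add.commute[of k])
  have "u < k \<or> (\<exists>v<l. u = k + v)" if "u < k + l" for u
    using that by (metis add_less_cancel_left le_Suc_ex linorder_not_less)
  then show ?thesis
    using assms * unfolding reach_def by metis
qed

declare add_2_eq_Suc' [simp del]

definition code_at :: "instr list \<Rightarrow> nat \<Rightarrow> instr list \<Rightarrow> bool" where
  "code_at prog p xs \<longleftrightarrow> (\<exists>pre post. prog = pre @ xs @ post \<and> length pre = p)"

lemma code_at_append:
  assumes "code_at prog p (xs @ ys)"
  shows "code_at prog p xs" "code_at prog (p + length xs) ys"
proof -
  from assms obtain pre post where *: "prog = pre @ (xs @ ys) @ post" "length pre = p"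
    by (auto simp: code_at_def)
  show "code_at prog p xs" using * unfolding code_at_def
    by (intro exI[of _ pre] exI[of _ "ys @ post"]) auto
  show "code_at prog (p + length xs) ys" using * unfolding code_at_def
    by (intro exI[of _ "pre @ xs"] exI[of _ post]) auto
qed

lemma code_at_suffix:
  assumes "code_at prog p zs" "zs = xs @ ys" "q = p + length xs"
  shows "code_at prog q ys"
  using assms code_at_append(2) by blast

lemma code_at_Cons:
  assumes "code_at prog p (x # ys)"
  shows "p < length prog" "prog ! p = x" "code_at prog (Suc p) ys"
proof -
  from assms obtain pre post where *: "prog = pre @ (x # ys) @ post" "length pre = p"
    by (auto simp: code_at_def)
  show "p < length prog" "prog ! p = x" using * by auto
  show "code_at prog (Suc p) ys" using * unfolding code_at_def
    by (intro exI[of _ "pre @ [x]"] exI[of _ post]) auto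
qed

abbreviation cfg :: "nat \<Rightarrow> (nat \<Rightarrow> nat) \<Rightarrow> (nat \<Rightarrow> nat) \<Rightarrow> config" where
  "cfg p r m \<equiv> \<lparr>pc = p, reg = r, mem = m\<rparr>"

lemma reach_instr:
  assumes "code_at prog p (i # is)" "accessed i (cfg p r m) \<subseteq> {..<s}"
    "exec w i (cfg p r m) = c'"
  shows "reach w prog s 1 (cfg p r m) c'"
  by (rule reach_1) (use assms code_at_Cons[OF assms(1)] in auto)

lemma length_cexp[simp]: "length (cexp d e) = esz e"
  by (induction d e rule: cexp.induct) auto

lemma length_ccond[simp]: "length (ccond b) = csz b"
  by (simp add: ccond_def csz_def)

lemma binop_aval: "aok w f x y \<Longrightarrow> binop_val w f x y = aval f x y"
proof (cases f)
  case Sub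
  assume "aok w f x y"
  then have *: "x + 2 ^ w - y = x - y + 2 ^ w" "x - y < 2 ^ w" using Sub by auto
  show ?thesis using *(2) by (simp only: Sub binop_val.simps aval.simps *(1) mod_add_self2 mod_less)
qed auto

text \<open>The machine registers \<open>rm\<close> may differ from the source registers
  \<open>r\<close> from \<open>tmp\<close> on, where earlier evaluations have left their values.
  Since \<open>e\<close> mentions only registers below \<open>tmp\<close>, its value is still the
  one in \<open>r\<close>.\<close>

lemma cexp_reach:
  assumes "code_at prog p (cexp d e)" "ok w s e r m" "\<forall>x<tmp. rm x = r x"
    "tmp \<le> d" "evars e \<subseteq> {..<tmp}"
  shows "\<exists>rm'. reach w prog s (esz e) (cfg p rm m) (cfg (p + esz e) rm' m) \<and>
      (\<forall>x<d. rm' x = rm x) \<and> rm' d = ev e r m"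
  using assms
proof (induction e arbitrary: p d rm)
  case (Num k)
  then have c: "code_at prog p [Const d k]" by simp
  have "reach w prog s 1 (cfg p rm m) (cfg (p + 1) (rm(d := k)) m)"
    by (rule reach_instr[OF c]) (use Num in simp_all)
  then show ?case by (intro exI[of _ "rm(d := k)"]) (simp add: fun_upd_def)
next
  case (Reg x)
  then have c: "code_at prog p [Move d x]" by simp
  have "reach w prog s 1 (cfg p rm m) (cfg (p + 1) (rm(d := r x)) m)"
    by (rule reach_instr[OF c]) (use Reg in simp_all)
  then show ?case by (intro exI[of _ "rm(d := r x)"]) (simp add: fun_upd_def)
next
  case (Mem e)
  from Mem.prems(1) have c: "code_at prog p (cexp d e)" "code_at prog (p + esz e) [Load d d]"
    using code_at_append[of prog p "cexp d e"] by auto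
  obtain rm' where rm': "reach w prog s (esz e) (cfg p rm m) (cfg (p + esz e) rm' m)"
    "\<forall>x<d. rm' x = rm x" "rm' d = ev e r m"
    using Mem.IH[OF c(1), of rm] Mem.prems by auto
  have "reach w prog s 1 (cfg (p + esz e) rm' m) (cfg (Suc (p + esz e)) (rm'(d := m (ev e r m))) m)"
    by (rule reach_instr[OF c(2)]) (use rm' Mem.prems in auto)
  from reach_trans[OF rm'(1) this] show ?case
    using rm' by (intro exI[of _ "rm'(d := m (ev e r m))"]) (auto simp: fun_upd_def)
next
  case (Bin f a b)
  from Bin.prems(1) have c: "code_at prog p (cexp d a)" "code_at prog (p + esz a) (cexp (Suc d) b)"
    "code_at prog (p + esz a + esz b) [Op f d d (Suc d)]"
    using code_at_append[of prog p "cexp d a"]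
      code_at_append[of prog "p + esz a" "cexp (Suc d) b"] by auto
  obtain rm1 where rm1: "reach w prog s (esz a) (cfg p rm m) (cfg (p + esz a) rm1 m)"
    "\<forall>x<d. rm1 x = rm x" "rm1 d = ev a r m"
    using Bin.IH(1)[OF c(1), of rm] Bin.prems by auto
  obtain rm2 where rm2: "reach w prog s (esz b) (cfg (p + esz a) rm1 m) (cfg (p + esz a + esz b) rm2 m)"
    "\<forall>x<Suc d. rm2 x = rm1 x" "rm2 (Suc d) = ev b r m"
    using Bin.IH(2)[OF c(2), of rm1] Bin.prems rm1 by auto
  have "reach w prog s 1 (cfg (p + esz a + esz b) rm2 m)
    (cfg (Suc (p + esz a + esz b)) (rm2(d := ev (Bin f a b) r m)) m)"
    by (rule reach_instr[OF c(3)]) (use rm1 rm2 Bin.prems in \<open>auto simp: binop_aval\<close>)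
  from reach_trans[OF reach_trans[OF rm1(1) rm2(1)] this] show ?case
    using rm1 rm2 by (intro exI[of _ "rm2(d := ev (Bin f a b) r m)"]) (auto simp: add_ac fun_upd_def)
qed

lemma two_exps_reach:
  assumes "code_at prog p (cexp tmp a @ cexp (Suc tmp) b)" "ok w s a r m" "ok w s b r m"
    "\<forall>x<tmp. rm x = r x" "evars a \<union> evars b \<subseteq> {..<tmp}"
  shows "\<exists>rm'. reach w prog s (esz a + esz b) (cfg p rm m) (cfg (p + (esz a + esz b)) rm' m) \<and>
      (\<forall>x<tmp. rm' x = r x) \<and> rm' tmp = ev a r m \<and> rm' (Suc tmp) = ev b r m"
proof -
  obtain rm1 where rm1: "reach w prog s (esz a) (cfg p rm m) (cfg (p + esz a) rm1 m)"
    "\<forall>x<tmp. rm1 x = rm x" "rm1 tmp = ev a r m"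
    using cexp_reach[OF code_at_append(1)[OF assms(1)]] assms by (metis le_refl le_sup_iff)
  obtain rm2 where rm2: "reach w prog s (esz b) (cfg (p + esz a) rm1 m) (cfg (p + esz a + esz b) rm2 m)"
    "\<forall>x<Suc tmp. rm2 x = rm1 x" "rm2 (Suc tmp) = ev b r m"
    using cexp_reach[OF code_at_append(2)[OF assms(1)], of w s r m rm1] assms rm1 by auto
  show ?thesis
    using reach_trans[OF rm1(1) rm2(1)] rm1 rm2 assms(4)
    by (intro exI[of _ rm2]) (auto simp: add_ac)
qed

lemma ccond_reach:
  assumes "code_at prog p (ccond b @ cjump b tmp (Suc tmp) l # is)" "cok w s b r m"
    "\<forall>x<tmp. rm x = r x" "evars (cfst b) \<union> evars (csnd b) \<subseteq> {..<tmp}"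
  shows "\<exists>rm'. reach w prog s (csz b + 1) (cfg p rm m)
      (cfg (if cev b r m then l else p + csz b + 1) rm' m) \<and> (\<forall>x<tmp. rm' x = r x)"
proof -
  note c = code_at_append[OF assms(1)]
  obtain rm1 where rm1: "reach w prog s (csz b) (cfg p rm m) (cfg (p + csz b) rm1 m)"
    "\<forall>x<tmp. rm1 x = r x" "rm1 tmp = ev (cfst b) r m" "rm1 (Suc tmp) = ev (csnd b) r m"
    using two_exps_reach[OF c(1)[unfolded ccond_def] _ _ assms(3,4)] assms(2)
    unfolding cok_def csz_def by blast
  have "reach w prog s 1 (cfg (p + csz b) rm1 m) (cfg (if cev b r m then l else p + csz b + 1) rm1 m)"
    by (rule reach_instr[OF c(2)[simplified]]; cases b) (use rm1 in auto)
  from reach_trans[OF rm1(1) this] rm1(2) show ?thesis by blast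
qed

text \<open>By induction on the derivation, for all load addresses at once. The time claim is an
  inequality because a then branch is charged for a jump that it does not make.\<close>

lemma ccom_reach:
  assumes "big w s c \<sigma> \<sigma>'" "code_at prog p (ccom p c)" "legal c" "\<forall>x<tmp. rm x = fst \<sigma> x"
  shows "\<exists>k rm'. reach w prog s k (cfg p rm (fst (snd \<sigma>)))
      (cfg (p + length (ccom p c)) rm' (fst (snd \<sigma>'))) \<and>
      (\<forall>x<tmp. rm' x = fst \<sigma>' x) \<and> snd (snd \<sigma>) + k \<le> snd (snd \<sigma>')"
  using assms
proof (induction arbitrary: p rm)
  case (big_Skip \<sigma>)
  then show ?case using reach_0 by fastforce
next
  case (big_Assign e r m x t)
  obtain rm1 where rm1: "reach w prog s (esz e) (cfg p rm m) (cfg (p + esz e) rm1 m)"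
    "\<forall>x<tmp. rm1 x = rm x" "rm1 tmp = ev e r m"
    using cexp_reach[of prog p tmp e w s r m rm] big_Assign code_at_append[of prog p "cexp tmp e"] by auto
  have "code_at prog (p + esz e) [Move x tmp]"
    using big_Assign code_at_append[of prog p "cexp tmp e"] by auto
  then have "reach w prog s 1 (cfg (p + esz e) rm1 m) (cfg (Suc (p + esz e)) (rm1(x := ev e r m)) m)"
    by (rule reach_instr) (use rm1 in auto)
  from reach_trans[OF rm1(1) this] show ?case using rm1 big_Assign.prems
    by (intro exI[of _ "esz e + 1"] exI[of _ "rm1(x := ev e r m)"]) (auto simp: fun_upd_def)
next
  case (big_Put a r m b t)
  have c: "code_at prog p (cexp tmp a @ cexp (Suc tmp) b)"
    "code_at prog (p + (esz a + esz b)) [Store tmp (Suc tmp)]"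
    using big_Put.prems(1) code_at_append[of prog p "cexp tmp a @ cexp (Suc tmp) b"] by auto
  obtain rm1 where rm1: "reach w prog s (esz a + esz b) (cfg p rm m) (cfg (p + (esz a + esz b)) rm1 m)"
    "\<forall>x<tmp. rm1 x = r x" "rm1 tmp = ev a r m" "rm1 (Suc tmp) = ev b r m"
    using two_exps_reach[OF c(1), of w s r m rm] big_Put by auto
  have "reach w prog s 1 (cfg (p + (esz a + esz b)) rm1 m)
    (cfg (Suc (p + (esz a + esz b))) rm1 (m(ev a r m := ev b r m)))"
    by (rule reach_instr[OF c(2)]) (use rm1 big_Put in auto)
  from reach_trans[OF rm1(1) this] show ?case using rm1
    by (intro exI[of _ "esz a + esz b + 1"] exI[of _ "rm1"]) (auto simp: fun_upd_def)
next
  case (big_Seq c \<sigma> \<sigma>' d \<sigma>'')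
  let ?q = "p + length (ccom p c)"
  have l: "legal c" "legal d" using big_Seq.prems by auto
  have c: "code_at prog p (ccom p c)" "code_at prog ?q (ccom ?q d)"
    using big_Seq.prems(1) code_at_append[of prog p "ccom p c"] by (auto simp: Let_def)
  obtain k rm1 where 1: "reach w prog s k (cfg p rm (fst (snd \<sigma>))) (cfg ?q rm1 (fst (snd \<sigma>')))"
    "\<forall>x<tmp. rm1 x = fst \<sigma>' x" "snd (snd \<sigma>) + k \<le> snd (snd \<sigma>')"
    using big_Seq.IH(1)[OF c(1) l(1) big_Seq.prems(3)] by blast
  obtain l rm2 where 2: "reach w prog s l (cfg ?q rm1 (fst (snd \<sigma>')))
      (cfg (?q + length (ccom ?q d)) rm2 (fst (snd \<sigma>'')))"
    "\<forall>x<tmp. rm2 x = fst \<sigma>'' x" "snd (snd \<sigma>') + l \<le> snd (snd \<sigma>'')"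
    using big_Seq.IH(2)[OF c(2) l(2) 1(2)] by blast
  show ?case using reach_trans[OF 1(1) 2(1)] 1 2
    by (intro exI[of _ "k + l"] exI[of _ "rm2"]) (auto simp: Let_def add_ac)
next
  case (big_IfT b r m c t \<sigma> d)
  let ?p1 = "p + csz b + 1"
  let ?ds = "ccom ?p1 d"
  let ?q = "?p1 + length ?ds + 1"
  let ?cs = "ccom ?q c"
  have full: "code_at prog p (ccond b @ cjump b tmp (Suc tmp) ?q # (?ds @ Jump (?q + length ?cs) # ?cs))"
    using big_IfT.prems(1) by (simp add: Let_def)
  have c2: "code_at prog ?q ?cs"
    by (rule code_at_suffix[OF full, of "ccond b @ cjump b tmp (Suc tmp) ?q # ?ds @ [Jump (?q + length ?cs)]"])
      auto
  obtain rm1 where 1: "reach w prog s (csz b + 1) (cfg p rm m) (cfg ?q rm1 m)" "\<forall>x<tmp. rm1 x = r x"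
    using ccond_reach[OF full big_IfT.hyps(1), of rm] big_IfT.hyps(2) big_IfT.prems(2,3)
    unfolding legal.simps fst_conv by auto
  obtain k rm2 where 2: "reach w prog s k (cfg ?q rm1 m) (cfg (?q + length ?cs) rm2 (fst (snd \<sigma>)))"
    "\<forall>x<tmp. rm2 x = fst \<sigma> x" "t + csz b + 2 + k \<le> snd (snd \<sigma>)"
    using big_IfT.IH[OF c2, of rm1] 1(2) big_IfT.prems(2) unfolding legal.simps fst_conv snd_conv by blast
  show ?case using reach_trans[OF 1(1) 2(1)] 2
    by (intro exI[of _ "csz b + 1 + k"] exI[of _ "rm2"]) (auto simp: Let_def add_ac)
next
  case (big_IfF b r m d t \<sigma> c)
  let ?p1 = "p + csz b + 1"
  let ?ds = "ccom ?p1 d"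
  let ?q = "?p1 + length ?ds + 1"
  let ?cs = "ccom ?q c"
  have full: "code_at prog p (ccond b @ cjump b tmp (Suc tmp) ?q # (?ds @ Jump (?q + length ?cs) # ?cs))"
    using big_IfF.prems(1) by (simp add: Let_def)
  have c2: "code_at prog ?p1 (?ds @ Jump (?q + length ?cs) # ?cs)"
    by (rule code_at_suffix[OF full, of "ccond b @ [cjump b tmp (Suc tmp) ?q]"]) auto
  obtain rm1 where 1: "reach w prog s (csz b + 1) (cfg p rm m) (cfg ?p1 rm1 m)" "\<forall>x<tmp. rm1 x = r x"
    using ccond_reach[OF full big_IfF.hyps(1), of rm] big_IfF.hyps(2) big_IfF.prems(2,3)
    unfolding legal.simps fst_conv by auto
  obtain k rm2 where 2: "reach w prog s k (cfg ?p1 rm1 m) (cfg (?p1 + length ?ds) rm2 (fst (snd \<sigma>)))"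
    "\<forall>x<tmp. rm2 x = fst \<sigma> x" "t + csz b + 2 + k \<le> snd (snd \<sigma>)"
    using big_IfF.IH[OF code_at_append(1)[OF c2], of rm1] 1(2) big_IfF.prems(2)
    unfolding legal.simps fst_conv snd_conv by blast
  have 3: "reach w prog s 1 (cfg (?p1 + length ?ds) rm2 (fst (snd \<sigma>))) (cfg (?q + length ?cs) rm2 (fst (snd \<sigma>)))"
    by (rule reach_instr[OF code_at_append(2)[OF c2]]) auto
  show ?case using reach_trans[OF reach_trans[OF 1(1) 2(1)] 3] 2
    by (intro exI[of _ "csz b + 1 + k + 1"] exI[of _ "rm2"]) (auto simp: Let_def add_ac)
next
  case (big_LoopT b r m c t \<sigma> \<sigma>')
  let ?q = "p + csz b + 2"
  let ?cs = "ccom ?q c"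
  let ?e = "?q + length ?cs + 1"
  have full: "code_at prog p (ccond b @ cjump b tmp (Suc tmp) ?q # ([Jump ?e] @ ?cs @ [Jump p]))"
    using big_LoopT.prems(1) by (simp add: Let_def)
  have c2: "code_at prog ?q (?cs @ [Jump p])"
    by (rule code_at_suffix[OF full, of "ccond b @ [cjump b tmp (Suc tmp) ?q, Jump ?e]"]) auto
  obtain rm1 where 1: "reach w prog s (csz b + 1) (cfg p rm m) (cfg ?q rm1 m)" "\<forall>x<tmp. rm1 x = r x"
    using ccond_reach[OF full big_LoopT.hyps(1), of rm] big_LoopT.hyps(2) big_LoopT.prems(2,3)
    unfolding legal.simps fst_conv by auto
  obtain k rm2 where 2: "reach w prog s k (cfg ?q rm1 m) (cfg (?q + length ?cs) rm2 (fst (snd \<sigma>)))"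
    "\<forall>x<tmp. rm2 x = fst \<sigma> x" "t + csz b + 2 + k \<le> snd (snd \<sigma>)"
    using big_LoopT.IH(1)[OF code_at_append(1)[OF c2], of rm1] 1(2) big_LoopT.prems(2)
    unfolding legal.simps fst_conv snd_conv by blast
  have 3: "reach w prog s 1 (cfg (?q + length ?cs) rm2 (fst (snd \<sigma>))) (cfg p rm2 (fst (snd \<sigma>)))"
    by (rule reach_instr[OF code_at_append(2)[OF c2]]) auto
  obtain l rm3 where 4: "reach w prog s l (cfg p rm2 (fst (snd \<sigma>)))
      (cfg (p + length (ccom p (Loop b c))) rm3 (fst (snd \<sigma>')))"
    "\<forall>x<tmp. rm3 x = fst \<sigma>' x" "snd (snd \<sigma>) + l \<le> snd (snd \<sigma>')"
    using big_LoopT.IH(2)[OF big_LoopT.prems(1,2) 2(2)] by blast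
  show ?case using reach_trans[OF reach_trans[OF reach_trans[OF 1(1) 2(1)] 3] 4(1)] 2 4
    by (intro exI[of _ "csz b + 1 + k + 1 + l"] exI[of _ "rm3"]) auto
next
  case (big_LoopF b r m c t)
  let ?q = "p + csz b + 2"
  let ?cs = "ccom ?q c"
  let ?e = "?q + length ?cs + 1"
  have full: "code_at prog p (ccond b @ cjump b tmp (Suc tmp) ?q # ([Jump ?e] @ ?cs @ [Jump p]))"
    using big_LoopF.prems(1) by (simp add: Let_def)
  have c2: "code_at prog (p + csz b + 1) (Jump ?e # ?cs @ [Jump p])"
    by (rule code_at_suffix[OF full, of "ccond b @ [cjump b tmp (Suc tmp) ?q]"]) auto
  obtain rm1 where 1: "reach w prog s (csz b + 1) (cfg p rm m) (cfg (p + csz b + 1) rm1 m)" "\<forall>x<tmp. rm1 x = r x"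
    using ccond_reach[OF full big_LoopF.hyps(1), of rm] big_LoopF.hyps(2) big_LoopF.prems(2,3)
    unfolding legal.simps fst_conv by auto
  have 3: "reach w prog s 1 (cfg (p + csz b + 1) rm1 m) (cfg ?e rm1 m)"
    by (rule reach_instr[OF c2]) auto
  have e: "?e = p + length (ccom p (Loop b c))" by (simp add: Let_def)
  show ?case using reach_trans[OF 1(1) 3, unfolded e] 1(2)
    by (intro exI[of _ "csz b + 1 + 1"] exI[of _ "rm1"]) (simp del: ccom.simps)
qed

text \<open>A single derivation contains termination, the time bound and the space bound; this is
  why \<open>wp\<close> below only asks for the existence of one.\<close>

theorem runs_ccom:
  assumes "big w s c (r, m, 0) (r', m', T)" "legal c"
  shows "\<exists>t c'. runs w (ccom 0 c) (cfg 0 r m) t s c' \<and> t \<le> T \<and> (\<forall>x<tmp. reg c' x = r' x) \<and> mem c' = m'"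
proof -
  have "code_at (ccom 0 c) 0 (ccom 0 c)" by (auto simp: code_at_def)
  from ccom_reach[OF assms(1) this assms(2), of r] obtain k rm' where
    "reach w (ccom 0 c) s k (cfg 0 r m) (cfg (length (ccom 0 c)) rm' m')"
    "\<forall>x<tmp. rm' x = r' x" "k \<le> T" by auto
  then show ?thesis unfolding reach_def runs_def Let_def
    by (intro exI[of _ k] exI[of _ "cfg (length (ccom 0 c)) rm' m'"]) (auto simp: halted_def)
qed

section \<open>Weakest preconditions for total correctness\<close>

definition wp :: "nat \<Rightarrow> nat \<Rightarrow> com \<Rightarrow> (state \<Rightarrow> bool) \<Rightarrow> state \<Rightarrow> bool" where
  "wp w s c Q \<sigma> \<longleftrightarrow> (\<exists>\<sigma>'. big w s c \<sigma> \<sigma>' \<and> Q \<sigma>')"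

inductive_cases big_elims: "big w s Skip \<sigma> \<sigma>'" "big w s (Assign x e) \<sigma> \<sigma>'" "big w s (Put a b) \<sigma> \<sigma>'"
  "big w s (Seq c d) \<sigma> \<sigma>'" "big w s (Ifte b c d) \<sigma> \<sigma>'"

lemma wp_Skip[simp]: "wp w s Skip Q \<sigma> = Q \<sigma>"
  unfolding wp_def by (safe elim!: big_elims; blast intro: big.intros)

lemma wp_Assign[simp]: "wp w s (Assign x e) Q (r, m, t) =
    (ok w s e r m \<and> Q (r(x := ev e r m), m, t + esz e + 1))"
  unfolding wp_def
  by (rule iffI, elim exE conjE big_elims, simp, intro exI conjI, rule big_Assign, auto)

lemma wp_Put[simp]: "wp w s (Put a b) Q (r, m, t) =
    (ok w s a r m \<and> ok w s b r m \<and> ev a r m < s \<and> Q (r, m(ev a r m := ev b r m), t + esz a + esz b + 1))"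
  unfolding wp_def
  by (rule iffI, elim exE conjE big_elims, simp, intro exI conjI, rule big_Put, auto)

lemma wp_Seq[simp]: "wp w s (Seq c d) Q \<sigma> = wp w s c (wp w s d Q) \<sigma>"
  unfolding wp_def by (safe elim!: big_elims; blast intro: big.intros)

lemma wp_Ifte[simp]: "wp w s (Ifte b c d) Q (r, m, t) =
    (cok w s b r m \<and> (if cev b r m then wp w s c Q (r, m, t + csz b + 2) else wp w s d Q (r, m, t + csz b + 2)))"
  unfolding wp_def by (cases "cev b r m"; simp only: if_True if_False not_True_eq_False not_False_eq_True;
    safe elim!: big_elims; blast intro: big.intros)

lemma wp_LoopT: "cok w s b r m \<Longrightarrow> cev b r m \<Longrightarrow> wp w s c (wp w s (Loop b c) Q) (r, m, t + csz b + 2) \<Longrightarrow>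
    wp w s (Loop b c) Q (r, m, t)"
  unfolding wp_def by (blast intro: big_LoopT)

lemma wp_LoopF: "cok w s b r m \<Longrightarrow> \<not> cev b r m \<Longrightarrow> Q (r, m, t + csz b + 2) \<Longrightarrow>
    wp w s (Loop b c) Q (r, m, t)"
  unfolding wp_def by (blast intro: big_LoopF)

lemma wp_mono: "wp w s c Q \<sigma> \<Longrightarrow> (\<And>\<sigma>'. Q \<sigma>' \<Longrightarrow> Q' \<sigma>') \<Longrightarrow> wp w s c Q' \<sigma>"
  unfolding wp_def by blast

text \<open>For loops that count up to a known \<open>q\<close>. The invariant is indexed by the
  counter and also speaks about the clock, so that running times come out of the same induction as
  functional correctness.\<close>

lemma wp_for:
  assumes "I i r m t" "i \<le> q"
    and "\<And>j r m t. i \<le> j \<Longrightarrow> j < q \<Longrightarrow> I j r m t \<Longrightarrow> cok w s b r m \<and> cev b r m \<and>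
      wp w s c (\<lambda>(r, m, t). I (Suc j) r m t) (r, m, t + csz b + 2)"
    and "\<And>r m t. I q r m t \<Longrightarrow> cok w s b r m \<and> \<not> cev b r m \<and> Q (r, m, t + csz b + 2)"
  shows "wp w s (Loop b c) Q (r, m, t)"
  using assms(2,1,3)
proof (induction i arbitrary: r m t rule: inc_induct)
  case base
  then show ?case using assms(4) by (blast intro: wp_LoopF)
next
  case (step i)
  note st = step.prems(2)[OF order_refl step.hyps(2) step.prems(1)]
  have "wp w s c (wp w s (Loop b c) Q) (r, m, t + csz b + 2)"
    by (rule wp_mono[OF st[THEN conjunct2, THEN conjunct2]], clarify, rule step.IH, assumption)
      (rule step.prems(2); linarith?; assumption)
  then show ?case using st by (intro wp_LoopT) auto
qed

declare add_2_eq_Suc' [simp]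

text \<open>For loops whose number of rounds depends on the data; a measure on the registers
  replaces the counter.\<close>

lemma wp_while:
  fixes f :: "(nat \<Rightarrow> nat) \<Rightarrow> nat"
  assumes "I r m t"
    and "\<And>r m t. I r m t \<Longrightarrow> cok w s b r m \<and>
      (if cev b r m then wp w s c (\<lambda>(r', m', t'). I r' m' t' \<and> f r' < f r) (r, m, t + csz b + 2)
       else Q (r, m, t + csz b + 2))"
  shows "wp w s (Loop b c) Q (r, m, t)"
  using assms(1)
proof (induction "f r" arbitrary: r m t rule: less_induct)
  case less
  note st = assms(2)[OF less.prems]
  show ?case
  proof (cases "cev b r m")
    case True
    with st have "wp w s c (\<lambda>(r', m', t'). I r' m' t' \<and> f r' < f r) (r, m, t + csz b + 2)" by simp
    then have "wp w s c (wp w s (Loop b c) Q) (r, m, t + csz b + 2)"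
      by (rule wp_mono) (auto intro: less.hyps)
    then show ?thesis using st True by (intro wp_LoopT) auto
  next
    case False
    then show ?thesis using st by (intro wp_LoopF) auto
  qed
qed


section \<open>Longest common subsequences\<close>

lemma finite_common_subseq: "finite {Z. common_subseq A B Z}"
proof (rule finite_subset)
  show "{Z. common_subseq A B Z} \<subseteq> {Z. set Z \<subseteq> set A \<and> length Z \<le> length A}"
    by (auto simp: common_subseq_def dest: list_emb_set list_emb_length)
  show "finite {Z. set Z \<subseteq> set A \<and> length Z \<le> length A}"
    by (rule finite_lists_length_le) simp
qed

lemma length_le_lcs: "subseq Z A \<Longrightarrow> subseq Z B \<Longrightarrow> length Z \<le> lcs A B"
  unfolding lcs_def by (rule Max_ge) (auto simp: finite_common_subseq common_subseq_def)

lemma lcs_attained: "\<exists>Z. subseq Z A \<and> subseq Z B \<and> length Z = lcs A B"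
proof -
  have "lcs A B \<in> length ` {Z. common_subseq A B Z}"
    unfolding lcs_def by (rule Max_in) (auto simp: finite_common_subseq common_subseq_def)
  then show ?thesis by (auto simp: common_subseq_def)
qed

lemma lcs_le1: "lcs A B \<le> length A"
  using lcs_attained[of A B] by (metis list_emb_length)

lemma lcs_le2: "lcs A B \<le> length B"
  using lcs_attained[of A B] by (metis list_emb_length)

lemma lcs_Nil[simp]: "lcs [] B = 0" "lcs A [] = 0"
  using lcs_le1[of "[]"] lcs_le2[of _ "[]"] by auto

lemma lcs_mono: "subseq A A' \<Longrightarrow> subseq B B' \<Longrightarrow> lcs A B \<le> lcs A' B'"
  using lcs_attained[of A B] by (metis length_le_lcs subseq_order.order_trans)

lemma lcs_append: "lcs A B + lcs A' B' \<le> lcs (A @ A') (B @ B')"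
proof -
  obtain Z Z' where "subseq Z A" "subseq Z B" "length Z = lcs A B"
    "subseq Z' A'" "subseq Z' B'" "length Z' = lcs A' B'"
    using lcs_attained by metis
  then show ?thesis using length_le_lcs[of "Z @ Z'" "A @ A'" "B @ B'"] by (auto simp: list_emb_append_mono)
qed

lemma subseq_snocD:
  assumes "subseq Z (A @ [x])"
  shows "subseq Z A \<or> (\<exists>Z'. Z = Z' @ [x] \<and> subseq Z' A)"
proof -
  obtain Z1 Z2 where "Z = Z1 @ Z2" "subseq Z1 A" "subseq Z2 [x]"
    using assms subseq_append_iff by metis
  then show ?thesis by (cases Z2) (auto split: if_splits)
qed

text \<open>Keeping all three options even when \<open>x = y\<close> avoids the argument that equal
  last characters may always be paired. This is also the form that generalises to several sources,
  where the diagonal neighbour may be unreachable.\<close>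

lemma lcs_snoc:
  "lcs (A @ [x]) (B @ [y]) =
    max (max (lcs A (B @ [y])) (lcs (A @ [x]) B)) (if x = y then lcs A B + 1 else 0)"
proof (rule antisym)
  obtain Z where Z: "subseq Z (A @ [x])" "subseq Z (B @ [y])" "length Z = lcs (A @ [x]) (B @ [y])"
    using lcs_attained by metis
  show "lcs (A @ [x]) (B @ [y]) \<le>
    max (max (lcs A (B @ [y])) (lcs (A @ [x]) B)) (if x = y then lcs A B + 1 else 0)"
    using subseq_snocD[OF Z(1)]
  proof (elim disjE exE conjE)
    assume "subseq Z A"
    then show ?thesis using Z length_le_lcs[of Z A "B @ [y]"] by simp
  next
    fix Z' assume Z': "Z = Z' @ [x]" "subseq Z' A"
    show ?thesis using subseq_snocD[OF Z(2)]
    proof (elim disjE exE conjE)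
      assume "subseq Z B"
      then show ?thesis using Z length_le_lcs[of Z "A @ [x]" B] by simp
    next
      fix Z'' assume "Z = Z'' @ [y]" "subseq Z'' B"
      then show ?thesis using Z Z' length_le_lcs[of Z' A B] by simp
    qed
  qed
  have "lcs A B + 1 \<le> lcs (A @ [x]) (B @ [x])"
    using lcs_append[of A B "[x]" "[x]"] length_le_lcs[of "[x]" "[x]" "[x]"] by simp
  moreover have "lcs A (B @ [y]) \<le> lcs (A @ [x]) (B @ [y])" "lcs (A @ [x]) B \<le> lcs (A @ [x]) (B @ [y])"
    by (auto intro!: lcs_mono)
  ultimately show "max (max (lcs A (B @ [y])) (lcs (A @ [x]) B)) (if x = y then lcs A B + 1 else 0)
      \<le> lcs (A @ [x]) (B @ [y])"
    by auto
qed

lemma lcs_snoc_cases: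
  "lcs (A @ [x]) (B @ [y]) = lcs A (B @ [y]) \<or> lcs (A @ [x]) (B @ [y]) = lcs (A @ [x]) B \<or>
    x = y \<and> lcs (A @ [x]) (B @ [y]) = lcs A B + 1"
proof -
  have "z = p \<or> z = q \<or> b \<and> z = c" if "z = max (max p q) (if b then c else 0)" for z p q c :: nat and b
    using that by (auto simp: max_def split: if_splits)
  from this[OF lcs_snoc] show ?thesis .
qed

text \<open>An optimal subsequence is cut where it passes from \<open>X\<close> to
  \<open>X'\<close>, and its embedding into \<open>Y\<close> is cut accordingly. Together with
  \<open>lcs_append\<close> this yields Hirschberg's equation for the best column.\<close>

lemma lcs_split:
  "\<exists>k\<le>length Y. lcs (X @ X') Y \<le> lcs X (take k Y) + lcs X' (drop k Y)"
proof -
  obtain Z where Z: "subseq Z (X @ X')" "subseq Z Y" "length Z = lcs (X @ X') Y"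
    using lcs_attained by metis
  obtain Z1 Z2 where Z12: "Z = Z1 @ Z2" "subseq Z1 X" "subseq Z2 X'"
    using Z(1) subseq_append_iff by metis
  obtain Y1 Y2 where Y12: "Y = Y1 @ Y2" "subseq Z1 Y1" "subseq Z2 Y2"
    using Z(2) Z12(1) list_emb_appendD by metis
  show ?thesis
    using Z12 Y12 Z(3) length_le_lcs[of Z1 X Y1] length_le_lcs[of Z2 X' Y2]
    by (intro exI[of _ "length Y1"]) auto
qed

section \<open>Slices given by half-open index ranges\<close>

definition slice :: "'a list \<Rightarrow> nat \<Rightarrow> nat \<Rightarrow> 'a list" where
  "slice X a b = take (b - a) (drop a X)"

lemma slice_Nil[simp]: "b \<le> a \<Longrightarrow> slice X a b = []"
  by (simp add: slice_def)

lemma slice_0[simp]: "slice X 0 b = take b X"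
  by (simp add: slice_def)

lemma slice_all[simp]: "length X \<le> b \<Longrightarrow> slice X a b = drop a X"
  by (simp add: slice_def)

lemma length_slice: "b \<le> length X \<Longrightarrow> length (slice X a b) = b - a"
  by (simp add: slice_def)

lemma slice_Suc: "a \<le> b \<Longrightarrow> b < length X \<Longrightarrow> slice X a (Suc b) = slice X a b @ [X ! b]"
  by (simp add: slice_def Suc_diff_le take_Suc_conv_app_nth)

lemma slice_append: "a \<le> c \<Longrightarrow> c \<le> b \<Longrightarrow> slice X a b = slice X a c @ slice X c b"
proof -
  assume "a \<le> c" "c \<le> b"
  then have "b - a = (c - a) + (b - c)" "drop (c - a) (drop a X) = drop c X" by simp_all
  then show ?thesis by (simp only: slice_def take_add)
qed

lemma nth_slice: "a + k < b \<Longrightarrow> b \<le> length X \<Longrightarrow> slice X a b ! k = X ! (a + k)"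
  by (simp add: slice_def)

lemma take_slice: "k \<le> b - a \<Longrightarrow> take k (slice X a b) = slice X a (a + k)"
  by (simp add: slice_def)

lemma drop_slice: "drop k (slice X a b) = slice X (a + k) b"
  by (simp add: slice_def drop_take add.commute)

lemma slice_slice_subseq: "a \<le> b \<Longrightarrow> b \<le> b' \<Longrightarrow> subseq (slice X a b) (slice X a b')"
  using slice_append[of a b b' X] list_emb_prefix[OF subseq_order.order_refl] by metis

text \<open>The base case of the bisection, where a single character of \<open>A\<close> is
  left.\<close>

lemma lcs_singleton:
  fixes x :: 'a
  shows "common_subseq [x] Y (if x \<in> set Y then [x] else [])"
    "length (if x \<in> set Y then [x] else []) = lcs [x] Y"
proof -
  show "common_subseq [x] Y (if x \<in> set Y then [x] else [])"
    by (simp add: common_subseq_def subseq_singleton_left)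
  show "length (if x \<in> set Y then [x] else []) = lcs [x] Y"
  proof (cases "x \<in> set Y")
    case True
    then have "1 \<le> lcs [x] Y" using length_le_lcs[of "[x]" "[x]" Y] by (simp add: subseq_singleton_left)
    then show ?thesis using True lcs_le1[of "[x]" Y] by simp
  next
    case False
    obtain Z where Z: "subseq Z [x]" "subseq Z Y" "length Z = lcs [x] Y" using lcs_attained by blast
    have "Z = []"
    proof (cases Z)
      case (Cons z Z')
      then have "z = x" using Z(1) by (simp split: if_splits)
      then have "x \<in> set Y" using list_emb_set[OF Z(2), of z] Cons by auto
      then show ?thesis using False by simp
    qed simp
    then show ?thesis using Z False by simp
  qed
qed

lemma set_slice: "c' \<le> length X \<Longrightarrow> x \<in> set (slice X c c') \<longleftrightarrow> (\<exists>k. c \<le> k \<and> k < c' \<and> X ! k = x)"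
proof
  assume c': "c' \<le> length X"
  show "\<exists>k. c \<le> k \<and> k < c' \<and> X ! k = x" if "x \<in> set (slice X c c')"
  proof -
    obtain j where "j < c' - c" "slice X c c' ! j = x"
      using \<open>x \<in> set (slice X c c')\<close> length_slice[OF c', of c] by (auto simp: in_set_conv_nth)
    then show ?thesis using c' by (intro exI[of _ "c + j"]) (simp add: nth_slice)
  qed
  assume "\<exists>k. c \<le> k \<and> k < c' \<and> X ! k = x"
  then obtain k where "c \<le> k" "k < c'" "X ! k = x" by blast
  then have "k - c < length (slice X c c')" "slice X c c' ! (k - c) = x"
    using c' by (simp_all add: length_slice nth_slice)
  then show "x \<in> set (slice X c c')" using nth_mem by blast
qed

section \<open>A dynamic program with packed seeds\<close>

text \<open>A seed \<open>(a, b, x)\<close> offers the value \<open>x\<close> at the grid point \<open>(a, b)\<close>; each matched pair of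
  characters on the way from there adds \<open>M\<close>.  If \<open>x\<close> is itself of the form \<open>u * M + o\<close> with
  \<open>o < M\<close>, then the maximum carries the label \<open>o\<close> of an optimal seed along.\<close>

definition best :: "nat \<Rightarrow> 'a list \<Rightarrow> 'a list \<Rightarrow> (nat \<times> nat \<times> nat) set \<Rightarrow> nat \<Rightarrow> nat \<Rightarrow> nat \<Rightarrow> bool" where
  "best M X Y S i j v \<longleftrightarrow>
     (\<forall>(a, b, x) \<in> S. a \<le> i \<and> b \<le> j \<longrightarrow> x + M * lcs (slice X a i) (slice Y b j) \<le> v) \<and>
     (v = 0 \<or> (\<exists>(a, b, x) \<in> S. a \<le> i \<and> b \<le> j \<and> v = x + M * lcs (slice X a i) (slice Y b j)))"

lemma best_le: "best M X Y S i j v \<Longrightarrow> (a, b, x) \<in> S \<Longrightarrow> a \<le> i \<Longrightarrow> b \<le> j \<Longrightarrow>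
    x + M * lcs (slice X a i) (slice Y b j) \<le> v"
  unfolding best_def by blast

lemma best_attained: "best M X Y S i j v \<Longrightarrow> 0 < v \<Longrightarrow>
    \<exists>a b x. (a, b, x) \<in> S \<and> a \<le> i \<and> b \<le> j \<and> v = x + M * lcs (slice X a i) (slice Y b j)"
  unfolding best_def by fastforce

lemma bestI:
  assumes "\<And>a b x. (a, b, x) \<in> S \<Longrightarrow> a \<le> i \<Longrightarrow> b \<le> j \<Longrightarrow> x + M * lcs (slice X a i) (slice Y b j) \<le> v"
    and "0 < v \<Longrightarrow> \<exists>a b x. (a, b, x) \<in> S \<and> a \<le> i \<and> b \<le> j \<and> v \<le> x + M * lcs (slice X a i) (slice Y b j)"
  shows "best M X Y S i j v"
  unfolding best_def using assms by (fastforce intro: antisym)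

lemma best_mono:
  assumes "best M X Y S i j v" "best M X Y S i j' v'" "j \<le> j'"
  shows "v \<le> v'"
proof (cases "v = 0")
  case False
  then obtain a b x where s: "(a, b, x) \<in> S" "a \<le> i" "b \<le> j" "v = x + M * lcs (slice X a i) (slice Y b j)"
    using best_attained[OF assms(1)] by blast
  have "lcs (slice X a i) (slice Y b j) \<le> lcs (slice X a i) (slice Y b j')"
    using s assms(3) by (intro lcs_mono slice_slice_subseq) auto
  then have "M * lcs (slice X a i) (slice Y b j) \<le> M * lcs (slice X a i) (slice Y b j')" by simp
  with best_le[OF assms(2) s(1,2)] s assms(3) show ?thesis by linarith
qed simp

text \<open>The value 0 says that no seed reaches the cell, so a match may only extend a positive
  value; otherwise a path without a source would arise.\<close>

fun row_step :: "nat \<Rightarrow> (nat \<Rightarrow> nat) \<Rightarrow> nat \<Rightarrow> (nat \<Rightarrow> nat) \<Rightarrow> nat \<Rightarrow> nat" where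
  "row_step c y M v 0 = v 0"
| "row_step c y M v (Suc j) = max (max (v (Suc j)) (row_step c y M v j))
     (if c = y j \<and> 0 < v j then v j + M else 0)"

lemma row_step_cong:
  "(\<And>k. k < j \<Longrightarrow> y k = y' k) \<Longrightarrow> (\<And>k. k \<le> j \<Longrightarrow> v k = v' k) \<Longrightarrow>
    row_step c y M v j = row_step c y' M v' j"
  by (induction j) auto

lemma best_Suc_Suc:
  assumes S: "\<And>a b x. (a, b, x) \<in> S \<Longrightarrow> a \<le> i \<and> 0 < x" and ij: "i < length X" "j < length Y"
    and d: "best M X Y S i j d" and u: "best M X Y S i (Suc j) u" and l: "best M X Y S (Suc i) j l"
  shows "best M X Y S (Suc i) (Suc j) (max (max u l) (if X ! i = Y ! j \<and> 0 < d then d + M else 0))"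
    (is "best M X Y S _ _ ?v")
proof (rule bestI)
  fix a b x assume s: "(a, b, x) \<in> S" "a \<le> Suc i" "b \<le> Suc j"
  then have a: "a \<le> i" and x: "0 < x" using S by auto
  show "x + M * lcs (slice X a (Suc i)) (slice Y b (Suc j)) \<le> ?v"
  proof (cases "b = Suc j")
    case True
    \<comment> \<open>A seed in the new column has no character of \<open>Y\<close> left to match,
      so it already counts with its bare value in \<open>u\<close>.\<close>
    then show ?thesis using best_le[OF u s(1) a] by simp
  next
    case False
    then have b: "b \<le> j" using s by simp
    let ?A = "slice X a i" and ?B = "slice Y b j"
    note 1 = best_le[OF u s(1) a s(3), unfolded slice_Suc[OF b ij(2)]]
    note 2 = best_le[OF l s(1,2) b, unfolded slice_Suc[OF a ij(1)]]
    note 3 = best_le[OF d s(1) a b]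
    consider "lcs (?A @ [X ! i]) (?B @ [Y ! j]) = lcs ?A (?B @ [Y ! j])"
      | "lcs (?A @ [X ! i]) (?B @ [Y ! j]) = lcs (?A @ [X ! i]) ?B"
      | "X ! i = Y ! j" "lcs (?A @ [X ! i]) (?B @ [Y ! j]) = lcs ?A ?B + 1"
      using lcs_snoc_cases[of ?A "X ! i" ?B "Y ! j"] by blast
    then show ?thesis unfolding slice_Suc[OF a ij(1)] slice_Suc[OF b ij(2)]
      using 1 2 3 x by cases auto
  qed
next
  assume "0 < ?v"
  then consider "0 < u" "?v = u" | "0 < l" "?v = l" | "X ! i = Y ! j" "0 < d" "?v = d + M"
    by (auto simp: max_def split: if_splits)
  then show "\<exists>a b x. (a, b, x) \<in> S \<and> a \<le> Suc i \<and> b \<le> Suc j \<and>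
      ?v \<le> x + M * lcs (slice X a (Suc i)) (slice Y b (Suc j))"
  proof cases
    case 1
    then obtain a b x where s: "(a, b, x) \<in> S" "a \<le> i" "b \<le> Suc j"
      "u = x + M * lcs (slice X a i) (slice Y b (Suc j))"
      using best_attained[OF u] by blast
    have "lcs (slice X a i) (slice Y b (Suc j)) \<le> lcs (slice X a (Suc i)) (slice Y b (Suc j))"
      using s by (intro lcs_mono slice_slice_subseq) auto
    then show ?thesis using s 1 by (intro exI[of _ a] exI[of _ b] exI[of _ x]) auto
  next
    case 2
    then obtain a b x where s: "(a, b, x) \<in> S" "a \<le> Suc i" "b \<le> j"
      "l = x + M * lcs (slice X a (Suc i)) (slice Y b j)"
      using best_attained[OF l] by blast
    have "lcs (slice X a (Suc i)) (slice Y b j) \<le> lcs (slice X a (Suc i)) (slice Y b (Suc j))"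
      using s by (intro lcs_mono slice_slice_subseq) auto
    then show ?thesis using s 2 by (intro exI[of _ a] exI[of _ b] exI[of _ x]) auto
  next
    case 3
    then obtain a b x where s: "(a, b, x) \<in> S" "a \<le> i" "b \<le> j"
      "d = x + M * lcs (slice X a i) (slice Y b j)"
      using best_attained[OF d] by blast
    have "lcs (slice X a i) (slice Y b j) + 1 \<le> lcs (slice X a (Suc i)) (slice Y b (Suc j))"
      using s 3 ij by (simp add: slice_Suc lcs_snoc)
    then have "M * (lcs (slice X a i) (slice Y b j) + 1) \<le> M * lcs (slice X a (Suc i)) (slice Y b (Suc j))"
      by (rule mult_le_mono2)
    then show ?thesis using s 3 by (intro exI[of _ a] exI[of _ b] exI[of _ x]) (auto simp: algebra_simps)
  qed
qed

lemma best_row_step: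
  assumes S: "\<And>a b x. (a, b, x) \<in> S \<Longrightarrow> a \<le> i \<and> 0 < x" and i: "i < length X"
    and v: "\<And>j. j \<le> length Y \<Longrightarrow> best M X Y S i j (v j)"
  shows "j \<le> length Y \<Longrightarrow> best M X Y S (Suc i) j (row_step (X ! i) ((!) Y) M v j)"
proof (induction j)
  case 0
  \<comment> \<open>In column 0 nothing can be matched, and no seed lies in the new row, so the
    value is carried over.\<close>
  have "best M X Y S i 0 (v 0)" using v by simp
  then show ?case using S unfolding best_def by (fastforce simp: le_Suc_eq)
next
  case (Suc j)
  have "best M X Y S (Suc i) (Suc j) (max (max (v (Suc j)) (row_step (X ! i) ((!) Y) M v j))
      (if X ! i = Y ! j \<and> 0 < v j then v j + M else 0))"
    by (rule best_Suc_Suc[OF S i]) (use Suc v in auto)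
  then show ?case by simp
qed

fun row_steps :: "(nat \<Rightarrow> nat) \<Rightarrow> (nat \<Rightarrow> nat) \<Rightarrow> nat \<Rightarrow> (nat \<Rightarrow> nat) \<Rightarrow> nat \<Rightarrow> nat \<Rightarrow> nat" where
  "row_steps x y M v 0 = v"
| "row_steps x y M v (Suc k) = row_step (x k) y M (row_steps x y M v k)"

lemma best_row_steps:
  assumes S: "\<And>a b x. (a, b, x) \<in> S \<Longrightarrow> a \<le> i \<and> 0 < x"
    and v: "\<And>j. j \<le> length Y \<Longrightarrow> best M X Y S i j (v j)"
  shows "i + k \<le> length X \<Longrightarrow> j \<le> length Y \<Longrightarrow>
    best M X Y S (i + k) j (row_steps (\<lambda>k. X ! (i + k)) ((!) Y) M v k j)"
proof (induction k arbitrary: j)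
  case 0
  then show ?case using v by simp
next
  case (Suc k)
  have "best M X Y S (Suc (i + k)) j (row_step (X ! (i + k)) ((!) Y) M
      (row_steps (\<lambda>k. X ! (i + k)) ((!) Y) M v k) j)"
  proof (rule best_row_step)
    show "a \<le> i + k \<and> 0 < x" if "(a, b, x) \<in> S" for a b x using S[OF that] by simp
  qed (use Suc in auto)
  then show ?case by simp
qed

text \<open>A seed at \<open>(i, b)\<close> serves every \<open>(i, j)\<close> with
  \<open>b \<le> j\<close> at its bare value, since nothing is matched along a row; hence the
  running maximum of \<open>\<sigma>\<close>. An entry 0 of \<open>\<sigma>\<close> stands for a
  missing seed.\<close>

fun seed_row :: "(nat \<Rightarrow> nat) \<Rightarrow> (nat \<Rightarrow> nat) \<Rightarrow> nat \<Rightarrow> nat" where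
  "seed_row \<sigma> v 0 = max (\<sigma> 0) (v 0)"
| "seed_row \<sigma> v (Suc j) = max (max (seed_row \<sigma> v j) (\<sigma> (Suc j))) (v (Suc j))"

lemma seed_row_le: "v j \<le> seed_row \<sigma> v j" "b \<le> j \<Longrightarrow> \<sigma> b \<le> seed_row \<sigma> v j"
  by (induction j) (auto simp: le_Suc_eq le_max_iff_disj)

text \<open>The running maximum also passes over earlier entries of \<open>v\<close>. Monotonicity,
  which \<open>best_mono\<close> supplies, makes this harmless: they never exceed the entry at
  \<open>j\<close>.\<close>

lemma seed_row_cases:
  "(\<And>k. k < j \<Longrightarrow> v k \<le> v (Suc k)) \<Longrightarrow> seed_row \<sigma> v j = v j \<or> (\<exists>b\<le>j. seed_row \<sigma> v j = \<sigma> b)"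
proof (induction j)
  case (Suc j)
  have mono: "v j \<le> v (Suc j)" using Suc.prems by simp
  have IH: "seed_row \<sigma> v j = v j \<or> (\<exists>b\<le>j. seed_row \<sigma> v j = \<sigma> b)" using Suc by simp
  have "seed_row \<sigma> v (Suc j) = seed_row \<sigma> v j \<or> seed_row \<sigma> v (Suc j) = \<sigma> (Suc j)
    \<or> seed_row \<sigma> v (Suc j) = v (Suc j)" by (simp add: max_def)
  then show ?case
  proof (elim disjE)
    assume 1: "seed_row \<sigma> v (Suc j) = seed_row \<sigma> v j"
    have "v (Suc j) \<le> seed_row \<sigma> v (Suc j)" by simp
    with 1 mono IH show ?thesis by (metis le_SucI order_antisym)
  qed auto
qed (auto simp: max_def)

lemma best_seed_row:
  assumes v: "\<And>k. k \<le> j \<Longrightarrow> best M X Y S i k (v k)"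
    and S': "\<And>a b x. (a, b, x) \<in> S' \<longleftrightarrow> (a, b, x) \<in> S \<or> (a = i \<and> b \<le> q \<and> x = \<sigma> b \<and> 0 < x)" and "j \<le> q"
  shows "best M X Y S' i j (seed_row \<sigma> v j)"
proof (rule bestI)
  fix a b x assume s: "(a, b, x) \<in> S'" "a \<le> i" "b \<le> j"
  show "x + M * lcs (slice X a i) (slice Y b j) \<le> seed_row \<sigma> v j"
  proof (cases "(a, b, x) \<in> S")
    case True
    then show ?thesis using best_le[OF v[OF order_refl] True] s seed_row_le(1)[of v j \<sigma>] by linarith
  next
    case False
    then show ?thesis using s S' seed_row_le(2)[of b j \<sigma> v] by auto
  qed
next
  assume pos: "0 < seed_row \<sigma> v j"
  have "v k \<le> v (Suc k)" if "k < j" for k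
    using best_mono[OF v v, of k "Suc k"] that by simp
  then have "seed_row \<sigma> v j = v j \<or> (\<exists>b\<le>j. seed_row \<sigma> v j = \<sigma> b)"
    by (rule seed_row_cases)
  then show "\<exists>a b x. (a, b, x) \<in> S' \<and> a \<le> i \<and> b \<le> j \<and> seed_row \<sigma> v j \<le> x + M * lcs (slice X a i) (slice Y b j)"
  proof (elim disjE exE conjE)
    assume "seed_row \<sigma> v j = v j"
    then show ?thesis using best_attained[OF v[OF order_refl]] pos S' by fastforce
  next
    fix b assume b: "b \<le> j" "seed_row \<sigma> v j = \<sigma> b"
    then show ?thesis using pos S' assms(3) by (intro exI[of _ i] exI[of _ b] exI[of _ "\<sigma> b"]) auto
  qed
qed

text \<open>Ordinary prefix lengths arise when every cell of row 0 is a seed of value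
  \<open>M\<close>: the seed in column 0 wins, because it leaves the longest part of
  \<open>Y\<close>. The initial \<open>M\<close> keeps all values positive.\<close>

lemma best_uniform:
  assumes "best M X Y {(0, b, M) |b. b \<le> q} i j v" "0 < M"
  shows "v = M * (1 + lcs (take i X) (take j Y))"
proof -
  have "M + M * lcs (slice X 0 i) (slice Y 0 j) \<le> v" by (rule best_le[OF assms(1)]) auto
  moreover then have "0 < v" using assms(2) by linarith
  then obtain b where b: "b \<le> j" "v = M + M * lcs (slice X 0 i) (slice Y b j)"
    using best_attained[OF assms(1)] by auto
  have "lcs (slice X 0 i) (slice Y b j) \<le> lcs (slice X 0 i) (slice Y 0 j)"
    using b by (intro lcs_mono) (auto simp: slice_append[of 0 b j] simp del: slice_0)
  then have "v \<le> M + M * lcs (slice X 0 i) (slice Y 0 j)" using b by simp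
  ultimately show ?thesis by simp
qed

text \<open>Used against overflow: on top of its seed a path collects at most one \<open>M\<close>
  per character of \<open>Y\<close>.\<close>

lemma best_bound:
  assumes "best M X Y S i j v" "\<And>a b x. (a, b, x) \<in> S \<Longrightarrow> x \<le> U" "j \<le> length Y"
  shows "v \<le> U + M * length Y"
proof (cases "v = 0")
  case False
  then obtain a b x where s: "(a, b, x) \<in> S" "v = x + M * lcs (slice X a i) (slice Y b j)"
    using best_attained[OF assms(1)] by blast
  have "lcs (slice X a i) (slice Y b j) \<le> length Y"
    using lcs_le2[of "slice X a i" "slice Y b j"] length_slice[of j Y b] assms(3) by simp
  then have "M * lcs (slice X a i) (slice Y b j) \<le> M * length Y" by simp
  then show ?thesis using assms(2)[OF s(1)] s(2) by linarith
qed simp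

text \<open>A forward-only form of Hirschberg's step: the cells of row \<open>p\<close> become seeds
  that carry their prefix value and their own column as label, so the final value names the column
  where an optimal path crosses row \<open>p\<close>, and no reversed table is needed.\<close>

lemma crossing_column:
  assumes b: "best M X Y {(p, b, M * (1 + lcs (take p X) (take b Y)) + b) |b. b \<le> length Y} (length X) (length Y) v"
    and p: "p \<le> length X" and M: "length Y < M"
  shows "v mod M \<le> length Y"
    "lcs X Y = lcs (take p X) (take (v mod M) Y) + lcs (drop p X) (drop (v mod M) Y)"
proof -
  define f where "f b = lcs (take p X) (take b Y) + lcs (drop p X) (drop b Y)" for b
  have ge: "M * (1 + f b) + b \<le> v" if "b \<le> length Y" for b
    using best_le[OF b, of p b "M * (1 + lcs (take p X) (take b Y)) + b"] that p
    by (simp add: f_def algebra_simps)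
  have "0 < v" using ge[of 0] M by auto
  then obtain k where k: "k \<le> length Y" "v = M * (1 + f k) + k"
    using best_attained[OF b] by (auto simp: f_def algebra_simps)
  have "v = k + M * (1 + f k)" "k < M" using k M by simp_all
  then have vm: "v mod M = k" by (simp only: mod_mult_self2 mod_less)
  then show "v mod M \<le> length Y" using k by simp
  obtain b where b: "b \<le> length Y" "lcs (take p X @ drop p X) Y \<le> f b"
    using lcs_split[of Y "take p X" "drop p X"] unfolding f_def by blast
  have "M * (1 + f b) + b \<le> M * (1 + f k) + k" using ge[OF b(1)] k(2) by simp
  \<comment> \<open>Labels are smaller than \<open>M\<close>, so packed numbers are compared by
    their leading parts first.\<close>
  then have "M * (1 + f b) < M * (1 + f k + 1)" using k(1) M by (simp add: algebra_simps)
  then have "f b \<le> f k" unfolding mult_less_cancel1 by simp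
  moreover have "f k \<le> lcs (take p X @ drop p X) (take k Y @ drop k Y)"
    unfolding f_def by (rule lcs_append)
  ultimately have "lcs X Y = f k" using b(2) by simp
  then show "lcs X Y = lcs (take p X) (take (v mod M) Y) + lcs (drop p X) (drop (v mod M) Y)"
    by (simp add: f_def vm)
qed

section \<open>Iterated row steps, in the form in which the program computes them\<close>

lemma row_steps_add:
  "row_steps x y M v (a + k) = row_steps (\<lambda>k. x (a + k)) y M (row_steps x y M v a) k"
  by (induction k) auto

lemma row_steps_cong:
  assumes "\<And>k. k < K \<Longrightarrow> x k = x' k" "\<And>k. k < q \<Longrightarrow> y k = y' k" "\<And>k. k \<le> q \<Longrightarrow> v k = v' k"
  shows "j \<le> q \<Longrightarrow> row_steps x y M v K j = row_steps x' y' M v' K j"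
  using assms(1)
proof (induction K arbitrary: j)
  case 0
  then show ?case using assms by simp
next
  case (Suc K)
  have "row_steps x y M v (Suc K) j = row_step (x' K) y M (row_steps x y M v K) j" using Suc.prems by simp
  also have "\<dots> = row_step (x' K) y' M (row_steps x' y' M v' K) j"
    using Suc assms by (intro row_step_cong) auto
  finally show ?case by simp
qed

lemma row_steps_uniform:
  assumes "0 < M" "k \<le> length X" "j \<le> length Y"
  shows "row_steps (\<lambda>k. X ! k) ((!) Y) M (\<lambda>_. M) k j = M * (1 + lcs (take k X) (take j Y))"
proof -
  let ?S = "{(0 :: nat, b, M) |b. b \<le> length Y}"
  have "best M X Y ?S 0 j M" if "j \<le> length Y" for j
    by (rule bestI) (auto intro!: exI[of _ 0])
  then have "best M X Y ?S (0 + k) j (row_steps (\<lambda>k. X ! (0 + k)) ((!) Y) M (\<lambda>_. M) k j)"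
    using assms by (intro best_row_steps) auto
  from best_uniform[OF this assms(1)] show ?thesis by simp
qed

lemma row_steps_crossing:
  assumes p: "p \<le> length X" and M: "length Y < M"
    and v: "v = row_steps (\<lambda>k. X ! (p + k)) ((!) Y) M (\<lambda>j. M * (1 + lcs (take p X) (take j Y)) + j)"
  shows "p + k \<le> length X \<Longrightarrow> j \<le> length Y \<Longrightarrow> v k j \<le> M * (1 + length Y) + length Y + M * length Y"
    and "v (length X - p) (length Y) mod M \<le> length Y"
    and "lcs X Y = lcs (take p X) (take (v (length X - p) (length Y) mod M) Y)
        + lcs (drop p X) (drop (v (length X - p) (length Y) mod M) Y)"
proof -
  let ?S = "{(p, b, M * (1 + lcs (take p X) (take b Y)) + b) |b. b \<le> length Y}"
  \<comment> \<open>The packed seeds increase with the column, so the initial row equals its own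
    running maximum and is already correct for row \<open>p\<close>.\<close>
  have mono: "M * (1 + lcs (take p X) (take b Y)) + b \<le> M * (1 + lcs (take p X) (take j Y)) + j"
    if "b \<le> j" for b j
    using that lcs_mono[OF subseq_order.order_refl slice_slice_subseq[of 0 b j Y], of "take p X"]
    by (intro add_mono mult_le_mono2) auto
  have "best M X Y ?S p j (M * (1 + lcs (take p X) (take j Y)) + j)" if "j \<le> length Y" for j
    using that by (intro bestI) (auto dest: mono)
  then have b: "best M X Y ?S (p + k) j (v k j)" if "p + k \<le> length X" "j \<le> length Y" for k j
    unfolding v using that M by (intro best_row_steps) auto
  have U: "x \<le> M * (1 + length Y) + length Y" if "(a, b, x) \<in> ?S" for a b x
  proof -
    have "lcs (take p X) (take b Y) \<le> length Y" using lcs_le2[of "take p X" "take b Y"] by simp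
    then have "M * (1 + lcs (take p X) (take b Y)) \<le> M * (1 + length Y)" by simp
    then show ?thesis using that by (auto intro!: add_mono)
  qed
  show "p + k \<le> length X \<Longrightarrow> j \<le> length Y \<Longrightarrow> v k j \<le> M * (1 + length Y) + length Y + M * length Y"
    by (rule best_bound[OF b]) (assumption+, rule U)
  have "best M X Y ?S (length X) (length Y) (v (length X - p) (length Y))"
    using b[of "length X - p" "length Y"] p by simp
  from crossing_column[OF this p M]
  show "v (length X - p) (length Y) mod M \<le> length Y"
    "lcs X Y = lcs (take p X) (take (v (length X - p) (length Y) mod M) Y)
        + lcs (drop p X) (drop (v (length X - p) (length Y) mod M) Y)" by blast+
qed

section \<open>Embeddings of the pattern\<close>

text \<open>Matching the first \<open>k\<close> characters of \<open>p\<close> greedily from position \<open>s\<close> of \<open>x\<close> backwards;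
  the result is the successor of the start position, or 0 if there is no embedding.\<close>

fun match_back :: "(nat \<Rightarrow> nat) \<Rightarrow> (nat \<Rightarrow> nat) \<Rightarrow> nat \<Rightarrow> nat \<Rightarrow> nat" where
  "match_back x p 0 s = Suc s"
| "match_back x p (Suc k) 0 = 0"
| "match_back x p (Suc k) (Suc s) =
     (if x s = p k then match_back x p k s else match_back x p (Suc k) s)"

lemma match_back_cong:
  "(\<And>i. i < s \<Longrightarrow> x i = x' i) \<Longrightarrow> (\<And>i. i < k \<Longrightarrow> p i = p' i) \<Longrightarrow> match_back x p k s = match_back x' p' k s"
  by (induction x p k s rule: match_back.induct) auto

lemma match_back_sound:
  assumes "match_back ((!) X) ((!) P) k s = Suc a" "k \<le> length P" "s \<le> length X"
  shows "a \<le> s \<and> subseq (take k P) (slice X a s)"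
  using assms
proof (induction s arbitrary: k)
  case 0
  then show ?case by (cases k) auto
next
  case (Suc s)
  show ?case
  proof (cases k)
    case 0
    then show ?thesis using Suc.prems by simp
  next
    case k: (Suc l)
    show ?thesis
    proof (cases "X ! s = P ! l")
      case True
      then have "a \<le> s \<and> subseq (take l P) (slice X a s)" using Suc.IH[of l] Suc.prems k by simp
      then show ?thesis using True Suc.prems k
        by (simp add: slice_Suc take_Suc_conv_app_nth list_emb_append_mono)
    next
      case False
      then have "a \<le> s \<and> subseq (take k P) (slice X a s)" using Suc.IH[of k] Suc.prems k by simp
      then show ?thesis using Suc.prems by (simp add: slice_Suc list_emb_prefix)
    qed
  qed
qed

text \<open>Greedy matching from the right is optimal: a last character that fits may be used, since
  this leaves the most room for the rest, and one that does not fit cannot belong to the end of the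
  embedding.\<close>

lemma match_back_max:
  assumes "subseq (take k P) (slice X a s)" "k \<le> length P" "s \<le> length X" "a \<le> s"
  shows "a < match_back ((!) X) ((!) P) k s"
  using assms
proof (induction s arbitrary: k)
  case 0
  then show ?case by (cases k) auto
next
  case (Suc s)
  show ?case
  proof (cases k)
    case 0
    then show ?thesis using Suc.prems by simp
  next
    case k: (Suc l)
    have "a \<noteq> Suc s"
    proof
      assume "a = Suc s"
      then have "take k P = []" using Suc.prems list_emb_Nil2[of "(=)" "take k P"] by (simp del: take_eq_Nil)
      then show False using Suc.prems k by auto
    qed
    then have a: "a \<le> s" using Suc.prems by simp
    have sub: "subseq (take l P @ [P ! l]) (slice X a s @ [X ! s])"
      using Suc.prems a k by (simp add: slice_Suc take_Suc_conv_app_nth)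
    show ?thesis
    proof (cases "X ! s = P ! l")
      case True
      then have "subseq (take l P) (slice X a s)" using sub by simp
      then show ?thesis using Suc.IH[of l] Suc.prems k True a by simp
    next
      case False
      then have "subseq (take k P) (slice X a s)"
        using subseq_snocD[OF sub] Suc.prems k by (auto simp: take_Suc_conv_app_nth)
      then show ?thesis using Suc.IH[of k] Suc.prems k False a by simp
    qed
  qed
qed

section \<open>Latest starts of embeddings\<close>

definition start :: "nat list \<Rightarrow> nat list \<Rightarrow> nat \<Rightarrow> nat" where
  "start X P i = match_back ((!) X) ((!) P) (length P) i"

lemma start_Suc: "start X P i = Suc a \<Longrightarrow> i \<le> length X \<Longrightarrow> a \<le> i \<and> subseq P (slice X a i)"
  unfolding start_def using match_back_sound[of X P "length P" i a] by simp

lemma start_max: "subseq P (slice X a i) \<Longrightarrow> a \<le> i \<Longrightarrow> i \<le> length X \<Longrightarrow> a < start X P i"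
  unfolding start_def using match_back_max[of "length P" P X a i] by simp

text \<open>An embedding that fits before \<open>i\<close> also fits before \<open>i'\<close>, so
  the latest start cannot move to the left.\<close>

lemma start_mono:
  assumes "start X P i = Suc a" "i \<le> i'" "i' \<le> length X"
  shows "start X P i \<le> start X P i'"
proof -
  have "a \<le> i" "subseq P (slice X a i)" using start_Suc[OF assms(1)] assms by auto
  then show ?thesis using start_max[of P X a i'] slice_slice_subseq[of a i i' X] assms
    by (auto dest: subseq_order.order_trans)
qed

text \<open>The label of the seed at \<open>(i, j)\<close> is \<open>i * (n + 1) + j\<close>, and its rank is the successor of
  the length of the best common subsequence that ends with \<open>P\<close> embedded up to \<open>i\<close> and \<open>j\<close>.\<close>

definition seed :: "nat list \<Rightarrow> nat list \<Rightarrow> nat list \<Rightarrow> nat \<Rightarrow> nat \<Rightarrow> nat" where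
  "seed A B P i j = (if start A P i = 0 \<or> start B P j = 0 then 0
     else (lcs (take (start A P i - 1) A) (take (start B P j - 1) B) + 1 + length P)
       * (length A + 1) ^ 2 + i * (length A + 1) + j)"

definition seeds :: "nat list \<Rightarrow> nat list \<Rightarrow> nat list \<Rightarrow> nat \<Rightarrow> (nat \<times> nat \<times> nat) set" where
  "seeds A B P k = {(i, j, x). i < k \<and> j \<le> length A \<and> x = seed A B P i j \<and> 0 < x}"

text \<open>The summand 1 in the rank serves this equivalence: a seed is positive even if
  \<open>P\<close> is empty, the prefixes share nothing and the label is 0.\<close>

lemma seed_pos: "0 < seed A B P i j \<longleftrightarrow> 0 < start A P i \<and> 0 < start B P j"
  unfolding seed_def by (auto intro!: trans_less_add1)

text \<open>The rank is at most \<open>2 * length A + 1\<close>, and the label contributes at most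
  one more multiple of \<open>(length A + 1) ^ 2\<close>.\<close>

lemma seed_le:
  assumes "length B = length A" "length P \<le> length A" "i \<le> length A" "j \<le> length A"
  shows "seed A B P i j \<le> (2 * length A + 2) * (length A + 1) ^ 2"
proof (cases "start A P i = 0 \<or> start B P j = 0")
  case False
  let ?n = "length A"
  have "lcs (take (start A P i - 1) A) (take (start B P j - 1) B) \<le> ?n"
    using lcs_le1 by (rule order_trans) simp
  then have "(lcs (take (start A P i - 1) A) (take (start B P j - 1) B) + 1 + length P) * (?n + 1)^2
      \<le> (2 * ?n + 1) * (?n + 1)^2"
    using assms by (intro mult_right_mono) auto
  moreover have "i * (?n + 1) + j \<le> ?n * (?n + 1) + ?n" using assms by (intro add_mono mult_right_mono) auto
  moreover have "?n * (?n + 1) + ?n \<le> (?n + 1)^2" by (simp add: power2_eq_square)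
  ultimately show ?thesis using False unfolding seed_def by (simp add: algebra_simps)
qed (auto simp: seed_def)

text \<open>Each pair of end positions with embeddings yields a solution of length
  \<open>val i j\<close>, and every candidate is dominated by such a pair; the maximal packed number
  then reveals an optimal pair. The outer parts \<open>Z1\<close> and \<open>Z2\<close> are left
  arbitrary, because the bisection may deliver any longest common subsequences there.\<close>

theorem best_seeds:
  fixes A B P :: "nat list"
  assumes n: "length A = n" "length B = n" and best: "best ((n + 1)^2) A B (seeds A B P (n + 1)) n n v"
  shows "v = 0 \<Longrightarrow> is_str_ic_lcs A B P None"
    and "0 < v \<Longrightarrow> i = v mod (n + 1)^2 div (n + 1) \<Longrightarrow> j = v mod (n + 1)^2 mod (n + 1) \<Longrightarrow>
      i \<le> n \<and> j \<le> n \<and> 0 < start A P i \<and> 0 < start B P j \<and>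
      (\<forall>Z1 Z2. common_subseq (take (start A P i - 1) A) (take (start B P j - 1) B) Z1 \<longrightarrow>
         length Z1 = lcs (take (start A P i - 1) A) (take (start B P j - 1) B) \<longrightarrow>
         common_subseq (drop i A) (drop j B) Z2 \<longrightarrow> length Z2 = lcs (drop i A) (drop j B) \<longrightarrow>
         is_str_ic_lcs A B P (Some (Z1 @ P @ Z2)))"
proof -
  define M where "M = (n + 1)^2"
  define val where "val i j = lcs (take (start A P i - 1) A) (take (start B P j - 1) B) + length P
    + lcs (drop i A) (drop j B)" for i j
  have seed: "seed A B P i j + M * lcs (slice A i n) (slice B j n) = M * (val i j + 1) + (i * (n + 1) + j)"
    if "0 < start A P i" "0 < start B P j" for i j
  proof -
    have "seed A B P i j = (lcs (take (start A P i - 1) A) (take (start B P j - 1) B) + 1 + length P) * M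
        + i * (n + 1) + j"
      using that n by (simp add: seed_def M_def)
    moreover have "slice A i n = drop i A" "slice B j n = drop j B" using n by simp_all
    ultimately show ?thesis by (simp add: val_def algebra_simps)
  qed
  have upper: "\<exists>i\<le>n. \<exists>j\<le>n. 0 < start A P i \<and> 0 < start B P j \<and> length Z \<le> val i j"
    if cand: "str_ic_candidate A B P Z" for Z
  proof -
    obtain X Y where Z: "Z = X @ P @ Y" using cand unfolding str_ic_candidate_def sublist_def by blast
    have sub: "subseq (X @ P @ Y) A" "subseq (X @ P @ Y) B"
      using cand Z by (auto simp: str_ic_candidate_def common_subseq_def)
    \<comment> \<open>The embedding of \<open>X @ P @ Y\<close> is cut into three blocks;
      \<open>a\<close> and \<open>i\<close> are the borders of the block that receives
      \<open>P\<close>.\<close>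
    have split: "\<exists>a i. a \<le> i \<and> i \<le> length C \<and> subseq X (take a C) \<and> subseq P (slice C a i) \<and> subseq Y (drop i C)"
      if sub: "subseq (X @ P @ Y) C" for C
    proof -
      obtain C1 C' where "C = C1 @ C'" "subseq X C1" "subseq (P @ Y) C'"
        using list_emb_appendD[OF sub] by blast
      moreover then obtain C2 C3 where "C' = C2 @ C3" "subseq P C2" "subseq Y C3"
        using list_emb_appendD by metis
      ultimately show ?thesis
        by (intro exI[of _ "length C1"] exI[of _ "length C1 + length C2"]) (auto simp: slice_def)
    qed
    obtain a i where i: "a \<le> i" "i \<le> n" "subseq X (take a A)" "subseq P (slice A a i)" "subseq Y (drop i A)"
      using split[OF sub(1)] n by auto
    obtain b j where j: "b \<le> j" "j \<le> n" "subseq X (take b B)" "subseq P (slice B b j)" "subseq Y (drop j B)"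
      using split[OF sub(2)] n by auto
    \<comment> \<open>The exchange: the latest starts are no earlier than \<open>a\<close> and
      \<open>b\<close>, so \<open>X\<close> still fits into the prefixes before them.\<close>
    have s: "a < start A P i" "b < start B P j" using start_max i j n by auto
    have "subseq X (take (start A P i - 1) A)" "subseq X (take (start B P j - 1) B)"
      using s i(3) j(3) subseq_order.order_trans[of X "take a A"] subseq_order.order_trans[of X "take b B"]
        slice_slice_subseq[of 0 a "start A P i - 1" A] slice_slice_subseq[of 0 b "start B P j - 1" B]
      by auto
    then have "length Z \<le> val i j"
      unfolding val_def Z using length_le_lcs[of X] length_le_lcs[OF i(5) j(5)] by (simp add: add_mono)
    then show ?thesis using i j s by (metis gr_zeroI less_nat_zero_code)
  qed
  have lower: "M * (val i j + 1) + (i * (n + 1) + j) \<le> v"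
    if "i \<le> n" "j \<le> n" "0 < start A P i" "0 < start B P j" for i j
  proof -
    have "(i, j, seed A B P i j) \<in> seeds A B P (n + 1)"
      using that n seed_pos[of A B P i j] by (auto simp: seeds_def)
    from best_le[OF best this that(1,2)] show ?thesis
      using seed[OF that(3,4)] by (simp only: M_def)
  qed
  show "is_str_ic_lcs A B P None" if "v = 0"
  proof -
    have False if cand: "str_ic_candidate A B P Z" for Z
    proof -
      obtain i j where "M * (val i j + 1) + (i * (n + 1) + j) \<le> v"
        using upper[OF cand] lower by blast
      then show False using \<open>v = 0\<close> by (simp add: M_def)
    qed
    then show ?thesis by auto
  qed
  assume "0 < v"
  then obtain i' j' where s: "i' \<le> n" "j' \<le> n" "0 < start A P i'" "0 < start B P j'"
    "v = seed A B P i' j' + M * lcs (slice A i' n) (slice B j' n)"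
    using best_attained[OF best] n seed_pos[of A B P] unfolding seeds_def M_def by auto
  then have v: "v = (i' * (n + 1) + j') + M * (val i' j' + 1)"
    using seed[OF s(3,4)] by simp
  \<comment> \<open>Both coordinates are at most \<open>n\<close>, so the label stays below the
    modulus and is recovered as a remainder.\<close>
  have "i' * (n + 1) + j' \<le> n * (n + 1) + n" using s by (intro add_mono mult_right_mono) auto
  then have label: "i' * (n + 1) + j' < M" by (simp add: M_def power2_eq_square)
  assume "i = v mod (n + 1)^2 div (n + 1)" "j = v mod (n + 1)^2 mod (n + 1)"
  moreover have "v mod (n + 1)^2 = i' * (n + 1) + j'"
    using label by (simp only: v mod_mult_self2 mod_less flip: M_def)
  moreover have "(i' * (n + 1) + j') div (n + 1) = i'" "(i' * (n + 1) + j') mod (n + 1) = j'"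
    using s(2) div_mult_self1[of "n + 1" j' i'] mod_mult_self1[of j' i' "n + 1"]
    unfolding add.commute[of j'] by simp_all
  ultimately have ij: "i = i'" "j = j'" by simp_all
  show "i \<le> n \<and> j \<le> n \<and> 0 < start A P i \<and> 0 < start B P j \<and>
      (\<forall>Z1 Z2. common_subseq (take (start A P i - 1) A) (take (start B P j - 1) B) Z1 \<longrightarrow>
         length Z1 = lcs (take (start A P i - 1) A) (take (start B P j - 1) B) \<longrightarrow>
         common_subseq (drop i A) (drop j B) Z2 \<longrightarrow> length Z2 = lcs (drop i A) (drop j B) \<longrightarrow>
         is_str_ic_lcs A B P (Some (Z1 @ P @ Z2)))"
  proof (intro conjI allI impI)
    fix Z1 Z2 assume Z: "common_subseq (take (start A P i - 1) A) (take (start B P j - 1) B) Z1"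
      "length Z1 = lcs (take (start A P i - 1) A) (take (start B P j - 1) B)"
      "common_subseq (drop i A) (drop j B) Z2" "length Z2 = lcs (drop i A) (drop j B)"
    have join: "subseq (Z1 @ P @ Z2) C"
      if k: "0 < start C P k" "k \<le> length C" "subseq Z1 (take (start C P k - 1) C)" "subseq Z2 (drop k C)" for C k
    proof -
      obtain a where a: "start C P k = Suc a" using k(1) gr0_implies_Suc by blast
      note st = start_Suc[OF a k(2)]
      have "subseq (Z1 @ P @ Z2) (take a C @ slice C a k @ drop k C)"
        using k a st by (intro list_emb_append_mono) auto
      also have "take a C @ slice C a k @ drop k C = C"
        using st slice_append[of 0 a k C] append_take_drop_id[of k C] by simp
      finally show ?thesis .
    qed
    have cand: "str_ic_candidate A B P (Z1 @ P @ Z2)"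
      using join[of A i] join[of B j] Z s ij n by (auto simp: str_ic_candidate_def common_subseq_def)
    have len: "length (Z1 @ P @ Z2) = val i j" using Z by (simp add: val_def)
    have "length Z \<le> val i j" if cand: "str_ic_candidate A B P Z" for Z
    proof -
      obtain i2 j2 where 2: "i2 \<le> n" "j2 \<le> n" "0 < start A P i2" "0 < start B P j2" "length Z \<le> val i2 j2"
        using upper[OF cand] by blast
      have "M * (val i2 j2 + 1) < M * (val i j + 1 + 1)"
        using lower[OF 2(1-4)] v label ij by (simp add: algebra_simps)
      then have "val i2 j2 \<le> val i j" unfolding mult_less_cancel1 by simp
      then show ?thesis using 2 by simp
    qed
    then show "is_str_ic_lcs A B P (Some (Z1 @ P @ Z2))" using cand len by simp
  qed (use s ij in auto)
qed

section \<open>Row operations\<close>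

notation Seq (infixr ";;" 60)
abbreviation exp_add (infixl "\<oplus>" 65) where "a \<oplus> b \<equiv> Bin Add a b"
abbreviation exp_sub (infixl "\<ominus>" 65) where "a \<ominus> b \<equiv> Bin Sub a b"
abbreviation exp_mul (infixl "\<otimes>" 70) where "a \<otimes> b \<equiv> Bin Mul a b"

abbreviation (input) "rN \<equiv> 0 :: nat"
abbreviation (input) "rP \<equiv> 2 :: nat"
abbreviation (input) "rA \<equiv> 10 :: nat"
abbreviation (input) "rB \<equiv> 11 :: nat"
abbreviation (input) "rQ \<equiv> 12 :: nat"
abbreviation (input) "rV \<equiv> 13 :: nat"
abbreviation (input) "rM \<equiv> 14 :: nat"
abbreviation (input) "rJ \<equiv> 15 :: nat"
abbreviation (input) "rD \<equiv> 16 :: nat"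
abbreviation (input) "rL \<equiv> 17 :: nat"
abbreviation (input) "rU \<equiv> 18 :: nat"
abbreviation (input) "rX \<equiv> 19 :: nat"
abbreviation (input) "rVal \<equiv> 21 :: nat"
abbreviation (input) "rEnd \<equiv> 20 :: nat"
abbreviation (input) "rMM \<equiv> 32 :: nat"
abbreviation (input) "rC \<equiv> 33 :: nat"
abbreviation (input) "rBase \<equiv> 22 :: nat"
abbreviation (input) "rI \<equiv> 23 :: nat"
abbreviation (input) "rRes \<equiv> 24 :: nat"
abbreviation (input) "rK \<equiv> 25 :: nat"
abbreviation (input) "rS \<equiv> 26 :: nat"

text \<open>The row is updated in place. \<open>rU\<close> is the old value above the new cell and
  \<open>rL\<close> the new value on its left; \<open>rD\<close> saves the old diagonal value, whose
  cell has already been overwritten.\<close>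

definition row_body :: com where
  "row_body =
     Assign rU (Mem (Reg rV \<oplus> Reg rJ \<oplus> Num 1)) ;;
     Assign rX (Reg rL) ;;
     Ifte (Less (Reg rX) (Reg rU)) (Assign rX (Reg rU)) Skip ;;
     Ifte (Eq (Mem (Reg rA)) (Mem (Reg rB \<oplus> Reg rJ)))
       (Ifte (Less (Num 0) (Reg rD))
         (Ifte (Less (Reg rX) (Reg rD \<oplus> Reg rM)) (Assign rX (Reg rD \<oplus> Reg rM)) Skip) Skip) Skip ;;
     Assign rD (Reg rU) ;;
     Assign rL (Reg rX) ;;
     Put (Reg rV \<oplus> Reg rJ \<oplus> Num 1) (Reg rX) ;;
     Assign rJ (Reg rJ \<oplus> Num 1)"

definition row :: com where
  "row = Assign rJ (Num 0) ;; Assign rD (Mem (Reg rV)) ;; Assign rL (Mem (Reg rV)) ;;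
     Loop (Less (Reg rJ) (Reg rQ)) row_body"

lemmas wps = cok_def csz_def

lemma wp_row:
  assumes regs: "r rA < vb" "r rB + q \<le> vb" "r rQ = q" "r rV = vb" "r rM = M"
    and s: "vb + q < s" "s < 2 ^ w"
    and M: "\<And>j. j \<le> q \<Longrightarrow> m (vb + j) + M < 2 ^ w"
    and Q: "\<And>r' m' t'. (\<And>j. j \<le> q \<Longrightarrow>
          m' (vb + j) = row_step (m (r rA)) (\<lambda>k. m (r rB + k)) M (\<lambda>k. m (vb + k)) j) \<Longrightarrow>
        (\<And>a. a < vb \<or> vb + q < a \<Longrightarrow> m' a = m a) \<Longrightarrow>
        (\<And>x. x \<notin> {rJ, rD, rL, rU, rX} \<Longrightarrow> r' x = r x) \<Longrightarrow>
        t' \<le> t + 60 * (q + 1) \<Longrightarrow> Q (r', m', t')"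
  shows "wp w s row Q (r, m, t)"
proof -
  define f where "f = row_step (m (r rA)) (\<lambda>k. m (r rB + k)) M (\<lambda>k. m (vb + k))"
  have f0: "f 0 = m vb" by (simp add: f_def)
  have fS: "f (Suc j) = max (max (m (vb + j + 1)) (f j))
      (if m (r rA) = m (r rB + j) \<and> 0 < m (vb + j) then m (vb + j) + M else 0)" for j
    by (simp add: f_def)
  define I where "I j r' m' t' \<longleftrightarrow> (\<forall>k. k \<le> j \<longrightarrow> m' (vb + k) = f k) \<and>
     (\<forall>a. a < vb \<or> vb + j < a \<longrightarrow> m' a = m a) \<and> (\<forall>x. x \<notin> {rJ, rD, rL, rU, rX} \<longrightarrow> r' x = r x) \<and>
     r' rJ = j \<and> r' rD = m (vb + j) \<and> r' rL = f j \<and> t' \<le> t + 10 + 60 * j" for j r' m' t'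
  have init: "I 0 (r(15 := 0, 16 := m vb, 17 := m vb)) m t'" if "t' \<le> t + 10" for t'
    using that unfolding I_def by (auto simp: f0)
  have step: "wp w s row_body (\<lambda>(r, m, t). I (Suc j) r m t) (r', m', t' + csz (Less (Reg rJ) (Reg rQ)) + 2)"
    if j: "j < q" and I: "I j r' m' t'" for j r' m' t'
  proof -
    have fr: "\<And>x. x \<notin> {rJ, rD, rL, rU, rX} \<Longrightarrow> r' x = r x" and fm: "\<And>a. a < vb \<or> vb + j < a \<Longrightarrow> m' a = m a"
      and rj: "r' rJ = j" "r' rD = m (vb + j)" "r' rL = f j" and t': "t' \<le> t + 10 + 60 * j"
      and f: "\<And>k. k \<le> j \<Longrightarrow> m' (vb + k) = f k"
      using I unfolding I_def by auto
    have regs': "r' rA = r rA" "r' rB = r rB" "r' rV = vb" "r' rM = M" using fr regs by auto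
    have b: "vb + j + 1 < s" "r rA < s" "r rB + j < s" "vb + j + 1 < 2 ^ w" "r rB + j < 2 ^ w" "vb + j < 2 ^ w"
      "1 < (2::nat) ^ w" "m (vb + j) + M < 2 ^ w" "j + 1 < 2 ^ w"
      using j s regs M[of j] by auto
    have mm: "m' (vb + j + 1) = m (vb + j + 1)" "m' (r rA) = m (r rA)" "m' (r rB + j) = m (r rB + j)"
      using fm regs j by auto
    have step_I: "I (Suc j) (r'(18 := u, 19 := x, 16 := u', 17 := x', 15 := j + 1)) (m'(vb + j + 1 := x'')) t''"
      if "u' = m (vb + j + 1)" "x' = f (Suc j)" "x'' = f (Suc j)" "t'' \<le> t' + 60" for u u' x x' x'' t''
      unfolding I_def using that fr fm f t' by (auto simp: le_Suc_eq)
    show ?thesis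
      unfolding row_body_def
      apply (simp add: wps regs' rj b mm b[simplified] mm[simplified] del: One_nat_def)
      apply (intro conjI impI; rule step_I; simp add: fS max_def)
      done
  qed
  show ?thesis
    unfolding row_def
    apply (simp add: regs)
    apply (intro conjI)
    subgoal using s by simp
    apply (rule wp_for[where I = I and i = 0 and q = q])
    subgoal by (rule init) simp
    subgoal by simp
    subgoal using step regs by (auto simp: I_def wps)
    subgoal by (auto simp: I_def f_def wps regs intro!: Q)
    done
qed


definition rows :: com where
  "rows = Loop (Less (Reg rA) (Reg rEnd)) (row ;; Assign rA (Reg rA \<oplus> Num 1))"

text \<open>Freedom from overflow is required of all intermediate rows, because \<open>M\<close> is
  added to their entries; callers derive it from the meaning of these rows.\<close>

lemma wp_rows:
  assumes regs: "r rA = a" "r rEnd = a'" "r rB = bb" "r rQ = q" "r rV = vb" "r rM = M"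
    and a: "a \<le> a'" "a' \<le> vb" "bb + q \<le> vb"
    and s: "vb + q < s" "s < 2 ^ w"
    and M: "\<And>k j. k \<le> a' - a \<Longrightarrow> j \<le> q \<Longrightarrow>
        row_steps (\<lambda>k. m (a + k)) (\<lambda>k. m (bb + k)) M (\<lambda>j. m (vb + j)) k j + M < 2 ^ w"
    and Q: "\<And>r' m' t'. (\<And>j. j \<le> q \<Longrightarrow> m' (vb + j) =
          row_steps (\<lambda>k. m (a + k)) (\<lambda>k. m (bb + k)) M (\<lambda>j. m (vb + j)) (a' - a) j) \<Longrightarrow>
        (\<And>b. b < vb \<or> vb + q < b \<Longrightarrow> m' b = m b) \<Longrightarrow>
        (\<And>x. x \<notin> {rA, rJ, rD, rL, rU, rX} \<Longrightarrow> r' x = r x) \<Longrightarrow> r' rA = a' \<Longrightarrow>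
        t' \<le> t + 10 + 80 * (a' - a) * (q + 1) \<Longrightarrow> Q (r', m', t')"
  shows "wp w s rows Q (r, m, t)"
proof -
  define f where "f = row_steps (\<lambda>k. m (a + k)) (\<lambda>k. m (bb + k)) M (\<lambda>j. m (vb + j))"
  have f0: "f 0 j = m (vb + j)" and
    fS: "f (Suc k) j = row_step (m (a + k)) (\<lambda>k. m (bb + k)) M (f k) j" for k j
    by (simp_all add: f_def)
  define I where "I k r' m' t' \<longleftrightarrow> (\<forall>j\<le>q. m' (vb + j) = f (k - a) j) \<and>
     (\<forall>b. b < vb \<or> vb + q < b \<longrightarrow> m' b = m b) \<and>
     (\<forall>x. x \<notin> {rA, rJ, rD, rL, rU, rX} \<longrightarrow> r' x = r x) \<and>
     r' rA = k \<and> t' \<le> t + 80 * (k - a) * (q + 1)" for k r' m' t'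
  show ?thesis
    unfolding rows_def
  proof (rule wp_for[where I = I and i = a and q = a'])
    show "I a r m t" by (simp add: I_def f0 regs)
    show "a \<le> a'" by fact
  next
    fix k r' m' t' assume k: "a \<le> k" "k < a'" and I: "I k r' m' t'"
    have fr: "\<And>x. x \<notin> {rA, rJ, rD, rL, rU, rX} \<Longrightarrow> r' x = r x" and ra: "r' rA = k"
      and fm: "\<And>b. b < vb \<or> vb + q < b \<Longrightarrow> m' b = m b"
      and f: "\<And>j. j \<le> q \<Longrightarrow> m' (vb + j) = f (k - a) j" and t': "t' \<le> t + 80 * (k - a) * (q + 1)"
      using I unfolding I_def by auto
    have kk: "k - a \<le> a' - a" "a + (k - a) = k" "Suc k - a = Suc (k - a)" using k by auto
    have "wp w s (row ;; Assign rA (Reg rA \<oplus> Num 1)) (\<lambda>(r, m, t). I (Suc k) r m t) (r', m', t' + csz (Less (Reg rA) (Reg rEnd)) + 2)"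
      unfolding wp_Seq
    proof (rule wp_row[where vb = vb and q = q and M = M])
      show "r' rA < vb" "r' rB + q \<le> vb" "r' rQ = q" "r' rV = vb" "r' rM = M" using fr regs ra k a by auto
      show "vb + q < s" "s < 2 ^ w" by fact+
      show "m' (vb + j) + M < 2 ^ w" if "j \<le> q" for j
        using M[OF kk(1) that] f[OF that] by (simp add: f_def)
    next
      fix r2 m2 t2
      assume m2: "\<And>j. j \<le> q \<Longrightarrow> m2 (vb + j) = row_step (m' (r' rA)) (\<lambda>k. m' (r' rB + k)) M (\<lambda>k. m' (vb + k)) j"
        and fm2: "\<And>a. a < vb \<or> vb + q < a \<Longrightarrow> m2 a = m' a"
        and fr2: "\<And>x. x \<notin> {rJ, rD, rL, rU, rX} \<Longrightarrow> r2 x = r' x"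
        and t2: "t2 \<le> t' + csz (Less (Reg rA) (Reg rEnd)) + 2 + 60 * (q + 1)"
      have "m2 (vb + j) = f (Suc k - a) j" if j: "j \<le> q" for j
      proof -
        have "m' (r' rA) = m (a + (k - a))" using fm ra k a kk by simp
        then have "m2 (vb + j) = row_step (m (a + (k - a))) (\<lambda>k. m' (r' rB + k)) M (\<lambda>k. m' (vb + k)) j"
          using m2[OF j] by simp
        also have "\<dots> = row_step (m (a + (k - a))) (\<lambda>k. m (bb + k)) M (f (k - a)) j"
          using fr regs fm f j a by (intro row_step_cong) auto
        finally show ?thesis unfolding kk(3) fS .
      qed
      moreover have "t2 + 4 \<le> t + 80 * (Suc k - a) * (q + 1)"
        using t2 t' unfolding kk(3) by (simp add: wps algebra_simps)
      moreover have "r2 rA + 1 < 2 ^ w" "r2 rA = k" using fr2 ra k a s by auto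
      ultimately show "wp w s (Assign rA (Reg rA \<oplus> Num 1)) (\<lambda>(r, m, t). I (Suc k) r m t) (r2, m2, t2)"
        using fr fr2 fm fm2 by (simp add: I_def)
    qed
    then show "cok w s (Less (Reg rA) (Reg rEnd)) r' m' \<and> cev (Less (Reg rA) (Reg rEnd)) r' m' \<and>
      wp w s (row ;; Assign rA (Reg rA \<oplus> Num 1)) (\<lambda>(r, m, t). I (Suc k) r m t)
        (r', m', t' + csz (Less (Reg rA) (Reg rEnd)) + 2)"
      using ra k fr regs by (simp add: wps)
  next
    fix r' m' t' assume "I a' r' m' t'"
    then show "cok w s (Less (Reg rA) (Reg rEnd)) r' m' \<and> \<not> cev (Less (Reg rA) (Reg rEnd)) r' m' \<and>
        Q (r', m', t' + csz (Less (Reg rA) (Reg rEnd)) + 2)"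
      using regs by (auto simp: I_def f_def wps intro!: Q)
  qed
qed

definition fill :: com where
  "fill = Assign rJ (Num 0) ;; Loop (Less (Reg rJ) (Reg rQ \<oplus> Num 1))
     (Put (Reg rV \<oplus> Reg rJ) (Reg rVal) ;; Assign rJ (Reg rJ \<oplus> Num 1))"

lemma wp_fill:
  assumes regs: "r rQ = q" "r rV = vb" and s: "vb + q < s" "s < 2 ^ w"
    and Q: "\<And>r' m' t'. (\<And>j. j \<le> q \<Longrightarrow> m' (vb + j) = r rVal) \<Longrightarrow>
        (\<And>b. b < vb \<or> vb + q < b \<Longrightarrow> m' b = m b) \<Longrightarrow>
        (\<And>x. x \<noteq> rJ \<Longrightarrow> r' x = r x) \<Longrightarrow> t' \<le> t + 40 * (q + 1) \<Longrightarrow> Q (r', m', t')"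
  shows "wp w s fill Q (r, m, t)"
  unfolding fill_def
  apply (simp add: del: One_nat_def)
  apply (rule wp_for[where i = 0 and q = "q + 1" and I = "\<lambda>j r' m' t'. (\<forall>k<j. m' (vb + k) = r rVal) \<and>
     (\<forall>b. b < vb \<or> vb + q < b \<longrightarrow> m' b = m b) \<and> (\<forall>x. x \<noteq> rJ \<longrightarrow> r' x = r x) \<and> r' rJ = j \<and>
     t' \<le> t + 2 + 20 * j"])
  subgoal by simp
  subgoal by simp
  subgoal using regs s by (auto simp: wps less_Suc_eq)
  subgoal using regs s by (auto simp: wps intro!: Q)
  done

text \<open>Conditions have no conjunction, so the product tests that both the remaining pattern and
  the remaining text are nonempty. Correctness therefore needs room for this product in a
  word.\<close>

definition match :: com where
  "match = Assign rK (Reg rP) ;; Assign rS (Reg rI) ;;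
     Loop (Less (Num 0) (Reg rK \<otimes> Reg rS))
       (Assign rS (Reg rS \<ominus> Num 1) ;;
        Ifte (Eq (Mem (Reg rBase \<oplus> Reg rS)) (Mem (Reg rN \<oplus> Reg rN \<oplus> Reg rK \<ominus> Num 1)))
          (Assign rK (Reg rK \<ominus> Num 1)) Skip) ;;
     Ifte (Eq (Reg rK) (Num 0)) (Assign rRes (Reg rS \<oplus> Num 1)) (Assign rRes (Num 0))"

lemma wp_match:
  assumes s: "r rN + r rN + r rP < s" "r rBase + r rI < s" "s < 2 ^ w" "r rP * r rI < 2 ^ w"
    and Q: "\<And>r' t'. r' rRes = match_back (\<lambda>i. m (r rBase + i)) (\<lambda>i. m (r rN + r rN + i)) (r rP) (r rI) \<Longrightarrow>
        (\<And>x. x \<notin> {rRes, rK, rS} \<Longrightarrow> r' x = r x) \<Longrightarrow> t' \<le> t + 40 * (r rI + 1) \<Longrightarrow> Q (r', m, t')"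
  shows "wp w s match Q (r, m, t)"
proof -
  define f where "f = match_back (\<lambda>i. m (r rBase + i)) (\<lambda>i. m (r rN + r rN + i))"
  \<comment> \<open>The recursion of \<open>match_back\<close> is a tail recursion, so its value at
    the current registers never changes.\<close>
  define I where "I r' m' t' \<longleftrightarrow> f (r' rK) (r' rS) = f (r rP) (r rI) \<and> r' rK \<le> r rP \<and> r' rS \<le> r rI \<and> m' = m \<and>
    (\<forall>x. x \<notin> {rRes, rK, rS} \<longrightarrow> r' x = r x) \<and> t' + 40 * r' rS \<le> t + 4 + 40 * r rI" for r' m' t'
  show ?thesis unfolding match_def
    apply (simp del: One_nat_def)
    apply (rule wp_while[where I = I and f = "\<lambda>r. r rS"])
    subgoal by (simp add: I_def)
    subgoal premises I for r' m' t'
    proof -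
      have b: "r' rK * r' rS \<le> r rP * r rI" using I unfolding I_def by (intro mult_le_mono) auto
      have b2: "r' rK * r' rS < 2 ^ w" "(0::nat) < 2 ^ w" "1 < (2::nat) ^ w"
        using b s by (auto intro: le_less_trans)
      show ?thesis
      proof (cases "0 < r' rK * r' rS")
        case True
        then obtain k l where kl: "r' rK = Suc k" "r' rS = Suc l" by (cases "r' rK"; cases "r' rS") auto
        have fkl: "f (Suc k) (Suc l) = (if m (r rBase + l) = m (r rN + r rN + k) then f k l else f (Suc k) l)"
          by (simp add: f_def)
        show ?thesis
          using I s b2 kl fkl unfolding I_def by (auto simp: wps)
      next
        case False
        then have "f (r' rK) (r' rS) = (if r' rK = 0 then r' rS + 1 else 0)"
          by (cases "r' rK") (auto simp: f_def)
        then show ?thesis using I s b2 False unfolding I_def by (auto simp: wps f_def intro!: Q)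
      qed
    qed
    done
qed


text \<open>A fresh greedy match for each end position takes linear time, which a quadratic budget
  allows. Only the starts in \<open>B\<close> are tabulated, since every row looks them up again; a
  start in \<open>A\<close> is computed when its row is reached.\<close>

definition ends :: com where
  "ends = Assign rBase (Reg rN) ;; Assign rI (Num 0) ;;
     Loop (Less (Reg rI) (Reg rN \<oplus> Num 1))
       (match ;; Put (Reg rN \<oplus> Reg rN \<oplus> Reg rN \<oplus> Reg rI) (Reg rRes) ;; Assign rI (Reg rI \<oplus> Num 1))"

lemma wp_ends:
  assumes regs: "r rN = n" "r rP \<le> n"
    and s: "n + n + n + n < s" "s < 2 ^ w" "(n + 1) * (n + 1) < 2 ^ w"
    and Q: "\<And>r' m' t'. (\<And>j. j \<le> n \<Longrightarrow> m' (n + n + n + j) =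
          match_back (\<lambda>i. m (n + i)) (\<lambda>i. m (n + n + i)) (r rP) j) \<Longrightarrow>
        (\<And>b. b < n + n + n \<or> n + n + n + n < b \<Longrightarrow> m' b = m b) \<Longrightarrow>
        (\<And>x. x \<notin> {rBase, rI, rRes, rK, rS} \<Longrightarrow> r' x = r x) \<Longrightarrow>
        t' \<le> t + 120 * ((n + 1) * (n + 1)) \<Longrightarrow> Q (r', m', t')"
  shows "wp w s ends Q (r, m, t)"
proof -
  let ?B = "n + n + n"
  define f where "f = match_back (\<lambda>i. m (n + i)) (\<lambda>i. m (n + n + i)) (r rP)"
  define I where "I j r' m' t' \<longleftrightarrow> (\<forall>k<j. m' (?B + k) = f k) \<and> (\<forall>b. b < ?B \<or> ?B + n < b \<longrightarrow> m' b = m b) \<and>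
     (\<forall>x. x \<notin> {rBase, rI, rRes, rK, rS} \<longrightarrow> r' x = r x) \<and> r' rI = j \<and> r' rBase = n \<and>
     t' \<le> t + 10 + 100 * (n + 1) * j" for j r' m' t'
  have w: "1 < (2::nat) ^ w" "0 < (2::nat) ^ w" "n + 1 < 2 ^ w" "n < s"
    using s by auto
  have rPn: "r rP * j < 2 ^ w" if "j \<le> n" for j
    using mult_le_mono[of "r rP" "n + 1" j "n + 1"] regs that s by linarith
  show ?thesis unfolding ends_def
    apply (simp add: w del: One_nat_def)
    apply (rule wp_for[where I = I and i = 0 and q = "n + 1"])
    subgoal by (simp add: I_def regs)
    subgoal by simp
    subgoal premises j for j r' m' t'
    proof -
      have fr: "\<And>x. x \<notin> {rBase, rI, rRes, rK, rS} \<Longrightarrow> r' x = r x" and ri: "r' rI = j" "r' rBase = n"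
        and fm: "\<And>b. b < ?B \<or> ?B + n < b \<Longrightarrow> m' b = m b" and fk: "\<And>k. k < j \<Longrightarrow> m' (?B + k) = f k"
        and t': "t' \<le> t + 10 + 100 * (n + 1) * j"
        using j unfolding I_def by auto
      have rg: "r' rN = n" "r' rP = r rP" using fr regs by auto
      have "wp w s (match ;; Put (Reg rN \<oplus> Reg rN \<oplus> Reg rN \<oplus> Reg rI) (Reg rRes) ;; Assign rI (Reg rI \<oplus> Num 1))
        (\<lambda>(r, m, t). I (Suc j) r m t) (r', m', t' + csz (Less (Reg rI) (Reg rN \<oplus> Num 1)) + 2)"
        unfolding wp_Seq
      proof (rule wp_match)
        show "r' rN + r' rN + r' rP < s" "r' rBase + r' rI < s" "s < 2 ^ w" "r' rP * r' rI < 2 ^ w"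
          using rg ri regs s j rPn by auto
      next
        fix r2 t2
        assume res: "r2 rRes = match_back (\<lambda>i. m' (r' rBase + i)) (\<lambda>i. m' (r' rN + r' rN + i)) (r' rP) (r' rI)"
          and fr2: "\<And>x. x \<notin> {rRes, rK, rS} \<Longrightarrow> r2 x = r' x"
          and t2: "t2 \<le> t' + csz (Less (Reg rI) (Reg rN \<oplus> Num 1)) + 2 + 40 * (r' rI + 1)"
        have "r2 rRes = f j"
          unfolding res f_def rg ri using fm regs j by (intro match_back_cong) auto
        moreover have "t2 + 16 \<le> t + 10 + 100 * (n + 1) * Suc j"
          using t2 t' ri j by (simp add: wps algebra_simps)
        moreover have "r2 rN = n" "r2 rI = j" "r2 rBase = n" using fr2 rg ri by auto
        ultimately show "wp w s (Put (Reg rN \<oplus> Reg rN \<oplus> Reg rN \<oplus> Reg rI) (Reg rRes))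
            (wp w s (Assign rI (Reg rI \<oplus> Num 1)) (\<lambda>(r, m, t). I (Suc j) r m t)) (r2, m', t2)"
          using fr fr2 fm fk s j by (auto simp: I_def less_Suc_eq)
      qed
      then show ?thesis using rg ri j w by (simp add: wps)
    qed
    subgoal premises I for r' m' t'
    proof -
      have "t' + 10 \<le> t + 120 * ((n + 1) * (n + 1))" using I by (simp add: I_def algebra_simps)
      then show ?thesis using I regs w by (auto simp: I_def f_def wps intro!: Q)
    qed
    done
qed

text \<open>The prefix row begins at \<open>4 n + 1\<close> and \<open>rU\<close> is the successor
  of a start, so the address \<open>4 n + rU\<close> is the entry of that start itself. The entry is
  one more than the prefix length, which provides the summand 1 of the rank; \<open>rC\<close> holds
  the row part of the label.\<close>

definition add_seeds :: com where
  "add_seeds = Assign rJ (Num 0) ;; Assign rL (Num 0) ;;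
     Loop (Less (Reg rJ) (Reg rN \<oplus> Num 1))
       (Assign rU (Mem (Reg rN \<oplus> Reg rN \<oplus> Reg rN \<oplus> Reg rJ)) ;;
        Ifte (Less (Num 0) (Reg rU))
          (Assign rX ((Mem (Reg rN \<oplus> Reg rN \<oplus> Reg rN \<oplus> Reg rN \<oplus> Reg rU) \<oplus> Reg rP) \<otimes> Reg rMM \<oplus> Reg rC \<oplus> Reg rJ) ;;
           Ifte (Less (Reg rL) (Reg rX)) (Assign rL (Reg rX)) Skip) Skip ;;
        Assign rU (Mem (Reg rV \<oplus> Reg rJ)) ;;
        Ifte (Less (Reg rL) (Reg rU)) (Assign rL (Reg rU)) Skip ;;
        Put (Reg rV \<oplus> Reg rJ) (Reg rL) ;;
        Assign rJ (Reg rJ \<oplus> Num 1))"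

lemma wp_add_seeds:
  assumes regs: "r rN = n" "r rV = vb" "0 < r rMM"
    and s: "n + n + n + n + n + 1 < vb" "vb + n < s" "s < 2 ^ w"
    and \<sigma>: "\<And>j. j \<le> n \<Longrightarrow> \<sigma> j = (if 0 < m (n + n + n + j)
        then (m (n + n + n + n + m (n + n + n + j)) + r rP) * r rMM + r rC + j else 0)"
    and b: "\<And>j. j \<le> n \<Longrightarrow> m (n + n + n + j) \<le> n + 1" "\<And>j. j \<le> n \<Longrightarrow> \<sigma> j < 2 ^ w"
    and Q: "\<And>r' m' t'. (\<And>j. j \<le> n \<Longrightarrow> m' (vb + j) = seed_row \<sigma> (\<lambda>j. m (vb + j)) j) \<Longrightarrow>
        (\<And>b. b < vb \<or> vb + n < b \<Longrightarrow> m' b = m b) \<Longrightarrow>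
        (\<And>x. x \<notin> {rJ, rL, rU, rX} \<Longrightarrow> r' x = r x) \<Longrightarrow>
        t' \<le> t + 100 * (n + 1) \<Longrightarrow> Q (r', m', t')"
  shows "wp w s add_seeds Q (r, m, t)"
proof -
  let ?B = "n + n + n"
  \<comment> \<open>The content of \<open>rL\<close> on entry to column \<open>j\<close>: the
    running maximum of the columns before it, and 0 at the outset.\<close>
  define g where "g j = (case j of 0 \<Rightarrow> 0 | Suc k \<Rightarrow> seed_row \<sigma> (\<lambda>j. m (vb + j)) k)" for j
  have gS: "seed_row \<sigma> (\<lambda>j. m (vb + j)) j = max (max (g j) (\<sigma> j)) (m (vb + j))" for j
    by (cases j) (auto simp: g_def)
  have gS': "g (Suc j) = max (max (g j) (\<sigma> j)) (m (vb + j))" for j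
    using gS by (simp add: g_def)
  define I where "I j r' m' t' \<longleftrightarrow> (\<forall>k<j. m' (vb + k) = g (Suc k)) \<and>
     (\<forall>b. b < vb \<or> vb + j \<le> b \<longrightarrow> m' b = m b) \<and>
     (\<forall>x. x \<notin> {rJ, rL, rU, rX} \<longrightarrow> r' x = r x) \<and> r' rJ = j \<and> r' rL = g j \<and>
     t' \<le> t + 10 + 70 * j" for j r' m' t'
  have w: "1 < (2::nat) ^ w" "0 < (2::nat) ^ w" "n + 1 < 2 ^ w"
    using s by auto
  show ?thesis unfolding add_seeds_def
    apply (simp add: w del: One_nat_def)
    apply (rule wp_for[where I = I and i = 0 and q = "n + 1"])
    subgoal by (simp add: I_def regs g_def)
    subgoal by simp
    subgoal premises j for j r' m' t'
    proof -
      have fr: "\<And>x. x \<notin> {rJ, rL, rU, rX} \<Longrightarrow> r' x = r x" and rj: "r' rJ = j" "r' rL = g j"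
        and fm: "\<And>b. b < vb \<or> vb + j \<le> b \<Longrightarrow> m' b = m b" and fk: "\<And>k. k < j \<Longrightarrow> m' (vb + k) = g (Suc k)"
        and t': "t' \<le> t + 10 + 70 * j"
        using j unfolding I_def by auto
      have rg: "r' rN = n" "r' rP = r rP" "r' rV = vb" "r' rMM = r rMM" "r' rC = r rC" using fr regs by auto
      let ?u = "m (?B + j)"
      have jn: "j \<le> n" using j by simp
      note u = b(1)[OF jn]
      have mm: "m' (?B + j) = ?u" "m' (?B + n + ?u) = m (?B + n + ?u)" "m' (vb + j) = m (vb + j)"
        using fm jn u s by auto
      have bb: "?B + j < s" "?B + n + ?u < s" "vb + j < s" "n + n < 2 ^ w" "?B < 2 ^ w" "?B + j < 2 ^ w"
        "?B + n < 2 ^ w" "?B + n + ?u < 2 ^ w" "vb + j < 2 ^ w" "j + 1 < 2 ^ w" "j < n + 1"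
        using jn u s by auto
      have prod: "m (?B + n + ?u) + r rP < 2 ^ w \<and> (m (?B + n + ?u) + r rP) * r rMM < 2 ^ w \<and>
          (m (?B + n + ?u) + r rP) * r rMM + r rC < 2 ^ w \<and>
          (m (?B + n + ?u) + r rP) * r rMM + r rC + j < 2 ^ w" if "0 < ?u"
      proof -
        \<comment> \<open>As the factor is positive, every intermediate result is at most the final
          one, for which a bound is assumed.\<close>
        have "m (?B + n + ?u) + r rP \<le> (m (?B + n + ?u) + r rP) * r rMM"
          using regs(3) by (cases "r rMM") auto
        moreover have "(m (?B + n + ?u) + r rP) * r rMM + r rC + j < 2 ^ w"
          using b(2)[OF jn] \<sigma>[OF jn] that by simp
        ultimately show ?thesis by (intro conjI; linarith)
      qed
      have step_I: "I (Suc j) (r2(15 := j + 1)) (m'(vb + j := x)) t2"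
        if "x = g (Suc j)" "r2 rL = g (Suc j)" "\<And>x. x \<notin> {rJ, rL, rU, rX} \<Longrightarrow> r2 x = r' x" "t2 \<le> t' + 70" for r2 x t2
        unfolding I_def using that fr fm fk t' by (auto simp: less_Suc_eq)
      note \<sigma>j = \<sigma>[OF jn]
      show ?thesis
      proof (cases "0 < ?u")
        case True
        then show ?thesis
          apply (simp add: wps rg rj w bb prod mm del: One_nat_def)
          apply (intro conjI impI; rule step_I; simp add: gS' \<sigma>j max_def rj)
          done
      next
        case False
        then show ?thesis
          apply (simp add: wps rg rj w bb mm del: One_nat_def)
          apply (intro conjI impI; rule step_I; simp add: gS' \<sigma>j max_def rj)
          done
      qed
    qed
    subgoal for r' m' t'
      using regs w by (auto simp: I_def wps g_def intro!: Q)
    done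
qed

section \<open>Hirschberg's bisection\<close>

abbreviation (input) "rO \<equiv> 40 :: nat"
abbreviation (input) "rTop \<equiv> 41 :: nat"
abbreviation (input) "rLeft \<equiv> 42 :: nat"
abbreviation (input) "rSp \<equiv> 43 :: nat"
abbreviation (input) "rBot \<equiv> 44 :: nat"
abbreviation (input) "rRight \<equiv> 45 :: nat"
abbreviation (input) "rMid \<equiv> 46 :: nat"
abbreviation (input) "rStack \<equiv> 48 :: nat"

text \<open>The entries are multiples of \<open>M\<close> when this runs in the bisection, so adding
  the column turns each of them into a seed that carries its own position.\<close>

definition label :: com where
  "label = Assign rJ (Num 0) ;; Loop (Less (Reg rJ) (Reg rQ \<oplus> Num 1))
     (Put (Reg rV \<oplus> Reg rJ) (Mem (Reg rV \<oplus> Reg rJ) \<oplus> Reg rJ) ;; Assign rJ (Reg rJ \<oplus> Num 1))"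

lemma wp_label:
  assumes regs: "r rQ = q" "r rV = vb" and s: "vb + q < s" "s < 2 ^ w"
    and b: "\<And>j. j \<le> q \<Longrightarrow> m (vb + j) + j < 2 ^ w"
    and Q: "\<And>r' m' t'. (\<And>j. j \<le> q \<Longrightarrow> m' (vb + j) = m (vb + j) + j) \<Longrightarrow>
        (\<And>b. b < vb \<or> vb + q < b \<Longrightarrow> m' b = m b) \<Longrightarrow>
        (\<And>x. x \<noteq> rJ \<Longrightarrow> r' x = r x) \<Longrightarrow> t' \<le> t + 40 * (q + 1) \<Longrightarrow> Q (r', m', t')"
  shows "wp w s label Q (r, m, t)"
  unfolding label_def
  apply (simp add: del: One_nat_def)
  apply (rule wp_for[where i = 0 and q = "q + 1" and I = "\<lambda>j r' m' t'. (\<forall>k<j. m' (vb + k) = m (vb + k) + k) \<and>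
     (\<forall>b. b < vb \<or> vb + j \<le> b \<longrightarrow> m' b = m b) \<and> (\<forall>x. x \<noteq> rJ \<longrightarrow> r' x = r x) \<and> r' rJ = j \<and>
     t' \<le> t + 2 + 20 * j"])
  subgoal by simp
  subgoal by simp
  subgoal using regs s b by (auto simp: wps less_Suc_eq)
  subgoal using regs s by (auto simp: wps intro!: Q)
  done

text \<open>After a hit the counter jumps to the right border, which ends the loop and prevents a
  second output.\<close>

definition scan :: com where
  "scan = Assign rJ (Reg rLeft) ;; Loop (Less (Reg rJ) (Reg rRight))
     (Ifte (Eq (Mem (Reg rN \<oplus> Reg rJ)) (Mem (Reg rTop)))
       (Put (Reg rO) (Mem (Reg rTop)) ;; Assign rO (Reg rO \<oplus> Num 1) ;; Assign rJ (Reg rRight))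
       (Assign rJ (Reg rJ \<oplus> Num 1)))"

lemma wp_scan:
  assumes s: "r rN + r rRight \<le> r rO" "r rO < s" "r rTop < r rO" "s < 2 ^ w" "r rLeft \<le> r rRight"
    and Q: "\<And>r' m' t'. m' = (if \<exists>k. r rLeft \<le> k \<and> k < r rRight \<and> m (r rN + k) = m (r rTop)
          then m(r rO := m (r rTop)) else m) \<Longrightarrow>
        r' rO = (if \<exists>k. r rLeft \<le> k \<and> k < r rRight \<and> m (r rN + k) = m (r rTop)
          then r rO + 1 else r rO) \<Longrightarrow>
        (\<And>x. x \<noteq> rJ \<Longrightarrow> x \<noteq> rO \<Longrightarrow> r' x = r x) \<Longrightarrow> t' \<le> t + 10 + 30 * (r rRight - r rLeft) \<Longrightarrow> Q (r', m', t')"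
  shows "wp w s scan Q (r, m, t)"
proof -
  let ?P = "\<lambda>e. \<exists>k. r rLeft \<le> k \<and> k < e \<and> m (r rN + k) = m (r rTop)"
  define I where "I r' m' t' \<longleftrightarrow> (\<forall>x. x \<noteq> rJ \<longrightarrow> x \<noteq> rO \<longrightarrow> r' x = r x) \<and>
     r rLeft \<le> r' rJ \<and> r' rJ \<le> r rRight \<and> t' + 30 * (r rRight - r' rJ) \<le> t + 2 + 30 * (r rRight - r rLeft) \<and>
     (if ?P (r' rJ) then r' rJ = r rRight \<and> m' = m(r rO := m (r rTop)) \<and> r' rO = r rO + 1
      else m' = m \<and> r' rO = r rO)" for r' m' t'
  show ?thesis unfolding scan_def
    apply (simp del: One_nat_def)
    apply (rule wp_while[where I = I and f = "\<lambda>r'. r rRight - r' rJ"])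
    subgoal using s by (auto simp: I_def)
    subgoal premises I for r' m' t'
    proof (cases "r' rJ < r rRight")
      case True
      then have nP: "\<not> ?P (r' rJ)" using I unfolding I_def by (auto split: if_splits)
      have fr: "\<And>x. x \<noteq> rJ \<Longrightarrow> x \<noteq> rO \<Longrightarrow> r' x = r x" and m': "m' = m" "r' rO = r rO"
        and j: "r rLeft \<le> r' rJ" and t': "t' + 30 * (r rRight - r' rJ) \<le> t + 2 + 30 * (r rRight - r rLeft)"
        using I nP unfolding I_def by auto
      have rg: "r' rN = r rN" "r' rRight = r rRight" "r' rTop = r rTop" using fr by auto
      have b: "r rN + r' rJ < s" "r rN + r' rJ < 2 ^ w" "r' rJ + 1 < 2 ^ w" "1 < (2::nat) ^ w" "r rTop < s"
        "r rO < s" "r rO + 1 < 2 ^ w" using s True by auto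
      show ?thesis
      proof (cases "m (r rN + r' rJ) = m (r rTop)")
        case eq: True
        then have P: "?P (r rRight)" using True j by auto
        have "I (r'(rO := r rO + 1, rJ := r rRight)) (m(r rO := m (r rTop))) t2"
          if "t2 \<le> t' + 30" for t2
          using that P True fr t' j unfolding I_def by auto
        then show ?thesis using True eq rg b m' by (simp add: wps del: One_nat_def)
      next
        case ne: False
        then have "\<not> ?P (r' rJ + 1)" using nP by (auto simp: less_Suc_eq)
        then have "I (r'(rJ := r' rJ + 1)) m t2" if "t2 \<le> t' + 30" for t2
          using that True fr t' j m' unfolding I_def by auto
        then show ?thesis using True ne rg b m' by (simp add: wps del: One_nat_def)
      qed
    next
      case False
      then have "r' rJ = r rRight" "r' rRight = r rRight" using I by (auto simp: I_def)
      then show ?thesis using I by (auto simp: I_def wps intro!: Q)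
    qed
    done
qed


definition bisect4 :: com where
  "bisect4 =
     Assign rA (Bin Mod (Mem (Reg rV \<oplus> Reg rQ)) (Reg rM)) ;;
     Put (Reg rSp) (Reg rMid) ;;
     Put (Reg rSp \<oplus> Num 1) (Reg rLeft \<oplus> Reg rA) ;;
     Assign rSp (Reg rSp \<oplus> Num 2)"

definition bisect3 :: com where
  "bisect3 = label ;; Assign rEnd (Reg rBot) ;; rows ;; bisect4"

definition bisect2 :: com where
  "bisect2 = Assign rA (Reg rTop) ;; Assign rEnd (Reg rMid) ;; rows ;; bisect3"

definition bisect :: com where
  "bisect =
     Assign rMid (Bin Div (Reg rTop \<oplus> Reg rBot) (Num 2)) ;;
     Assign rB (Reg rN \<oplus> Reg rLeft) ;;
     Assign rQ (Reg rRight \<ominus> Reg rLeft) ;;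
     Assign rV (Reg rN \<oplus> Reg rN \<oplus> Reg rN \<oplus> Reg rN \<oplus> Reg rN \<oplus> Num 2) ;;
     Assign rM (Reg rN \<oplus> Num 1) ;;
     Assign rVal (Reg rN \<oplus> Num 1) ;;
     fill ;; bisect2"

text \<open>The upper half is swept with uniform seeds, its last row is labelled with columns, and
  the sweep goes on through the lower half; \<open>row_steps_crossing\<close> reads the column off
  the last cell. The rectangle is traversed once, with \<open>M = n + 1\<close> exceeding every
  column label.\<close>

lemma wp_bisect:
  assumes len: "length A = n" "length B = n"
    and A: "\<And>k. k < n \<Longrightarrow> m k = A ! k" and B: "\<And>k. k < n \<Longrightarrow> m (n + k) = B ! k"
    and regs: "r rN = n" "r rTop = i" "r rLeft = c" "r rBot = i'" "r rRight = c'" "r rSp = sp"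
    and rect: "i \<le> i'" "i' \<le> n" "c \<le> c'" "c' \<le> n"
    and vb: "vb = n + n + n + n + n + 2" "vb + n < sp" "sp + 1 < s" "s < 2 ^ w" and big: "3 * ((n + 1) * (n + 1)) < 2 ^ w"
    and Q: "\<And>r' m' t' k. k \<le> c' - c \<Longrightarrow>
        lcs (slice A i i') (slice B c c') =
          lcs (slice A i ((i + i') div 2)) (slice B c (c + k)) +
          lcs (slice A ((i + i') div 2) i') (slice B (c + k) c') \<Longrightarrow>
        m' sp = (i + i') div 2 \<Longrightarrow> m' (sp + 1) = c + k \<Longrightarrow>
        (\<And>b. b < vb \<or> vb + n < b \<and> b \<noteq> sp \<and> b \<noteq> sp + 1 \<Longrightarrow> m' b = m b) \<Longrightarrow>
        r' rSp = sp + 2 \<Longrightarrow> (\<And>x. x \<notin> {rA..rVal} \<union> {rSp, rMid} \<Longrightarrow> r' x = r x) \<Longrightarrow>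
        t' \<le> t + 200 + 80 * (c' - c + 1) + 80 * (i' - i) * (c' - c + 1) \<Longrightarrow> Q (r', m', t')"
  shows "wp w s bisect Q (r, m, t)"
proof -
  define X Y where "X = slice A i i'" and "Y = slice B c c'"
  define M where "M = n + 1"
  define q where "q = c' - c"
  define mid where "mid = (i + i') div 2"
  define p where "p = mid - i"
  have mid: "i \<le> mid" "mid \<le> i'" "mid = i + p" using rect by (auto simp: mid_def p_def)
  have XY: "length X = i' - i" "length Y = q" "p \<le> length X" using rect len mid by (auto simp: X_def Y_def q_def length_slice)
  have q: "q \<le> n" "length Y < M" "0 < M" using rect XY by (auto simp: q_def M_def)
  have Xm: "X ! k = m (i + k)" if "k < i' - i" for k
    using that rect len A[of "i + k"] by (simp add: X_def nth_slice)
  have Ym: "Y ! k = m (n + c + k)" if "k < q" for k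
    using that rect len B[of "c + k"] by (simp add: Y_def q_def nth_slice add.assoc)
  have vbs: "vb + q < s" "vb < 2 ^ w" "sp + 1 < 2 ^ w" "sp + 2 < 2 ^ w \<or> sp + 2 = s" using vb q by auto
  define u where "u j = M * (1 + lcs (take p X) (take j Y))" for j
  define v where "v = row_steps (\<lambda>k. X ! (p + k)) ((!) Y) M (\<lambda>j. u j + j)"
  note cross = row_steps_crossing[OF XY(3) q(2) v_def[unfolded u_def]]
  define k where "k = v (length X - p) (length Y) mod M"
  \<comment> \<open>The left side bounds the largest number that occurs: a seed, its matches and one
    further addition of \<open>M\<close>. This is the origin of the factor 3 in the word size
    condition.\<close>
  have Mq: "M * (1 + q) + q + M * q + M \<le> 3 * ((n + 1) * (n + 1))"
  proof -
    have "n * q \<le> n * n" using q by simp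
    then have "q + n * q \<le> n + n * n" using q by linarith
    then show ?thesis using q(1) by (simp add: M_def algebra_simps)
  qed
  \<comment> \<open>\<open>G\<close> and \<open>F\<close> collect what all later stages leave
    intact: the parameters of the rectangle, and the memory outside the working row.\<close>
  define G where "G r' \<longleftrightarrow> r' rB = n + c \<and> r' rQ = q \<and> r' rV = vb \<and> r' rM = M \<and> r' rTop = i \<and> r' rBot = i' \<and>
    r' rMid = mid \<and> r' rSp = sp \<and> r' rLeft = c \<and> r' rN = n \<and>
    (\<forall>x. x \<notin> {rA..rVal} \<union> {rSp, rMid} \<longrightarrow> r' x = r x)" for r'
  define F where "F m' \<longleftrightarrow> (\<forall>b. b < vb \<or> vb + q < b \<longrightarrow> m' b = m b)" for m'
  have G_upd: "G r'" if "G r''" "\<And>x. x \<notin> {rA, rJ, rD, rL, rU, rX, rEnd} \<Longrightarrow> r' x = r'' x" for r' r''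
    using that by (auto simp: G_def)
  have 4: "wp w s bisect4 Q (r1, m1, t1)"
    if h: "G r1" "F m1" "m1 (vb + q) = v (length X - p) (length Y)"
      "t1 + 40 \<le> t + 200 + 80 * (q + 1) + 80 * (i' - i) * (q + 1)" for r1 m1 t1
  proof -
    have "k \<le> q" using cross(2) XY by (simp add: k_def)
    then have ck: "c + k \<le> n" using rect by (simp add: q_def)
    have lcs: "lcs (slice A i i') (slice B c c') =
          lcs (slice A i mid) (slice B c (c + k)) + lcs (slice A mid i') (slice B (c + k) c')"
    proof -
      have "take p X = slice A i mid" "drop p X = slice A mid i'"
        using mid by (simp_all add: X_def take_slice drop_slice)
      moreover have "take k Y = slice B c (c + k)" "drop k Y = slice B (c + k) c'"
        using \<open>k \<le> q\<close> by (simp_all add: Y_def q_def take_slice drop_slice)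
      ultimately show ?thesis using cross(3) unfolding k_def[symmetric] X_def[symmetric] Y_def[symmetric] by simp
    qed
    have post: "Q (r1(rA := k, rSp := sp + 2), m1(sp := mid, sp + 1 := c + k), t2)" if t2: "t2 \<le> t1 + 40" for t2
    proof (rule Q[of k])
      show "k \<le> c' - c" using \<open>k \<le> q\<close> by (simp add: q_def)
      show "lcs (slice A i i') (slice B c c') =
          lcs (slice A i ((i + i') div 2)) (slice B c (c + k)) +
          lcs (slice A ((i + i') div 2) i') (slice B (c + k) c')"
        using lcs by (simp only: mid_def)
      show "t2 \<le> t + 200 + 80 * (c' - c + 1) + 80 * (i' - i) * (c' - c + 1)"
        using t2 h(4) unfolding q_def by linarith
      show "(m1(sp := mid, sp + 1 := c + k)) b = m b" if "b < vb \<or> vb + n < b \<and> b \<noteq> sp \<and> b \<noteq> sp + 1" for b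
        using that h(2) vb q by (auto simp: F_def)
    qed (use h(1) in \<open>auto simp: G_def mid_def\<close>)
    show ?thesis unfolding bisect4_def
      using h(1,3) vb vbs ck post by (simp add: G_def k_def wps del: One_nat_def)
  qed
  have uv: "row_steps (\<lambda>k. m1 (mid + k)) (\<lambda>k. m1 (n + c + k)) M (\<lambda>j. m1 (vb + j)) l j = v l j"
    if "F m1" "\<And>j. j \<le> q \<Longrightarrow> m1 (vb + j) = u j + j" "l \<le> i' - mid" "j \<le> q" for m1 l j
    unfolding v_def
  proof (rule row_steps_cong[where q = q])
    show "m1 (mid + k) = X ! (p + k)" if "k < l" for k
      using Xm[of "p + k"] that \<open>l \<le> i' - mid\<close> \<open>F m1\<close> mid rect vb by (simp add: F_def add_ac)
    show "m1 (n + c + k) = Y ! k" if "k < q" for k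
      using Ym[OF that] \<open>F m1\<close> that rect vb by (simp add: F_def q_def)
  qed (use that in auto)
  have 3: "wp w s bisect3 Q (r1, m1, t1)"
    if G: "G r1" and Ra: "r1 rA = mid" and F: "F m1" and u: "\<And>j. j \<le> q \<Longrightarrow> m1 (vb + j) = u j"
      and t1: "t1 + 100 + 40 * (q + 1) + 80 * (i' - mid) * (q + 1) \<le> t + 200 + 80 * (q + 1) + 80 * (i' - i) * (q + 1)" for r1 m1 t1
    unfolding bisect3_def wp_Seq
  proof (rule wp_label[where q = q and vb = vb])
    show "r1 rQ = q" "r1 rV = vb" using G by (auto simp: G_def)
    show "vb + q < s" "s < 2 ^ w" using vbs vb by auto
    show "m1 (vb + j) + j < 2 ^ w" if "j \<le> q" for j
    proof -
      have "v 0 j \<le> M * (1 + q) + q + M * q" using cross(1)[of 0 j] XY that by simp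
      then show ?thesis using u[OF that] Mq big by (simp add: v_def)
    qed
  next
    fix r2 m2 t2
    assume m2: "\<And>j. j \<le> q \<Longrightarrow> m2 (vb + j) = m1 (vb + j) + j" and F2: "\<And>b. b < vb \<or> vb + q < b \<Longrightarrow> m2 b = m1 b"
      and r2: "\<And>x. x \<noteq> rJ \<Longrightarrow> r2 x = r1 x" and t2: "t2 \<le> t1 + 40 * (q + 1)"
    have G2: "G (r2(rEnd := i'))" using r2 by (intro G_upd[OF G]) auto
    have F2': "F m2" using F F2 by (auto simp: F_def)
    have m2': "m2 (vb + j) = u j + j" if "j \<le> q" for j using m2 u that by simp
    have "wp w s rows (wp w s bisect4 Q) (r2(rEnd := i'), m2, t2 + 2)"
    proof (rule wp_rows[where a = mid and a' = i' and bb = "n + c" and q = q and vb = vb and M = M])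
      show "(r2(rEnd := i')) rA = mid" "(r2(rEnd := i')) rEnd = i'" "(r2(rEnd := i')) rB = n + c"
        "(r2(rEnd := i')) rQ = q" "(r2(rEnd := i')) rV = vb" "(r2(rEnd := i')) rM = M"
        using G2 r2 Ra by (auto simp: G_def)
      show "mid \<le> i'" "i' \<le> vb" "n + c + q \<le> vb" "vb + q < s" "s < 2 ^ w"
        using mid rect vb vbs by (auto simp: q_def)
      show "row_steps (\<lambda>k. m2 (mid + k)) (\<lambda>k. m2 (n + c + k)) M (\<lambda>j. m2 (vb + j)) l j + M < 2 ^ w"
        if "l \<le> i' - mid" "j \<le> q" for l j
      proof -
        have "v l j \<le> M * (1 + q) + q + M * q" using cross(1)[of l j] XY that mid by simp
        then show ?thesis using uv[OF F2' m2' that] Mq big by simp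
      qed
    next
      fix r3 m3 t3
      assume m3: "\<And>j. j \<le> q \<Longrightarrow> m3 (vb + j) = row_steps (\<lambda>k. m2 (mid + k)) (\<lambda>k. m2 (n + c + k)) M (\<lambda>j. m2 (vb + j)) (i' - mid) j"
        and F3: "\<And>b. b < vb \<or> vb + q < b \<Longrightarrow> m3 b = m2 b"
        and r3: "\<And>x. x \<notin> {rA, rJ, rD, rL, rU, rX} \<Longrightarrow> r3 x = (r2(rEnd := i')) x"
        and t3: "t3 \<le> t2 + 2 + 10 + 80 * (i' - mid) * (q + 1)"
      show "wp w s bisect4 Q (r3, m3, t3)"
      proof (rule 4)
        show "G r3" using r3 by (intro G_upd[OF G2]) auto
        show "F m3" using F2' F3 by (auto simp: F_def)
        have "i' - mid = length X - p" using mid XY by auto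
        then show "m3 (vb + q) = v (length X - p) (length Y)"
          using m3[of q] uv[OF F2' m2', of "i' - mid" q] XY by simp
        show "t3 + 40 \<le> t + 200 + 80 * (q + 1) + 80 * (i' - i) * (q + 1)"
          using t1 t2 t3 by linarith
      qed
    qed
    then show "wp w s (Assign rEnd (Reg rBot)) (wp w s rows (wp w s bisect4 Q)) (r2, m2, t2)"
      using G2 by (simp add: G_def numeral_2_eq_2)
  qed
  have 2: "wp w s bisect2 Q (r1, m1, t1)"
    if G: "G r1" and F: "F m1" and u1: "\<And>j. j \<le> q \<Longrightarrow> m1 (vb + j) = M"
      and t1: "t1 + 120 + 40 * (q + 1) \<le> t + 200 + 80 * (q + 1)" for r1 m1 t1
  proof -
    have G2: "G (r1(rA := i, rEnd := mid))" by (intro G_upd[OF G]) auto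
    have steps: "row_steps (\<lambda>k. m1 (i + k)) (\<lambda>k. m1 (n + c + k)) M (\<lambda>j. m1 (vb + j)) l j =
        M * (1 + lcs (take l X) (take j Y))" if "l \<le> p" "j \<le> q" for l j
    proof -
      have "row_steps (\<lambda>k. m1 (i + k)) (\<lambda>k. m1 (n + c + k)) M (\<lambda>j. m1 (vb + j)) l j =
        row_steps (\<lambda>k. X ! k) ((!) Y) M (\<lambda>_. M) l j"
      proof (rule row_steps_cong[where q = q])
        show "m1 (i + k) = X ! k" if "k < l" for k
          using Xm[of "k"] that \<open>l \<le> p\<close> F mid rect vb by (simp add: F_def)
        show "m1 (n + c + k) = Y ! k" if "k < q" for k
          using Ym[OF that] F that rect vb by (simp add: F_def q_def)
      qed (use that u1 in auto)
      then show ?thesis using row_steps_uniform[OF q(3), of l X j Y] that XY by simp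
    qed
    have "wp w s rows (wp w s bisect3 Q) (r1(rA := i, rEnd := mid), m1, t1')" if t1': "t1' \<le> t1 + 4" for t1'
    proof (rule wp_rows[where a = i and a' = mid and bb = "n + c" and q = q and vb = vb and M = M])
      show "(r1(rA := i, rEnd := mid)) rA = i" "(r1(rA := i, rEnd := mid)) rEnd = mid" "(r1(rA := i, rEnd := mid)) rB = n + c"
        "(r1(rA := i, rEnd := mid)) rQ = q" "(r1(rA := i, rEnd := mid)) rV = vb" "(r1(rA := i, rEnd := mid)) rM = M"
        using G by (auto simp: G_def)
      show "i \<le> mid" "mid \<le> vb" "n + c + q \<le> vb" "vb + q < s" "s < 2 ^ w"
        using mid rect vb vbs by (auto simp: q_def)
      show "row_steps (\<lambda>k. m1 (i + k)) (\<lambda>k. m1 (n + c + k)) M (\<lambda>j. m1 (vb + j)) l j + M < 2 ^ w"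
        if "l \<le> mid - i" "j \<le> q" for l j
      proof -
        have "lcs (take l X) (take j Y) \<le> q" using lcs_le2[of "take l X" "take j Y"] that XY by simp
        then have "M * (1 + lcs (take l X) (take j Y)) \<le> M * (1 + q)" by (intro mult_le_mono2) simp
        moreover have "l \<le> p" using that by (simp add: p_def)
        ultimately show ?thesis using steps[of l j] that Mq big by linarith
      qed
    next
      fix r3 m3 t3
      assume m3: "\<And>j. j \<le> q \<Longrightarrow> m3 (vb + j) = row_steps (\<lambda>k. m1 (i + k)) (\<lambda>k. m1 (n + c + k)) M (\<lambda>j. m1 (vb + j)) (mid - i) j"
        and F3: "\<And>b. b < vb \<or> vb + q < b \<Longrightarrow> m3 b = m1 b"
        and r3: "\<And>x. x \<notin> {rA, rJ, rD, rL, rU, rX} \<Longrightarrow> r3 x = (r1(rA := i, rEnd := mid)) x"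
        and r3A: "r3 rA = mid"
        and t3: "t3 \<le> t1' + 10 + 80 * (mid - i) * (q + 1)"
      show "wp w s bisect3 Q (r3, m3, t3)"
      proof (rule 3)
        show "G r3" using r3 by (intro G_upd[OF G2]) auto
        show "F m3" using F F3 by (auto simp: F_def)
        show "r3 rA = mid" by fact
        show "m3 (vb + j) = u j" if "j \<le> q" for j
          using m3[OF that] steps[of p j] that by (simp add: u_def p_def)
        have "i' - i = (mid - i) + (i' - mid)" using mid by simp
        then have "80 * (i' - i) * (q + 1) = 80 * (mid - i) * (q + 1) + 80 * (i' - mid) * (q + 1)"
          by (simp only: add_mult_distrib add_mult_distrib2)
        then show "t3 + 100 + 40 * (q + 1) + 80 * (i' - mid) * (q + 1) \<le> t + 200 + 80 * (q + 1) + 80 * (i' - i) * (q + 1)"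
          using t1 t1' t3 by linarith
      qed
    qed
    then show ?thesis unfolding bisect2_def
      using G by (simp add: G_def)
  qed
  define r1 where "r1 = r(rMid := mid, rB := n + c, rQ := q, rV := vb, rM := M, rVal := M)"
  have G1: "G r1" unfolding G_def r1_def using regs by (auto simp: mid_def)
  have 1: "wp w s fill (wp w s bisect2 Q) (r1, m, t1)" if "t1 \<le> t + 60" for t1
  proof (rule wp_fill[where q = q and vb = vb])
    fix r2 m2 t2
    assume m2: "\<And>j. j \<le> q \<Longrightarrow> m2 (vb + j) = r1 rVal" and F2: "\<And>b. b < vb \<or> vb + q < b \<Longrightarrow> m2 b = m b"
      and r2: "\<And>x. x \<noteq> rJ \<Longrightarrow> r2 x = r1 x" and t2: "t2 \<le> t1 + 40 * (q + 1)"
    show "wp w s bisect2 Q (r2, m2, t2)"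
    proof (rule 2)
      show "G r2" using r2 by (intro G_upd[OF G1]) auto
      show "F m2" using F2 by (auto simp: F_def)
      show "m2 (vb + j) = M" if "j \<le> q" for j using m2[OF that] by (simp add: r1_def)
      show "t2 + 120 + 40 * (q + 1) \<le> t + 200 + 80 * (q + 1)" using t2 that by simp
    qed
  qed (use vb vbs in \<open>auto simp: r1_def\<close>)
  have b: "n + n < 2 ^ w" "n + n + n < 2 ^ w" "n + n + n + n < 2 ^ w" "n + n + n + n + n < 2 ^ w"
    "n + 1 < 2 ^ w" "n + c < 2 ^ w" "i + i' < 2 ^ w" "2 < (2::nat) ^ w" "c' < 2 ^ w"
    using vb rect by auto
  have upd: "r(rMid := mid, rB := n + c, rQ := c' - c, rV := n + n + n + n + n + 2, rM := n + 1, rVal := n + 1) = r1"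
    by (simp add: r1_def vb M_def q_def)
  show ?thesis unfolding bisect_def
    using 1 b vbs vb(1) rect upd by (simp add: regs flip: mid_def)
qed

section \<open>The recursion on an explicit stack\<close>

definition pop :: com where
  "pop = Assign rTop (Reg rBot) ;; Assign rLeft (Reg rRight) ;; Assign rSp (Reg rSp \<ominus> Num 2)"

definition hirschberg_case :: com where
  "hirschberg_case =
     Ifte (Eq ((Reg rBot \<ominus> Reg rTop) \<otimes> (Reg rRight \<ominus> Reg rLeft)) (Num 0))
       pop
       (Ifte (Eq (Reg rBot) (Reg rTop \<oplus> Num 1)) (scan ;; pop) bisect)"

definition hirschberg_body :: com where
  "hirschberg_body =
     Assign rBot (Mem (Reg rSp \<ominus> Num 2)) ;;
     Assign rRight (Mem (Reg rSp \<ominus> Num 1)) ;;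
     hirschberg_case"

text \<open>Successive rectangles touch at corners: each begins where the one before it ended. The
  stack thus holds lower right corners only, and the current upper left corner lives in
  \<open>rTop\<close> and \<open>rLeft\<close>.\<close>

definition hirschberg :: com where
  "hirschberg = Loop (Less (Reg rStack) (Reg rSp)) hirschberg_body"

text \<open>Solves the time recurrence. Both halves have at most two thirds of the rows, the worst
  case being \<open>p = 3\<close>, so the two calls use at most two thirds of
  \<open>1600 * p * q\<close>; the remaining third pays for the sweep.\<close>

lemma bisection_cost:
  fixes p q k :: nat
  assumes "2 \<le> p" "1 \<le> q" "k \<le> q"
  shows "340 + 80 * (q + 1) + 80 * p * (q + 1) + (1600 * (p div 2) * k + 200) + (1600 * (p - p div 2) * (q - k) + 200)
    \<le> 1600 * p * q + 200"
proof -
  have "3 * (p div 2) \<le> 2 * p" "3 * (p - p div 2) \<le> 2 * p" using assms by linarith+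
  then have "3 * (p div 2) * k \<le> 2 * p * k" "3 * (p - p div 2) * (q - k) \<le> 2 * p * (q - k)"
    by (intro mult_right_mono; simp)+
  moreover have "2 * p * k + 2 * p * (q - k) = 2 * p * q"
    using assms by (metis add_mult_distrib2 le_add_diff_inverse)
  ultimately have 1: "3 * ((p div 2) * k) + 3 * ((p - p div 2) * (q - k)) \<le> 2 * (p * q)"
    unfolding mult.assoc by linarith
  have 2: "2 * q \<le> p * q" "p \<le> p * q" "2 \<le> p * q" using assms mult_le_mono[of 2 p 1 q] by simp_all
  have 3: "80 * p * (q + 1) = 80 * (p * q) + 80 * p" "80 * (q + 1) = 80 * q + 80"
    "1600 * a * b = 1600 * (a * b)" for a b :: nat
    by simp_all
  show ?thesis
    using 1 2 unfolding 3 by linarith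
qed

text \<open>Describes how the loop processes the topmost stack entry, with the rest of the loop as
  continuation, so that the two recursive uses chain without a separate sequencing argument. Each
  level pushes two words and loses at least one row, whence the stack room
  \<open>2 * (i' - i)\<close>.\<close>

lemma wp_hirschberg:
  assumes len: "length A = n" "length B = n"
    and vb: "n + n + n + n + n + 2 + n < st" "st + 2 \<le> ob" "ob < 2 ^ w" "s < 2 ^ w"
    and big: "3 * ((n + 1) * (n + 1)) < 2 ^ w"
  shows "i \<le> i' \<Longrightarrow> i' \<le> n \<Longrightarrow> c \<le> c' \<Longrightarrow> c' \<le> n \<Longrightarrow>
    (\<And>k. k < n \<Longrightarrow> m k = A ! k) \<Longrightarrow> (\<And>k. k < n \<Longrightarrow> m (n + k) = B ! k) \<Longrightarrow>
    r rN = n \<Longrightarrow> r rStack = st \<Longrightarrow> r rTop = i \<Longrightarrow> r rLeft = c \<Longrightarrow> r rSp = sp + 2 \<Longrightarrow> r rO = out \<Longrightarrow>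
    m sp = i' \<Longrightarrow> m (sp + 1) = c' \<Longrightarrow>
    st \<le> sp \<Longrightarrow> sp + 2 + 2 * (i' - i) \<le> ob \<Longrightarrow> ob \<le> out \<Longrightarrow> out + (i' - i) < s \<Longrightarrow>
    (\<And>r' m' t' Z. common_subseq (slice A i i') (slice B c c') Z \<Longrightarrow>
        length Z = lcs (slice A i i') (slice B c c') \<Longrightarrow>
        (\<And>k. k < length Z \<Longrightarrow> m' (out + k) = Z ! k) \<Longrightarrow>
        (\<And>a. a < n + n + n + n + n + 2 \<or> n + n + n + n + n + 2 + n < a \<and> a < sp + 2 \<or> ob \<le> a \<and> a < out \<Longrightarrow> m' a = m a) \<Longrightarrow>
        (\<And>x. x \<notin> {10..21} \<union> {40..47} \<Longrightarrow> r' x = r x) \<Longrightarrow>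
        r' rTop = i' \<Longrightarrow> r' rLeft = c' \<Longrightarrow> r' rSp = sp \<Longrightarrow> r' rO = out + length Z \<Longrightarrow>
        t' \<le> t + 1600 * (i' - i) * (c' - c) + 200 \<Longrightarrow> wp w s hirschberg Q (r', m', t')) \<Longrightarrow>
    wp w s hirschberg Q (r, m, t)"
proof (induction "i' - i" arbitrary: i i' c c' r m t sp out rule: less_induct)
  case less
  note rect = less.prems(1-4) and A = less.prems(5) and B = less.prems(6) and regs = less.prems(7-12)
    and top = less.prems(13,14) and sp = less.prems(15,16) and out = less.prems(17,18) and Q = less.prems(19)
  let ?vb = "n + n + n + n + n + 2"
  have prod: "(i' - i) * (c' - c) < 2 ^ w"
  proof -
    have "(i' - i) * (c' - c) \<le> (n + 1) * (n + 1)" using rect by (intro mult_le_mono) auto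
    then show ?thesis using big by linarith
  qed
  have b: "sp < s" "sp + 1 < s" "sp + 2 < 2 ^ w" "1 < (2::nat) ^ w" "0 < (2::nat) ^ w" "2 < (2::nat) ^ w"
    "i' < 2 ^ w" "c' < 2 ^ w" "i + 1 < 2 ^ w" "st < 2 ^ w"
    using vb sp out rect by auto
  define r1 where "r1 = r(rBot := i', rRight := c')"
  have r1: "r1 rN = n" "r1 rStack = st" "r1 rTop = i" "r1 rLeft = c" "r1 rSp = sp + 2" "r1 rO = out"
    "r1 rBot = i'" "r1 rRight = c'" "\<And>x. x \<noteq> rBot \<Longrightarrow> x \<noteq> rRight \<Longrightarrow> r1 x = r x"
    using regs by (auto simp: r1_def)
  \<comment> \<open>The common exit of both base cases: the finished lower right corner becomes the
    next upper left one.\<close>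
  have pop: "wp w s pop (wp w s hirschberg Q) (r2, m2, t2)"
    if r2: "r2 rBot = i'" "r2 rRight = c'" "r2 rSp = sp + 2" "r2 rO = out + length Z"
      "\<And>x. x \<notin> {10..21} \<union> {40..47} \<Longrightarrow> r2 x = r x"
      and Z: "common_subseq (slice A i i') (slice B c c') Z" "length Z = lcs (slice A i i') (slice B c c')"
        "\<And>k. k < length Z \<Longrightarrow> m2 (out + k) = Z ! k"
      and m2: "\<And>a. a < ?vb \<or> ?vb + n < a \<and> a < sp + 2 \<or> ob \<le> a \<and> a < out \<Longrightarrow> m2 a = m a"
      and t2: "t2 + 10 \<le> t + 1600 * (i' - i) * (c' - c) + 200" for r2 m2 t2 Z
  proof -
    have "wp w s hirschberg Q (r2(rTop := i', rLeft := c', rSp := sp), m2, t3)" if "t3 \<le> t2 + 10" for t3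
      by (rule Q[OF Z(1,2,3) m2]) (use r2 that t2 in auto)
    then show ?thesis unfolding pop_def using r2 b by (simp add: numeral_2_eq_2)
  qed
  have body: "wp w s hirschberg_case (wp w s hirschberg Q) (r1, m, t1)"
    if t1: "t1 \<le> t + 40" for t1
  proof -
    consider "(i' - i) * (c' - c) = 0" | "(i' - i) * (c' - c) \<noteq> 0" "i' = i + 1"
      | "(i' - i) * (c' - c) \<noteq> 0" "i' \<noteq> i + 1" by blast
    then show ?thesis
    proof cases
      case 1
      then have e: "slice A i i' = [] \<or> slice B c c' = []" by auto
      then have "lcs (slice A i i') (slice B c c') = 0" by auto
      then have "wp w s pop (wp w s hirschberg Q) (r1, m, t2)" if "t2 \<le> t + 100" for t2
        by (intro pop[where Z = "[]"]) (use r1 that in \<open>auto simp: common_subseq_def\<close>)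
      then show ?thesis unfolding hirschberg_case_def using 1 r1 b t1 prod rect by (simp add: wps)
    next
      case 2
      let ?Z = "if A ! i \<in> set (slice B c c') then [A ! i] else []"
      have sA: "slice A i i' = [A ! i]" using 2 rect len by (simp add: slice_Suc)
      have ex: "(\<exists>k. c \<le> k \<and> k < c' \<and> m (n + k) = m i) \<longleftrightarrow> A ! i \<in> set (slice B c c')"
        unfolding set_slice[of c' B, unfolded len, OF rect(4)] using A[of i] B rect 2 by auto
      have "wp w s scan (wp w s pop (wp w s hirschberg Q)) (r1, m, t2)" if t2: "t2 \<le> t + 100" for t2
      proof (rule wp_scan)
        show "r1 rN + r1 rRight \<le> r1 rO" "r1 rO < s" "r1 rTop < r1 rO" "s < 2 ^ w" "r1 rLeft \<le> r1 rRight"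
          using r1 rect sp out vb by auto
      next
        fix r3 m3 t3
        assume m3: "m3 = (if \<exists>k. r1 rLeft \<le> k \<and> k < r1 rRight \<and> m (r1 rN + k) = m (r1 rTop)
            then m(r1 rO := m (r1 rTop)) else m)"
          and r3O: "r3 rO = (if \<exists>k. r1 rLeft \<le> k \<and> k < r1 rRight \<and> m (r1 rN + k) = m (r1 rTop)
            then r1 rO + 1 else r1 rO)"
          and r3: "\<And>x. x \<noteq> rJ \<Longrightarrow> x \<noteq> rO \<Longrightarrow> r3 x = r1 x" and t3: "t3 \<le> t2 + 10 + 30 * (r1 rRight - r1 rLeft)"
        show "wp w s pop (wp w s hirschberg Q) (r3, m3, t3)"
        proof (rule pop[where Z = ?Z])
          show "r3 rBot = i'" "r3 rRight = c'" "r3 rSp = sp + 2" using r3 r1 by auto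
          show "r3 rO = out + length ?Z" using r3O unfolding r1 ex by auto
          show "r3 x = r x" if "x \<notin> {10..21} \<union> {40..47}" for x using that r3 r1 by auto
          show "common_subseq (slice A i i') (slice B c c') ?Z" "length ?Z = lcs (slice A i i') (slice B c c')"
            unfolding sA by (rule lcs_singleton)+
          show "m3 (out + k) = ?Z ! k" if "k < length ?Z" for k
            using m3 that A[of i] rect 2 unfolding r1 ex by (auto split: if_splits)
          show "m3 a = m a" if "a < ?vb \<or> ?vb + n < a \<and> a < sp + 2 \<or> ob \<le> a \<and> a < out" for a
            using m3 that vb sp out unfolding r1 ex by auto
          show "t3 + 10 \<le> t + 1600 * (i' - i) * (c' - c) + 200"
            using t3 t2 2 by (simp add: r1)
        qed
      qed
      then show ?thesis unfolding hirschberg_case_def using 2 r1 b t1 rect prod by (simp add: wps)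
    next
      case 3
      then have pq: "2 \<le> i' - i" "1 \<le> c' - c" using rect by (auto simp: Suc_le_eq)
      \<comment> \<open>The crossing point will be pushed at \<open>sp + 2\<close> and
        \<open>sp + 3\<close>, which must stay below the output area.\<close>
      have room: "sp + 6 \<le> ob" using sp pq by linarith
      define mid where "mid = (i + i') div 2"
      have mid: "i \<le> mid" "mid \<le> i'" "mid - i < i' - i" "i' - mid < i' - i"
        "mid - i = (i' - i) div 2" "i' - mid = (i' - i) - (i' - i) div 2"
        using pq by (auto simp: mid_def)
      have "wp w s bisect (wp w s hirschberg Q) (r1, m, t2)" if t2: "t2 \<le> t + 100" for t2
      proof (rule wp_bisect[OF len A B, where i = i and i' = i' and c = c and c' = c' and vb = ?vb and sp = "sp + 2"])
        show "r1 rN = n" "r1 rTop = i" "r1 rLeft = c" "r1 rBot = i'" "r1 rRight = c'" "r1 rSp = sp + 2"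
          using r1 by auto
        show "?vb + n < sp + 2" "sp + 2 + 1 < s" using vb sp out pq by auto
      next
        fix r3 m3 t3 k
        assume k: "k \<le> c' - c" and lcs: "lcs (slice A i i') (slice B c c') =
            lcs (slice A i ((i + i') div 2)) (slice B c (c + k)) +
            lcs (slice A ((i + i') div 2) i') (slice B (c + k) c')"
          and m3: "m3 (sp + 2) = (i + i') div 2" "m3 (sp + 2 + 1) = c + k"
            "\<And>b. b < ?vb \<or> ?vb + n < b \<and> b \<noteq> sp + 2 \<and> b \<noteq> sp + 2 + 1 \<Longrightarrow> m3 b = m b"
          and r3: "r3 rSp = sp + 2 + 2" "\<And>x. x \<notin> {rA..rVal} \<union> {rSp, rMid} \<Longrightarrow> r3 x = r1 x"
          and t3: "t3 \<le> t2 + 200 + 80 * (c' - c + 1) + 80 * (i' - i) * (c' - c + 1)"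
        note lcs = lcs[folded mid_def] and m3 = m3[folded mid_def]
        have ck: "c \<le> c + k" "c + k \<le> c'" "c' - (c + k) = c' - c - k" using k rect by auto
        \<comment> \<open>First recursive use: the crossing point on top of the stack delimits the
          upper left rectangle.\<close>
        show "wp w s hirschberg Q (r3, m3, t3)"
        proof (rule less.hyps[where i = i and i' = mid and c = c and c' = "c + k" and r = r3 and m = m3 and
            t = t3 and sp = "sp + 2" and out = out])
          show "mid - i < i' - i" by fact
          show "i \<le> mid" "mid \<le> n" "c \<le> c + k" "c + k \<le> n" using mid(1,2) ck(1,2) rect by linarith+
          show "m3 k = A ! k" "m3 (n + k) = B ! k" if "k < n" for k
            using m3(3)[of k] m3(3)[of "n + k"] A B that by auto
          show "r3 rN = n" "r3 rStack = st" "r3 rTop = i" "r3 rLeft = c" "r3 rO = out"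
            using r3 r1 by auto
          show "m3 (sp + 2) = mid" "m3 (sp + 2 + 1) = c + k" "r3 rSp = sp + 2 + 2" by fact+
          show "st \<le> sp + 2" "sp + 2 + 2 + 2 * (mid - i) \<le> ob" "ob \<le> out" "out + (mid - i) < s"
            using sp out mid(1,2,3) pq by linarith+
        next
          fix r4 m4 t4 Z1
          assume Z1: "common_subseq (slice A i mid) (slice B c (c + k)) Z1" "length Z1 = lcs (slice A i mid) (slice B c (c + k))"
              "\<And>k. k < length Z1 \<Longrightarrow> m4 (out + k) = Z1 ! k"
            and m4: "\<And>a. a < ?vb \<or> ?vb + n < a \<and> a < sp + 2 + 2 \<or> ob \<le> a \<and> a < out \<Longrightarrow> m4 a = m3 a"
            and r4: "\<And>x. x \<notin> {10..21} \<union> {40..47} \<Longrightarrow> r4 x = r3 x" "r4 rTop = mid" "r4 rLeft = c + k"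
              "r4 rSp = sp + 2" "r4 rO = out + length Z1"
            and t4: "t4 \<le> t3 + 1600 * (mid - i) * (c + k - c) + 200"
          have Z1len: "length Z1 \<le> mid - i"
            using lcs_le1[of "slice A i mid"] Z1(2) length_slice[of mid A i] mid(2) rect len by simp
          \<comment> \<open>Second use: the original corner, untouched below, is on top again, and
            its rectangle starts at the crossing point left in the registers. Output continues
            behind \<open>Z1\<close>.\<close>
          show "wp w s hirschberg Q (r4, m4, t4)"
          proof (rule less.hyps[where i = mid and i' = i' and c = "c + k" and c' = c' and r = r4 and m = m4 and
              t = t4 and sp = sp and out = "out + length Z1"])
            show "i' - mid < i' - i" by fact
            show "mid \<le> i'" "i' \<le> n" "c + k \<le> c'" "c' \<le> n" using mid(1,2) ck(1,2) rect by linarith+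
            show "m4 k = A ! k" "m4 (n + k) = B ! k" if "k < n" for k
              using m4[of k] m4[of "n + k"] m3(3)[of k] m3(3)[of "n + k"] A B that by auto
            show "r4 rN = n" "r4 rStack = st" "r4 rTop = mid" "r4 rLeft = c + k" "r4 rSp = sp + 2"
              "r4 rO = out + length Z1"
              using r4 r3 r1 by auto
            show "m4 sp = i'" "m4 (sp + 1) = c'" using m4 m3(3) top vb sp by auto
            show "st \<le> sp" "sp + 2 + 2 * (i' - mid) \<le> ob" "ob \<le> out + length Z1" "out + length Z1 + (i' - mid) < s"
              using sp out mid(1,2,4) pq Z1len by linarith+
          next
            fix r5 m5 t5 Z2
            assume Z2: "common_subseq (slice A mid i') (slice B (c + k) c') Z2"
                "length Z2 = lcs (slice A mid i') (slice B (c + k) c')"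
                "\<And>k. k < length Z2 \<Longrightarrow> m5 (out + length Z1 + k) = Z2 ! k"
              and m5: "\<And>a. a < ?vb \<or> ?vb + n < a \<and> a < sp + 2 \<or> ob \<le> a \<and> a < out + length Z1 \<Longrightarrow> m5 a = m4 a"
              and r5: "\<And>x. x \<notin> {10..21} \<union> {40..47} \<Longrightarrow> r5 x = r4 x" "r5 rTop = i'" "r5 rLeft = c'"
                "r5 rSp = sp" "r5 rO = out + length Z1 + length Z2"
              and t5: "t5 \<le> t4 + 1600 * (i' - mid) * (c' - (c + k)) + 200"
            show "wp w s hirschberg Q (r5, m5, t5)"
            proof (rule Q[of "Z1 @ Z2"])
              show "common_subseq (slice A i i') (slice B c c') (Z1 @ Z2)"
                using Z1(1) Z2(1) slice_append[of i mid i' A] slice_append[of c "c + k" c' B] mid(1,2) ck(1,2)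
                by (auto simp: common_subseq_def list_emb_append_mono)
              show "length (Z1 @ Z2) = lcs (slice A i i') (slice B c c')" using lcs Z1(2) Z2(2) by simp
              show "m5 (out + k) = (Z1 @ Z2) ! k" if "k < length (Z1 @ Z2)" for k
              proof (cases "k < length Z1")
                case True
                then show ?thesis using m5[of "out + k"] Z1(3) out by (simp add: nth_append)
              next
                case False
                then show ?thesis using Z2(3)[of "k - length Z1"] that by (simp add: nth_append)
              qed
              show "m5 a = m a" if "a < ?vb \<or> ?vb + n < a \<and> a < sp + 2 \<or> ob \<le> a \<and> a < out" for a
                using that m5[of a] m4[of a] m3(3)[of a] sp(1) room vb(1) by auto
              show "r5 x = r x" if "x \<notin> {10..21} \<union> {40..47}" for x
                using that r5(1) r4(1) r3(2) r1(9) by auto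
              show "r5 rO = out + length (Z1 @ Z2)" using r5 by simp
              show "t5 \<le> t + 1600 * (i' - i) * (c' - c) + 200"
                using bisection_cost[OF pq k] t5[unfolded mid(6) ck(3)]
                  t4[unfolded mid(5) add_diff_cancel_left'] t3 t2 by linarith
            qed (use r5 in auto)
          qed
        qed
      qed (use rect vb big in auto)
      then show ?thesis unfolding hirschberg_case_def using 3 r1 b t1 rect prod by (simp add: wps)
    qed
  qed
  have "wp w s hirschberg_body (wp w s hirschberg Q) (r, m, t1)" if "t1 \<le> t + 20" for t1
    unfolding hirschberg_body_def using body that regs b top by (simp add: r1_def)
  then show ?case unfolding hirschberg_def
    using regs sp by (intro wp_LoopT) (auto simp: wps)
qed

section \<open>The program\<close>

definition holds :: "(nat \<Rightarrow> nat) \<Rightarrow> nat \<Rightarrow> nat list \<Rightarrow> bool" where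
  "holds m a X \<longleftrightarrow> (\<forall>k < length X. m (a + k) = X ! k)"

lemma holdsD: "holds m a X \<Longrightarrow> k < length X \<Longrightarrow> m (a + k) = X ! k"
  by (simp add: holds_def)

lemma holds_frame:
  "holds m a X \<Longrightarrow> (\<And>b. a \<le> b \<Longrightarrow> b < a + length X \<Longrightarrow> m' b = m b) \<Longrightarrow> holds m' a X"
  by (simp add: holds_def)

text \<open>Memory layout: the inputs at \<open>0\<close>, \<open>n\<close> and \<open>2 n\<close>, the numbers \<open>start B P j\<close> from \<open>3 n\<close>,
  the row of prefix lengths from \<open>4 n + 1\<close>, the row of the dynamic program from \<open>5 n + 2\<close>,
  the stack from \<open>6 n + 3\<close> and the output from \<open>8 n + 6\<close>.\<close>

abbreviation (input) "rRowF \<equiv> 50 :: nat"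
abbreviation (input) "rRowV \<equiv> 51 :: nat"

definition seed_body3 :: com where
  "seed_body3 = Assign rC (Reg rC \<oplus> Reg rN \<oplus> Num 1) ;; Assign rI (Reg rI \<oplus> Num 1)"

text \<open>Here \<open>rows\<close> runs with \<open>M = 1\<close>: the prefix row contains plain
  lengths without labels.\<close>

definition seed_body2 :: com where
  "seed_body2 =
     Assign rA (Reg rRowF) ;; Assign rEnd (Reg rRes \<ominus> Num 1) ;;
     Assign rV (Reg rN \<oplus> Reg rN \<oplus> Reg rN \<oplus> Reg rN \<oplus> Num 1) ;; Assign rM (Num 1) ;;
     rows ;;
     Assign rRowF (Reg rRes \<ominus> Num 1) ;;
     Assign rV (Reg rN \<oplus> Reg rN \<oplus> Reg rN \<oplus> Reg rN \<oplus> Reg rN \<oplus> Num 2) ;;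
     add_seeds"

definition seed_body1 :: com where
  "seed_body1 = Assign rRowV (Reg rI) ;; Assign rBase (Num 0) ;; match ;;
     Ifte (Less (Num 0) (Reg rRes)) seed_body2 Skip ;; seed_body3"

text \<open>The row advances before its own seeds are planted, because a row step accounts for seeds
  in earlier rows only.\<close>

definition seed_body :: com where
  "seed_body =
     Assign rA (Reg rRowV) ;; Assign rEnd (Reg rI) ;;
     Assign rV (Reg rN \<oplus> Reg rN \<oplus> Reg rN \<oplus> Reg rN \<oplus> Reg rN \<oplus> Num 2) ;; Assign rM (Reg rMM) ;;
     rows ;; seed_body1"

definition setup_tables3 :: com where
  "setup_tables3 = Assign rI (Num 0) ;; Assign rC (Num 0) ;; Assign rRowV (Num 0) ;; Assign rRowF (Num 0)"

definition setup_tables2 :: com where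
  "setup_tables2 = Assign rV (Reg rN \<oplus> Reg rN \<oplus> Reg rN \<oplus> Reg rN \<oplus> Reg rN \<oplus> Num 2) ;;
     Assign rVal (Num 0) ;; fill ;; setup_tables3"

definition setup_tables1 :: com where
  "setup_tables1 = Assign rMM ((Reg rN \<oplus> Num 1) \<otimes> (Reg rN \<oplus> Num 1)) ;;
     Assign rB (Reg rN) ;; Assign rQ (Reg rN) ;;
     Assign rV (Reg rN \<oplus> Reg rN \<oplus> Reg rN \<oplus> Reg rN \<oplus> Num 1) ;; Assign rVal (Num 1) ;; fill ;; setup_tables2"

definition setup_tables :: com where
  "setup_tables = ends ;; setup_tables1"

definition plant_seeds :: com where
  "plant_seeds = Loop (Less (Reg rI) (Reg rN \<oplus> Num 1)) seed_body"

abbreviation (input) "rEndA \<equiv> 52 :: nat"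
abbreviation (input) "rEndB \<equiv> 53 :: nat"

definition copy_pattern :: com where
  "copy_pattern = Assign rJ (Num 0) ;; Loop (Less (Reg rJ) (Reg rP))
     (Put (Reg rO) (Mem (Reg rN \<oplus> Reg rN \<oplus> Reg rJ)) ;;
      Assign rO (Reg rO \<oplus> Num 1) ;; Assign rJ (Reg rJ \<oplus> Num 1))"

definition out_base :: exp where
  "out_base = Reg rN \<oplus> Reg rN \<oplus> Reg rN \<oplus> Reg rN \<oplus> Reg rN \<oplus> Reg rN \<oplus> Reg rN \<oplus> Reg rN \<oplus> Num 6"

text \<open>Register 0 is both \<open>rN\<close>, on which \<open>out_base\<close> depends, and the
  success flag; therefore it is written last.\<close>

definition write_result3 :: com where
  "write_result3 = Assign rP (Reg rO \<ominus> out_base) ;; Assign 1 out_base ;; Assign rN (Num 1)"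

definition write_result2 :: com where
  "write_result2 =
     copy_pattern ;;
     Put (Reg rSp) (Reg rN) ;; Put (Reg rSp \<oplus> Num 1) (Reg rN) ;; Assign rSp (Reg rSp \<oplus> Num 2) ;;
     Assign rTop (Reg rEndA) ;; Assign rLeft (Reg rEndB) ;; hirschberg ;; write_result3"

definition write_result1 :: com where
  "write_result1 =
     Assign rStack (Reg rN \<oplus> Reg rN \<oplus> Reg rN \<oplus> Reg rN \<oplus> Reg rN \<oplus> Reg rN \<oplus> Num 3) ;;
     Assign rO out_base ;;
     Put (Reg rStack) (Reg rRes \<ominus> Num 1) ;;
     Put (Reg rStack \<oplus> Num 1) (Mem (Reg rN \<oplus> Reg rN \<oplus> Reg rN \<oplus> Reg rEndB) \<ominus> Num 1) ;;
     Assign rSp (Reg rStack \<oplus> Num 2) ;;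
     Assign rTop (Num 0) ;; Assign rLeft (Num 0) ;; hirschberg ;; write_result2"

definition write_result :: com where
  "write_result =
     Assign rX (Bin Mod (Reg rX) (Reg rMM)) ;;
     Assign rEndA (Bin Div (Reg rX) (Reg rN \<oplus> Num 1)) ;;
     Assign rEndB (Bin Mod (Reg rX) (Reg rN \<oplus> Num 1)) ;;
     Assign rI (Reg rEndA) ;; Assign rBase (Num 0) ;; match ;; write_result1"

definition finish :: com where
  "finish =
     Assign rX (Mem (Reg rN \<oplus> Reg rN \<oplus> Reg rN \<oplus> Reg rN \<oplus> Reg rN \<oplus> Num 2 \<oplus> Reg rN)) ;;
     Ifte (Eq (Reg rX) (Num 0)) (Assign rN (Num 0)) write_result"

definition str_ic_lcs :: com where
  "str_ic_lcs = setup_tables ;; plant_seeds ;; finish"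

text \<open>The output starts at \<open>8 n + 6\<close> and has at most \<open>3 n\<close>
  characters, which \<open>12 * n + 20\<close> covers. A seed is at most
  \<open>(2 * n + 2) * (n + 1)^2\<close>; up to \<open>n\<close> matches and one trial addition
  raise this to \<open>3 * (n + 1) ^ 3\<close>, below the bound on word values.\<close>

locale str_ic_input =
  fixes A B P :: "nat list" and n w s :: nat
  assumes len: "length A = n" "length B = n" "length P \<le> n"
    and s: "s = 12 * n + 20" "s < 2 ^ w" and big: "4 * (n + 1) ^ 3 < 2 ^ w"
begin

abbreviation "vb \<equiv> n + n + n + n + n + 2"
abbreviation "fb \<equiv> n + n + n + n + 1"

definition input :: "(nat \<Rightarrow> nat) \<Rightarrow> bool" where
  "input m \<longleftrightarrow> holds m 0 A \<and> holds m n B \<and> holds m (n + n) P"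

definition tables :: "(nat \<Rightarrow> nat) \<Rightarrow> bool" where
  "tables m \<longleftrightarrow> input m \<and> (\<forall>j\<le>n. m (n + n + n + j) = start B P j)"

text \<open>The invariant of the main loop: the seeds of all rows below \<open>u\<close> have been planted, the row of
  the dynamic program in memory is row \<open>l\<close>, and the row of prefix lengths is row \<open>a\<close>.  Since
  the start of the last embedding of \<open>P\<close> that ends at \<open>i\<close> grows with \<open>i\<close>, row \<open>a\<close> only ever advances,
  so that one row of prefix lengths suffices.\<close>

definition inv :: "nat \<Rightarrow> nat \<Rightarrow> nat \<Rightarrow> nat \<Rightarrow> (nat \<Rightarrow> nat) \<Rightarrow> (nat \<Rightarrow> nat) \<Rightarrow> bool" where
  "inv i l u a r m \<longleftrightarrow> r rN = n \<and> r rP = length P \<and> r rMM = (n + 1)^2 \<and> r rB = n \<and> r rQ = n \<and>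
     r rI = i \<and> r rC = i * (n + 1) \<and> r rRowV = l \<and> r rRowF = a \<and> a \<le> n \<and>
     (a = 0 \<or> (\<exists>h<u. start A P h = Suc a)) \<and> tables m \<and>
     (\<forall>j\<le>n. m (fb + j) = 1 + lcs (take a A) (take j B)) \<and>
     (\<forall>j\<le>n. best ((n + 1)^2) A B (seeds A B P u) l j (m (vb + j)))"

lemma big_cases: "k \<le> 4 * (n + 1)^3 \<Longrightarrow> k < 2 ^ w"
  using big by simp

lemma bounds: "1 < (2::nat) ^ w" "0 < (2::nat) ^ w" "2 < (2::nat) ^ w" "n + n < 2 ^ w" "n + n + n < 2 ^ w"
  "n + n + n + n < 2 ^ w" "n + n + n + n + n < 2 ^ w" "fb < 2 ^ w" "vb < 2 ^ w" "n + 1 < 2 ^ w"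
  "(n + 1) * (n + 1) < 2 ^ w" "3 * ((n + 1) * (n + 1)) < 2 ^ w" "n * (n + 1) + n + n + 2 < 2 ^ w"
proof -
  have "(n + 1) ^ 3 = (n + 1) * ((n + 1) * (n + 1))" by (simp add: power3_eq_cube)
  then have *: "(n + 1) * (n + 1) \<le> (n + 1) ^ 3" by simp
  then show "(n + 1) * (n + 1) < 2 ^ w" "3 * ((n + 1) * (n + 1)) < 2 ^ w" using big by linarith+
  have "n * (n + 1) + n + n + 2 \<le> 2 * ((n + 1) * (n + 1))" by (simp add: algebra_simps)
  then show "n * (n + 1) + n + n + 2 < 2 ^ w" using * big by linarith
qed (use s in simp_all)

lemma seeds_row: "(a, b, x) \<in> seeds A B P (Suc i) \<longleftrightarrow>
    (a, b, x) \<in> seeds A B P i \<or> a = i \<and> b \<le> n \<and> x = seed A B P i b \<and> 0 < x"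
  using len by (auto simp: seeds_def less_Suc_eq)

section \<open>One round of the main loop\<close>

lemma wp_seed_body3:
  assumes "inv i i (Suc i) a r m" "i \<le> n"
    and "\<And>r' t'. inv (Suc i) i (Suc i) a r' m \<Longrightarrow> t' \<le> t + 20 \<Longrightarrow> Q (r', m, t')"
  shows "wp w s seed_body3 Q (r, m, t)"
proof -
  have "i * (n + 1) \<le> n * (n + 1)" using assms(2) by (rule mult_le_mono1)
  then have "i * (n + 1) + n + 1 < 2 ^ w" "i * (n + 1) + n < 2 ^ w" "i + 1 < 2 ^ w"
    using bounds(10,13) assms(2) by linarith+
  moreover have "inv (Suc i) i (Suc i) a (r(rC := i * (n + 1) + n + 1, rI := i + 1)) m"
    using assms(1) unfolding inv_def by auto
  ultimately show ?thesis unfolding seed_body3_def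
    using assms(1,3) bounds by (simp add: inv_def del: One_nat_def mult_Suc_right add_Suc_right)
qed

lemma wp_seed_body2:
  assumes inv: "inv i i i a r m" and i: "i \<le> n" and res: "r rRes = start A P i" "0 < start A P i"
    and Q: "\<And>r' m' t'. inv i i (Suc i) (start A P i - 1) r' m' \<Longrightarrow> a < start A P i \<Longrightarrow>
        t' \<le> t + 80 * (start A P i - 1 - a) * (n + 1) + 200 * (n + 1) \<Longrightarrow> Q (r', m', t')"
  shows "wp w s seed_body2 Q (r, m, t)"
proof -
  obtain e where e: "start A P i = Suc e" using res(2) gr0_implies_Suc by blast
  have ei: "e \<le> i" using start_Suc[OF e] i len by simp
  have I: "r rN = n" "r rP = length P" "r rMM = (n + 1)^2" "r rB = n" "r rQ = n" "r rI = i"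
     "r rC = i * (n + 1)" "r rRowV = i" "r rRowF = a" "a \<le> n"
     "a = 0 \<or> (\<exists>h<i. start A P h = Suc a)" "tables m"
    and F: "\<And>j. j \<le> n \<Longrightarrow> m (fb + j) = 1 + lcs (take a A) (take j B)"
    and V: "\<And>j. j \<le> n \<Longrightarrow> best ((n + 1)^2) A B (seeds A B P i) i j (m (vb + j))"
    using inv unfolding inv_def by auto
  have A: "m k = A ! k" "m (n + k) = B ! k" if "k < n" for k
    using I(12) that len unfolding tables_def input_def holds_def by auto
  \<comment> \<open>The prefix row never has to be rewound, by monotonicity of the latest
    start.\<close>
  have ae: "a \<le> e"
  proof (cases "a = 0")
    case False
    then obtain h where "h < i" "start A P h = Suc a" using I(11) by auto
    then have "Suc a \<le> start A P i" using start_mono[of A P h a i] i len by simp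
    then show ?thesis using e by simp
  qed simp
  have steps: "row_steps (\<lambda>k. m (a + k)) (\<lambda>k. m (n + k)) 1 (\<lambda>j. m (fb + j)) k j =
      1 + lcs (take (a + k) A) (take j B)" if "k \<le> e - a" "j \<le> n" for k j
  proof -
    have u: "row_steps (\<lambda>k. A ! k) ((!) B) 1 (\<lambda>_. 1) l j = 1 + lcs (take l A) (take j B)"
      if "l \<le> n" "j \<le> n" for l j
      using row_steps_uniform[of 1 l A j B] that len by simp
    \<comment> \<open>The stored row is itself the result of \<open>a\<close> steps from the
      all-ones row, so the continuation joins on by \<open>row_steps_add\<close>.\<close>
    have "row_steps (\<lambda>k. m (a + k)) (\<lambda>k. m (n + k)) 1 (\<lambda>j. m (fb + j)) k j =
      row_steps (\<lambda>k. A ! (a + k)) ((!) B) 1 (row_steps (\<lambda>k. A ! k) ((!) B) 1 (\<lambda>_. 1) a) k j"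
    proof (rule row_steps_cong[where q = n])
      show "m (a + l) = A ! (a + l)" if "l < k" for l
        using A that \<open>k \<le> e - a\<close> ei i by simp
      show "m (fb + l) = row_steps (\<lambda>k. A ! k) ((!) B) 1 (\<lambda>_. 1) a l" if "l \<le> n" for l
        using F[OF that] u[of a l] that I(10) by simp
    qed (use A that in auto)
    also have "\<dots> = 1 + lcs (take (a + k) A) (take j B)"
      using u[of "a + k" j] that ei i ae by (simp add: row_steps_add)
    finally show ?thesis .
  qed
  define r1 where "r1 = r(rA := a, rEnd := e, rV := fb, rM := 1)"
  have "wp w s rows (wp w s (Assign rRowF (Reg rRes \<ominus> Num 1) ;;
     Assign rV (Reg rN \<oplus> Reg rN \<oplus> Reg rN \<oplus> Reg rN \<oplus> Reg rN \<oplus> Num 2) ;; add_seeds) Q) (r1, m, t1)"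
    if t1: "t1 \<le> t + 30" for t1
  proof (rule wp_rows[where a = a and a' = e and bb = n and q = n and vb = fb and M = 1])
    show "r1 rA = a" "r1 rEnd = e" "r1 rB = n" "r1 rQ = n" "r1 rV = fb" "r1 rM = 1"
      using I by (auto simp: r1_def)
    show "a \<le> e" "e \<le> fb" "n + n \<le> fb" "fb + n < s" "s < 2 ^ w" using ae ei i s by auto
    show "row_steps (\<lambda>k. m (a + k)) (\<lambda>k. m (n + k)) 1 (\<lambda>j. m (fb + j)) k j + 1 < 2 ^ w"
      if "k \<le> e - a" "j \<le> n" for k j
      using steps[OF that] lcs_le2[of "take (a + k) A" "take j B"] that s len by simp
  next
    fix r2 m2 t2
    assume m2: "\<And>j. j \<le> n \<Longrightarrow> m2 (fb + j) = row_steps (\<lambda>k. m (a + k)) (\<lambda>k. m (n + k)) 1 (\<lambda>j. m (fb + j)) (e - a) j"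
      and f2: "\<And>b. b < fb \<or> fb + n < b \<Longrightarrow> m2 b = m b"
      and r2: "\<And>x. x \<notin> {rA, rJ, rD, rL, rU, rX} \<Longrightarrow> r2 x = r1 x"
      and t2: "t2 \<le> t1 + 10 + 80 * (e - a) * (n + 1)"
    have F2: "m2 (fb + j) = 1 + lcs (take e A) (take j B)" if "j \<le> n" for j
      using m2[OF that] steps[of "e - a" j] that ae by simp
    have T2: "tables m2"
      using I(12) len f2 unfolding tables_def input_def by (auto intro!: holds_frame[of m])
    have V2: "m2 (vb + j) = m (vb + j)" for j using f2 by simp
    let ?r3 = "r2(rRowF := e, rV := vb)"
    have "wp w s add_seeds Q (?r3, m2, t3)" if t3: "t3 \<le> t2 + 30" for t3
    proof (rule wp_add_seeds[where n = n and vb = vb and \<sigma> = "seed A B P i"])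
      show "?r3 rN = n" "?r3 rV = vb" "0 < ?r3 rMM" using r2 I by (auto simp: r1_def)
      show "n + n + n + n + n + 1 < vb" "vb + n < s" "s < 2 ^ w" using s by auto
    next
      fix j assume j: "j \<le> n"
      have sb: "m2 (n + n + n + j) = start B P j" using T2 j by (simp add: tables_def)
      have le: "start B P j \<le> n + 1"
      proof (cases "start B P j")
        case (Suc b)
        then show ?thesis using start_Suc[OF Suc] j len by simp
      qed simp
      then show "m2 (n + n + n + j) \<le> n + 1" by (simp add: sb)
      show "seed A B P i j < 2 ^ w"
      proof (rule big_cases)
        have "seed A B P i j \<le> (2 * n + 2) * (n + 1)^2" using seed_le[of B A P i j] len i j by simp
        also have "\<dots> \<le> 4 * (n + 1)^3" by (simp add: power3_eq_cube power2_eq_square algebra_simps)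
        finally show "seed A B P i j \<le> 4 * (n + 1)^3" .
      qed
      show "seed A B P i j = (if 0 < m2 (n + n + n + j)
        then (m2 (n + n + n + n + m2 (n + n + n + j)) + ?r3 rP) * ?r3 rMM + ?r3 rC + j else 0)"
      proof (cases "start B P j")
        case 0
        then show ?thesis using sb by (simp add: seed_def)
      next
        case (Suc b)
        then have "m2 (n + n + n + n + start B P j) = 1 + lcs (take e A) (take b B)"
          using F2[of b] le by simp
        then show ?thesis using sb Suc e r2 I len by (simp add: seed_def r1_def)
      qed
    next
      fix r4 m4 t4
      assume m4: "\<And>j. j \<le> n \<Longrightarrow> m4 (vb + j) = seed_row (seed A B P i) (\<lambda>j. m2 (vb + j)) j"
        and f4: "\<And>b. b < vb \<or> vb + n < b \<Longrightarrow> m4 b = m2 b"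
        and r4: "\<And>x. x \<notin> {rJ, rL, rU, rX} \<Longrightarrow> r4 x = ?r3 x"
        and t4: "t4 \<le> t3 + 100 * (n + 1)"
      have V4: "best ((n + 1)^2) A B (seeds A B P (Suc i)) i j (m4 (vb + j))" if "j \<le> n" for j
        unfolding m4[OF that] by (rule best_seed_row[OF _ seeds_row that]) (use V V2 that in auto)
      have T4: "tables m4"
        using T2 len f4 unfolding tables_def input_def by (auto intro!: holds_frame[of m2])
      have "inv i i (Suc i) e r4 m4"
        unfolding inv_def using r4 r2 I F2 f4 V4 T4 ei i e by (auto simp: r1_def)
      moreover have "a < Suc e" using ae by simp
      moreover have "t4 \<le> t + 80 * (e - a) * (n + 1) + 200 * (n + 1)" using t4 t3 t2 t1 by simp
      ultimately show "Q (r4, m4, t4)" using Q e by simp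
    qed
    moreover have "r2 rRes = Suc e" "r2 rN = n" using r2 res e I by (auto simp: r1_def)
    ultimately show "wp w s (Assign rRowF (Reg rRes \<ominus> Num 1) ;;
     Assign rV (Reg rN \<oplus> Reg rN \<oplus> Reg rN \<oplus> Reg rN \<oplus> Reg rN \<oplus> Num 2) ;; add_seeds) Q (r2, m2, t2)"
      using bounds ei i s by simp
  qed
  then show ?thesis unfolding seed_body2_def
    using I res e bounds ei i s by (simp add: r1_def)
qed

lemma wp_seed_body1:
  assumes inv: "inv i i i a (r(rRowV := i)) m" and i: "i \<le> n" and ri: "r rI = i"
    and Q: "\<And>a' r' m' t'. inv (Suc i) i (Suc i) a' r' m' \<Longrightarrow> a \<le> a' \<Longrightarrow>
        t' \<le> t + 80 * (a' - a) * (n + 1) + 300 * (n + 1) \<Longrightarrow> Q (r', m', t')"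
  shows "wp w s seed_body1 Q (r, m, t)"
proof -
  let ?r1 = "r(rRowV := i, rBase := 0)"
  have I: "r rN = n" "r rP = length P" "r rI = i" "tables m" "a \<le> n" using inv unfolding inv_def by auto
  have inv1: "inv i i i a ?r1 m" using inv unfolding inv_def by auto
  have "wp w s match (wp w s (Ifte (Less (Num 0) (Reg rRes)) seed_body2 Skip ;; seed_body3) Q) (?r1, m, t1)"
    if t1: "t1 \<le> t + 10" for t1
  proof (rule wp_match)
    have "length P * i \<le> (n + 1) * (n + 1)" using len i by (intro mult_le_mono) auto
    then show "?r1 rP * ?r1 rI < 2 ^ w" using I bounds(11) by simp
    show "?r1 rN + ?r1 rN + ?r1 rP < s" "?r1 rBase + ?r1 rI < s" "s < 2 ^ w" using I len i s by auto
  next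
    fix r2 t2
    assume res: "r2 rRes = match_back (\<lambda>i. m (?r1 rBase + i)) (\<lambda>i. m (?r1 rN + ?r1 rN + i)) (?r1 rP) (?r1 rI)"
      and r2: "\<And>x. x \<notin> {rRes, rK, rS} \<Longrightarrow> r2 x = ?r1 x" and t2: "t2 \<le> t1 + 40 * (?r1 rI + 1)"
    have res': "r2 rRes = start A P i"
      unfolding res start_def using I(4) i len I
      by (simp, intro match_back_cong) (auto simp: tables_def input_def holds_def)
    have inv2: "inv i i i a r2 m" using inv1 r2 unfolding inv_def by auto
    show "wp w s (Ifte (Less (Num 0) (Reg rRes)) seed_body2 Skip ;; seed_body3) Q (r2, m, t2)"
    proof (cases "start A P i = 0")
      case True
      \<comment> \<open>No embedding of \<open>P\<close> into \<open>A\<close> ends by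
        \<open>i\<close>, so this row offers no source at all.\<close>
      have "seeds A B P (Suc i) = seeds A B P i"
        using seeds_row seed_pos[of A B P i] True by auto
      then have "inv i i (Suc i) a r2 m" using inv2 unfolding inv_def by (auto intro: less_SucI)
      note inv3 = this
      have "wp w s seed_body3 Q (r2, m, t3)" if t3: "t3 \<le> t2 + 10" for t3
      proof (rule wp_seed_body3[OF inv3 i])
        fix r' t' assume q: "inv (Suc i) i (Suc i) a r' m" "t' \<le> t3 + 20"
        show "Q (r', m, t')" by (rule Q[OF q(1)]) (use q(2) t1 t2 t3 I i in auto)
      qed
      then show ?thesis using True res' bounds by (simp add: wps)
    next
      case False
      have "wp w s seed_body2 (wp w s seed_body3 Q) (r2, m, t3)" if t3: "t3 \<le> t2 + 10" for t3
      proof (rule wp_seed_body2[OF inv2 i res'])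
        show "0 < start A P i" using False by simp
        fix r4 m4 t4 assume inv4: "inv i i (Suc i) (start A P i - 1) r4 m4" and a: "a < start A P i"
          and t4: "t4 \<le> t3 + 80 * (start A P i - 1 - a) * (n + 1) + 200 * (n + 1)"
        show "wp w s seed_body3 Q (r4, m4, t4)"
        proof (rule wp_seed_body3[OF inv4 i])
          fix r' t' assume inv5: "inv (Suc i) i (Suc i) (start A P i - 1) r' m4" and t': "t' \<le> t4 + 20"
          have "t' \<le> t + 80 * (start A P i - 1 - a) * (n + 1) + 300 * (n + 1)"
            using t1 t2 t3 t4 t' I i by simp
          then show "Q (r', m4, t')" using a by (intro Q[OF inv5]) auto
        qed
      qed
      then show ?thesis using False res' bounds by (simp add: wps)
    qed
  qed
  then show ?thesis unfolding seed_body1_def using I bounds by simp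
qed

text \<open>The subtraction \<open>i - 1\<close> is truncated: in the first round the row in memory
  is row 0 already, and no row step takes place. The cost of moving the prefix row is charged
  separately, by the distance \<open>a' - a\<close>.\<close>

lemma wp_seed_body:
  assumes inv: "inv i (i - 1) i a r m" and i: "i \<le> n"
    and Q: "\<And>a' r' m' t'. inv (Suc i) i (Suc i) a' r' m' \<Longrightarrow> a \<le> a' \<Longrightarrow>
        t' \<le> t + 80 * (a' - a) * (n + 1) + 500 * (n + 1) \<Longrightarrow> Q (r', m', t')"
  shows "wp w s seed_body Q (r, m, t)"
proof -
  define M where "M = (n + 1)^2"
  define r1 where "r1 = r(rA := i - 1, rEnd := i, rV := vb, rM := M)"
  have I: "r rN = n" "r rP = length P" "r rMM = M" "r rB = n" "r rQ = n" "r rI = i"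
     "r rRowV = i - 1" "a \<le> n" "tables m"
    and V: "\<And>j. j \<le> n \<Longrightarrow> best M A B (seeds A B P i) (i - 1) j (m (vb + j))"
    using inv unfolding inv_def M_def by auto
  have A: "m k = A ! k" "m (n + k) = B ! k" if "k < n" for k
    using I(9) that len unfolding tables_def input_def holds_def by auto
  have steps: "best M A B (seeds A B P i) (i - 1 + k) j
      (row_steps (\<lambda>k. m (i - 1 + k)) (\<lambda>k. m (n + k)) M (\<lambda>j. m (vb + j)) k j)" if k: "k \<le> i - (i - 1)" and j: "j \<le> n" for k j
  proof -
    have "row_steps (\<lambda>k. m (i - 1 + k)) (\<lambda>k. m (n + k)) M (\<lambda>j. m (vb + j)) k j =
      row_steps (\<lambda>k. A ! (i - 1 + k)) ((!) B) M (\<lambda>j. m (vb + j)) k j"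
      by (rule row_steps_cong[where q = n]) (use A k j i in auto)
    also have "best M A B (seeds A B P i) (i - 1 + k) j \<dots>"
      by (rule best_row_steps) (use V k j i len in \<open>auto simp: seeds_def\<close>)
    finally show ?thesis .
  qed
  have "wp w s rows (wp w s seed_body1 Q) (r1, m, t1)" if t1: "t1 \<le> t + 30" for t1
  proof (rule wp_rows[where a = "i - 1" and a' = i and bb = n and q = n and vb = vb and M = M])
    show "r1 rA = i - 1" "r1 rEnd = i" "r1 rB = n" "r1 rQ = n" "r1 rV = vb" "r1 rM = M"
      using I by (auto simp: r1_def)
    show "i - 1 \<le> i" "i \<le> vb" "n + n \<le> vb" "vb + n < s" "s < 2 ^ w" using i s by auto
    show "row_steps (\<lambda>k. m (i - 1 + k)) (\<lambda>k. m (n + k)) M (\<lambda>j. m (vb + j)) k j + M < 2 ^ w"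
      if "k \<le> i - (i - 1)" "j \<le> n" for k j
    proof (rule big_cases)
      have "x \<le> (2 * n + 2) * M" if "(a, b, x) \<in> seeds A B P i" for a b x
        using that seed_le[of B A P a b] len i by (auto simp: seeds_def M_def)
      then have "row_steps (\<lambda>k. m (i - 1 + k)) (\<lambda>k. m (n + k)) M (\<lambda>j. m (vb + j)) k j \<le> (2 * n + 2) * M + M * length B"
        by (intro best_bound[OF steps[OF that]]) (use that len in auto)
      then have "row_steps (\<lambda>k. m (i - 1 + k)) (\<lambda>k. m (n + k)) M (\<lambda>j. m (vb + j)) k j + M \<le> (2 * n + 2) * M + M * n + M"
        unfolding len by simp
      also have "\<dots> \<le> 4 * (n + 1)^3" by (simp add: M_def power3_eq_cube power2_eq_square algebra_simps)
      finally show "row_steps (\<lambda>k. m (i - 1 + k)) (\<lambda>k. m (n + k)) M (\<lambda>j. m (vb + j)) k j + M \<le> 4 * (n + 1)^3" .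
    qed
  next
    fix r2 m2 t2
    assume m2: "\<And>j. j \<le> n \<Longrightarrow> m2 (vb + j) =
        row_steps (\<lambda>k. m (i - 1 + k)) (\<lambda>k. m (n + k)) M (\<lambda>j. m (vb + j)) (i - (i - 1)) j"
      and f2: "\<And>b. b < vb \<or> vb + n < b \<Longrightarrow> m2 b = m b"
      and r2: "\<And>x. x \<notin> {rA, rJ, rD, rL, rU, rX} \<Longrightarrow> r2 x = r1 x"
      and t2: "t2 \<le> t1 + 10 + 80 * (i - (i - 1)) * (n + 1)"
    have V2: "best M A B (seeds A B P i) i j (m2 (vb + j))" if "j \<le> n" for j
      using steps[of "i - (i - 1)" j] m2[OF that] that by simp
    have T2: "tables m2"
      using I(9) len f2 unfolding tables_def input_def by (auto intro!: holds_frame[of m])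
    show "wp w s seed_body1 Q (r2, m2, t2)"
    proof (rule wp_seed_body1[where i = i and a = a])
      have "m2 (fb + j) = m (fb + j)" if "j \<le> n" for j using f2 that by simp
      then show "inv i i i a (r2(rRowV := i)) m2"
        using inv V2 T2 r2 unfolding inv_def by (auto simp: r1_def M_def)
      show "r2 rI = i" using r2 I by (simp add: r1_def)
      fix a' r' m' t' assume "inv (Suc i) i (Suc i) a' r' m'" "a \<le> a'"
        "t' \<le> t2 + 80 * (a' - a) * (n + 1) + 300 * (n + 1)"
      moreover have "80 * (i - (i - 1)) * (n + 1) \<le> 80 * (n + 1)" by (cases i) auto
      ultimately show "Q (r', m', t')" using t2 t1 by (intro Q) auto
    qed (use i in auto)
  qed
  then show ?thesis unfolding seed_body_def
    using I bounds by (simp add: r1_def)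
qed


section \<open>Initial tables and the main loop as a whole\<close>

lemma wp_setup_tables:
  assumes input: "input m" and regs: "r rN = n" "r rP = length P"
    and Q: "\<And>r' m' t'. inv 0 0 0 0 r' m' \<Longrightarrow> t' \<le> t + 400 * (n + 1)^2 \<Longrightarrow> Q (r', m', t')"
  shows "wp w s setup_tables Q (r, m, t)"
  unfolding setup_tables_def wp_Seq
proof (rule wp_ends[where n = n])
  show "r rN = n" "r rP \<le> n" "n + n + n + n < s" "s < 2 ^ w" "(n + 1) * (n + 1) < 2 ^ w"
    using regs len s bounds(11) by auto
next
  fix r1 m1 t1
  assume m1: "\<And>j. j \<le> n \<Longrightarrow> m1 (n + n + n + j) = match_back (\<lambda>i. m (n + i)) (\<lambda>i. m (n + n + i)) (r rP) j"
    and f1: "\<And>b. b < n + n + n \<or> n + n + n + n < b \<Longrightarrow> m1 b = m b"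
    and r1: "\<And>x. x \<notin> {rBase, rI, rRes, rK, rS} \<Longrightarrow> r1 x = r x" and t1: "t1 \<le> t + 120 * ((n + 1) * (n + 1))"
  have "m1 (n + n + n + j) = start B P j" if "j \<le> n" for j
    unfolding m1[OF that] start_def regs(2)
    using input len that by (intro match_back_cong) (auto simp: input_def holds_def)
  moreover have "input m1" using input f1 len unfolding input_def by (auto intro!: holds_frame[of m])
  ultimately have T1: "tables m1" by (simp add: tables_def)
  let ?M = "(n + 1) * (n + 1)"
  let ?r2 = "r1(rMM := ?M, rB := n, rQ := n, rV := fb, rVal := 1)"
  have "wp w s fill (wp w s setup_tables2 Q) (?r2, m1, t2)"
    if t2: "t2 \<le> t1 + 40" for t2
  proof (rule wp_fill[where q = n and vb = fb])
    fix r3 m3 t3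
    assume m3: "\<And>j. j \<le> n \<Longrightarrow> m3 (fb + j) = ?r2 rVal"
      and f3: "\<And>b. b < fb \<or> fb + n < b \<Longrightarrow> m3 b = m1 b"
      and r3: "\<And>x. x \<noteq> rJ \<Longrightarrow> r3 x = ?r2 x" and t3: "t3 \<le> t2 + 40 * (n + 1)"
    let ?r4 = "r3(rV := vb, rVal := 0)"
    have "wp w s fill (wp w s setup_tables3 Q) (?r4, m3, t4)" if t4: "t4 \<le> t3 + 40" for t4
    proof (rule wp_fill[where q = n and vb = vb])
      fix r5 m5 t5
      assume m5: "\<And>j. j \<le> n \<Longrightarrow> m5 (vb + j) = ?r4 rVal"
        and f5: "\<And>b. b < vb \<or> vb + n < b \<Longrightarrow> m5 b = m3 b"
        and r5: "\<And>x. x \<noteq> rJ \<Longrightarrow> r5 x = ?r4 x" and t5: "t5 \<le> t4 + 40 * (n + 1)"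
      have T5: "tables m5"
        using T1 len f3 f5 unfolding tables_def input_def by (auto intro!: holds_frame[of m1])
      have F5: "m5 (fb + j) = 1" if "j \<le> n" for j using f5[of "fb + j"] m3[OF that] that by simp
      have V5: "m5 (vb + j) = 0" if "j \<le> n" for j using m5[OF that] by simp
      have B: "best M A B (seeds A B P 0) i j 0" for M i j by (simp add: best_def seeds_def)
      have "inv 0 0 0 0 (r5(rI := 0, rC := 0, rRowV := 0, rRowF := 0)) m5"
        unfolding inv_def using r5 r3 r1 regs T5 F5 V5 B by (auto simp: power2_eq_square)
      moreover have "t5 + 8 \<le> t + 400 * (n + 1)^2"
        using t1 t2 t3 t4 t5 by (simp add: power2_eq_square algebra_simps)
      ultimately show "wp w s setup_tables3 Q (r5, m5, t5)"
        unfolding setup_tables3_def using bounds by (auto intro!: Q)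
    qed (use r3 s in auto)
    then show "wp w s setup_tables2 Q (r3, m3, t3)"
      unfolding setup_tables2_def using r3 r1 regs bounds by simp
  qed (use s in auto)
  then show "wp w s setup_tables1 Q (r1, m1, t1)"
    unfolding setup_tables1_def
    using r1 regs bounds by (simp del: One_nat_def mult_Suc_right mult_Suc)
qed

text \<open>The charges for moving the prefix row telescope: \<open>80 * a * (n + 1)\<close> in the
  invariant pays for them, and \<open>a\<close> never exceeds \<open>n\<close>. A single round may
  be long, but the total stays quadratic.\<close>

lemma wp_plant_seeds:
  assumes inv: "inv 0 0 0 0 r m"
    and Q: "\<And>a r' m' t'. inv (n + 1) n (n + 1) a r' m' \<Longrightarrow> t' \<le> t + 700 * (n + 1)^2 \<Longrightarrow> Q (r', m', t')"
  shows "wp w s plant_seeds Q (r, m, t)"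
  unfolding plant_seeds_def
proof (rule wp_for[where i = 0 and q = "n + 1" and
      I = "\<lambda>i r' m' t'. \<exists>a. inv i (i - 1) i a r' m' \<and> t' \<le> t + 550 * (i * (n + 1)) + 80 * a * (n + 1)"])
  show "\<exists>a. inv 0 (0 - 1) 0 a r m \<and> t \<le> t + 550 * (0 * (n + 1)) + 80 * a * (n + 1)"
    using inv by auto
next
  let ?b = "Less (Reg rI) (Reg rN \<oplus> Num 1)"
  fix i r' m' t' assume i: "i < n + 1"
    and "\<exists>a. inv i (i - 1) i a r' m' \<and> t' \<le> t + 550 * (i * (n + 1)) + 80 * a * (n + 1)"
  then obtain a where I: "inv i (i - 1) i a r' m'" and t': "t' \<le> t + 550 * (i * (n + 1)) + 80 * a * (n + 1)" by blast
  have "wp w s seed_body (\<lambda>(r', m', t'). \<exists>a. inv (Suc i) (Suc i - 1) (Suc i) a r' m' \<and>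
      t' \<le> t + 550 * (Suc i * (n + 1)) + 80 * a * (n + 1)) (r', m', t' + csz ?b + 2)"
  proof (rule wp_seed_body[OF I])
    show "i \<le> n" using i by simp
    fix a2 r2 m2 t2 assume I2: "inv (Suc i) i (Suc i) a2 r2 m2" and a: "a \<le> a2"
      and t2: "t2 \<le> t' + csz ?b + 2 + 80 * (a2 - a) * (n + 1) + 500 * (n + 1)"
    obtain d where d: "a2 = a + d" using a le_Suc_ex by blast
    have "t2 \<le> t + 550 * (Suc i * (n + 1)) + 80 * a2 * (n + 1)"
      using t2 t' unfolding d by (simp add: wps algebra_simps)
    then show "case (r2, m2, t2) of (r', m', t') \<Rightarrow> \<exists>a. inv (Suc i) (Suc i - 1) (Suc i) a r' m' \<and>
      t' \<le> t + 550 * (Suc i * (n + 1)) + 80 * a * (n + 1)"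
      using I2 by auto
  qed
  then show "cok w s ?b r' m' \<and> cev ?b r' m' \<and> wp w s seed_body (\<lambda>(r', m', t'). \<exists>a. inv (Suc i) (Suc i - 1) (Suc i) a r' m' \<and>
      t' \<le> t + 550 * (Suc i * (n + 1)) + 80 * a * (n + 1)) (r', m', t' + csz ?b + 2)"
    using I i bounds by (simp add: inv_def wps)
next
  let ?b = "Less (Reg rI) (Reg rN \<oplus> Num 1)"
  fix r' m' t' assume "\<exists>a. inv (n + 1) (n + 1 - 1) (n + 1) a r' m' \<and> t' \<le> t + 550 * ((n + 1) * (n + 1)) + 80 * a * (n + 1)"
  then obtain a where I: "inv (n + 1) n (n + 1) a r' m'" and t': "t' \<le> t + 550 * ((n + 1) * (n + 1)) + 80 * a * (n + 1)"
    by auto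
  have "a \<le> n" using I by (simp add: inv_def)
  then have "a * (n + 1) \<le> n * (n + 1)" by (rule mult_le_mono1)
  then have "t' + csz ?b + 2 \<le> t + 700 * (n + 1)^2"
    using t' by (simp add: wps power2_eq_square algebra_simps)
  then show "cok w s ?b r' m' \<and> \<not> cev ?b r' m' \<and> Q (r', m', t' + csz ?b + 2)"
    using I bounds Q[OF I] by (simp add: inv_def wps)
qed simp

section \<open>Writing out the solution\<close>

abbreviation "st \<equiv> n + n + n + n + n + n + 3"
abbreviation "ob \<equiv> n + n + n + n + n + n + n + n + 6"

text \<open>A complete bisection, with one rectangle on the stack at the beginning and an empty
  stack at the end.\<close>

lemma wp_hirschberg_run:
  assumes rect: "i \<le> i'" "i' \<le> n" "c \<le> c'" "c' \<le> n" and input: "input m"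
    and regs: "r rN = n" "r rStack = st" "r rTop = i" "r rLeft = c" "r rSp = st + 2" "r rO = out"
    and m: "m st = i'" "m (st + 1) = c'" and out: "ob \<le> out" "out + (i' - i) < s"
    and Q: "\<And>r' m' t' Z. common_subseq (slice A i i') (slice B c c') Z \<Longrightarrow>
        length Z = lcs (slice A i i') (slice B c c') \<Longrightarrow> holds m' out Z \<Longrightarrow>
        (\<And>a. a < vb \<or> ob \<le> a \<and> a < out \<Longrightarrow> m' a = m a) \<Longrightarrow>
        (\<And>x. x \<notin> {10..21} \<union> {40..47} \<Longrightarrow> r' x = r x) \<Longrightarrow>
        r' rSp = st \<Longrightarrow> r' rO = out + length Z \<Longrightarrow> t' \<le> t + 2000 * (n + 1)^2 \<Longrightarrow> Q (r', m', t')"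
  shows "wp w s hirschberg Q (r, m, t)"
proof (rule wp_hirschberg[where A = A and B = B and n = n and st = st and ob = ob and i = i and i' = i' and c = c
      and c' = c' and sp = st and out = out and m = m and r = r and t = t])
  show "m k = A ! k" "m (n + k) = B ! k" if "k < n" for k
    using input that len unfolding input_def holds_def by auto
next
  fix r' m' t' Z
  assume Z: "common_subseq (slice A i i') (slice B c c') Z" "length Z = lcs (slice A i i') (slice B c c')"
      "\<And>k. k < length Z \<Longrightarrow> m' (out + k) = Z ! k"
    and m': "\<And>a. a < n + n + n + n + n + 2 \<or> n + n + n + n + n + 2 + n < a \<and> a < st + 2 \<or> ob \<le> a \<and> a < out \<Longrightarrow> m' a = m a"
    and r': "\<And>x. x \<notin> {10..21} \<union> {40..47} \<Longrightarrow> r' x = r x" "r' rSp = st" "r' rO = out + length Z"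
    and t': "t' \<le> t + 1600 * (i' - i) * (c' - c) + 200"
  have "(i' - i) * (c' - c) \<le> (n + 1) * (n + 1)" using rect by (intro mult_le_mono) auto
  then have "t' + 10 \<le> t + 2000 * (n + 1)^2"
    using t' by (simp add: power2_eq_square mult.assoc)
  then have "Q (r', m', t' + csz (Less (Reg rStack) (Reg rSp)) + 2)"
    using Z m' r' by (intro Q) (auto simp: holds_def wps)
  then show "wp w s hirschberg Q (r', m', t')"
    unfolding hirschberg_def using r' regs by (intro wp_LoopF) (auto simp: wps)
qed (use assms len s bounds(12) in auto)

lemma wp_copy_pattern:
  assumes regs: "r rN = n" "r rP = length P" "r rO = out" and input: "input m"
    and out: "n + n + n \<le> out" "out + length P < s"
    and Q: "\<And>r' m' t'. holds m' out P \<Longrightarrow> (\<And>a. a < out \<or> out + length P \<le> a \<Longrightarrow> m' a = m a) \<Longrightarrow>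
        (\<And>x. x \<noteq> rJ \<Longrightarrow> x \<noteq> rO \<Longrightarrow> r' x = r x) \<Longrightarrow> r' rO = out + length P \<Longrightarrow>
        t' \<le> t + 100 * (n + 1) \<Longrightarrow> Q (r', m', t')"
  shows "wp w s copy_pattern Q (r, m, t)"
proof -
  have P: "m (n + n + k) = P ! k" if "k < length P" for k
    using input that unfolding input_def holds_def by auto
  have b: "n + n + k < s" "n + n + k < 2 ^ w" "out + k < s" "out + k + 1 < 2 ^ w" "k + 1 < 2 ^ w" if "k < length P" for k
    using that out s len by auto
  show ?thesis unfolding copy_pattern_def
    apply (simp add: bounds del: One_nat_def)
    apply (rule wp_for[where i = 0 and q = "length P" and I = "\<lambda>j r' m' t'. (\<forall>k<j. m' (out + k) = P ! k) \<and>
       (\<forall>a. a < out \<or> out + j \<le> a \<longrightarrow> m' a = m a) \<and> (\<forall>x. x \<noteq> rJ \<longrightarrow> x \<noteq> rO \<longrightarrow> r' x = r x) \<and> r' rJ = j \<and>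
       r' rO = out + j \<and> t' \<le> t + 2 + 30 * j"])
    subgoal using regs by simp
    subgoal by simp
    subgoal for j r' m' t'
      using regs b[of j] bounds P[of j] out(1) len by (auto simp: wps less_Suc_eq)
    subgoal for r' m' t'
      using regs len by (intro conjI Q) (auto simp: wps holds_def)
    done
qed


definition result :: "(nat \<Rightarrow> nat) \<Rightarrow> (nat \<Rightarrow> nat) \<Rightarrow> nat list option" where
  "result r m = (if r 0 = 0 then None else Some (map m [r 1 ..< r 1 + r 2]))"

lemma wp_write_result3:
  assumes regs: "r rN = n" "r rO = ob + length Z" and Z: "holds m ob Z" and lenZ: "length Z \<le> 3 * n"
    and Q: "\<And>r' t'. result r' m = Some Z \<Longrightarrow> r' 1 + r' 2 \<le> s \<Longrightarrow> t' \<le> t + 100 \<Longrightarrow> Q (r', m, t')"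
  shows "wp w s write_result3 Q (r, m, t)"
proof -
  have "map m [ob ..< ob + length Z] = Z"
    using holdsD[OF Z] by (intro nth_equalityI) auto
  then have "Q (r(rP := length Z, 1 := ob, rN := 1), m, t')" if "t' \<le> t + 100" for t'
    using that lenZ s by (intro Q) (auto simp: result_def)
  moreover have "n + n + n + n + n + n < 2 ^ w" "n + n + n + n + n + n + n < 2 ^ w"
     "n + n + n + n + n + n + n + n < 2 ^ w" "ob < 2 ^ w" "ob + length Z < 2 ^ w" "6 < (2::nat) ^ w" using s lenZ by auto
  ultimately show ?thesis unfolding write_result3_def out_base_def using regs bounds
    by simp
qed

lemma wp_write_result2:
  assumes tables: "tables m" and regs: "r rN = n" "r rP = length P" "r rStack = st" "r rSp = st"
      "r rEndA = i" "r rEndB = j" "r rO = ob + length Z1"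
    and ij: "i \<le> n" "j \<le> n" and Z1: "holds m ob Z1" "length Z1 \<le> n"
    and Q: "\<And>r' m' t' Z2. common_subseq (drop i A) (drop j B) Z2 \<Longrightarrow> length Z2 = lcs (drop i A) (drop j B) \<Longrightarrow>
        result r' m' = Some (Z1 @ P @ Z2) \<Longrightarrow> r' 1 + r' 2 \<le> s \<Longrightarrow> t' \<le> t + 3000 * (n + 1)^2 \<Longrightarrow> Q (r', m', t')"
  shows "wp w s write_result2 Q (r, m, t)"
  unfolding write_result2_def wp_Seq
proof (rule wp_copy_pattern[where out = "ob + length Z1"])
  show "r rN = n" "r rP = length P" "r rO = ob + length Z1" "input m"
    using regs tables by (auto simp: tables_def)
  show "n + n + n \<le> ob + length Z1" "ob + length Z1 + length P < s" using Z1 len s by auto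
next
  fix r1 m1 t1
  assume P1: "holds m1 (ob + length Z1) P"
    and m1: "\<And>a. a < ob + length Z1 \<or> ob + length Z1 + length P \<le> a \<Longrightarrow> m1 a = m a"
    and r1: "\<And>x. x \<noteq> rJ \<Longrightarrow> x \<noteq> rO \<Longrightarrow> r1 x = r x" "r1 rO = ob + length Z1 + length P"
    and t1: "t1 \<le> t + 100 * (n + 1)"
  let ?r2 = "r1(rSp := st + 2, rTop := i, rLeft := j)" and ?m2 = "m1(st := n, st + 1 := n)"
  have input1: "input m1"
    using tables m1 len unfolding tables_def input_def by (auto intro!: holds_frame[of m])
  define S where "S = (n + 1)^2"
  have nn: "(n + 1) \<le> (n + 1)^2" by (simp add: power2_eq_square)
  have "wp w s hirschberg (wp w s write_result3 Q) (?r2, ?m2, t2)" if t2: "t2 \<le> t1 + 100" for t2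
  proof (rule wp_hirschberg_run[where i = i and i' = n and c = j and c' = n and out = "ob + length Z1 + length P"])
    show "i \<le> n" "n \<le> n" "j \<le> n" "n \<le> n" using ij by auto
    show "input ?m2" using input1 len unfolding input_def by (auto intro!: holds_frame[of m1])
    show "?r2 rN = n" "?r2 rStack = st" "?r2 rTop = i" "?r2 rLeft = j" "?r2 rSp = st + 2"
      "?r2 rO = ob + length Z1 + length P" using r1 regs by auto
    show "?m2 st = n" "?m2 (st + 1) = n" by auto
    show "ob \<le> ob + length Z1 + length P" "ob + length Z1 + length P + (n - i) < s" using Z1 len s by auto
  next
    fix r3 m3 t3 Z2
    assume Z2: "common_subseq (slice A i n) (slice B j n) Z2" "length Z2 = lcs (slice A i n) (slice B j n)"
        "holds m3 (ob + length Z1 + length P) Z2"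
      and m3: "\<And>a. a < vb \<or> ob \<le> a \<and> a < ob + length Z1 + length P \<Longrightarrow> m3 a = ?m2 a"
      and r3: "\<And>x. x \<notin> {10..21} \<union> {40..47} \<Longrightarrow> r3 x = ?r2 x" "r3 rO = ob + length Z1 + length P + length Z2"
      and t3: "t3 \<le> t2 + 2000 * (n + 1)^2"
    have sl: "slice A i n = drop i A" "slice B j n = drop j B" using len by simp_all
    have "length Z2 \<le> n" using Z2(2) lcs_le1[of "drop i A" "drop j B"] len unfolding sl by simp
    then have lenZ: "length (Z1 @ P @ Z2) \<le> 3 * n" using Z1 len by simp
    \<comment> \<open>The second bisection writes behind the pattern, so the three pieces survive
      and lie side by side.\<close>
    have "m3 (ob + k) = (Z1 @ P @ Z2) ! k" if k: "k < length (Z1 @ P @ Z2)" for k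
    proof -
      consider "k < length Z1" | l where "k = length Z1 + l" "l < length P"
        | l where "k = length Z1 + length P + l" "l < length Z2"
        using k by (metis add.assoc add_less_cancel_left le_Suc_ex length_append linorder_not_less)
      then show ?thesis
      proof cases
        case 1
        then show ?thesis using m3[of "ob + k"] m1[of "ob + k"] holdsD[OF Z1(1), of k] by (simp add: nth_append)
      next
        case 2
        then show ?thesis using m3[of "ob + k"] holdsD[OF P1, of l] by (simp add: nth_append add.assoc)
      next
        case 3
        then show ?thesis using holdsD[OF Z2(3), of l] by (simp add: nth_append add.assoc)
      qed
    qed
    then have hZ: "holds m3 ob (Z1 @ P @ Z2)" by (simp add: holds_def)
    show "wp w s write_result3 Q (r3, m3, t3)"
    proof (rule wp_write_result3[OF _ _ hZ lenZ])
      show "r3 rN = n" "r3 rO = ob + length (Z1 @ P @ Z2)" using r3 r1 regs by auto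
      fix r4 t4 assume "result r4 m3 = Some (Z1 @ P @ Z2)" "r4 1 + r4 2 \<le> s" and t4: "t4 \<le> t3 + 100"
      moreover have "t4 \<le> t + 3000 * (n + 1)^2" using t1 t2 t3 t4 nn unfolding S_def[symmetric] by simp
      ultimately show "Q (r4, m3, t4)" using Z2(1,2) unfolding sl by (intro Q)
    qed
  qed
  moreover have "st < s" "st + 1 < s" "st + 2 < 2 ^ w" using s by auto
  ultimately show "wp w s (Put (Reg rSp) (Reg rN)) (wp w s (Put (Reg rSp \<oplus> Num 1) (Reg rN)) (wp w s (Assign rSp (Reg rSp \<oplus> Num 2))
     (wp w s (Assign rTop (Reg rEndA)) (wp w s (Assign rLeft (Reg rEndB)) (wp w s hirschberg (wp w s write_result3 Q)))))) (r1, m1, t1)"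
    using r1 regs bounds by simp
qed


lemma wp_write_result1:
  assumes tables: "tables m" and regs: "r rN = n" "r rP = length P" "r rEndA = i" "r rEndB = j"
      "r rRes = start A P i" "0 < start A P i" "0 < start B P j"
    and ij: "i \<le> n" "j \<le> n"
    and Q: "\<And>r' m' t' Z1 Z2. common_subseq (take (start A P i - 1) A) (take (start B P j - 1) B) Z1 \<Longrightarrow>
        length Z1 = lcs (take (start A P i - 1) A) (take (start B P j - 1) B) \<Longrightarrow>
        common_subseq (drop i A) (drop j B) Z2 \<Longrightarrow> length Z2 = lcs (drop i A) (drop j B) \<Longrightarrow>
        result r' m' = Some (Z1 @ P @ Z2) \<Longrightarrow> r' 1 + r' 2 \<le> s \<Longrightarrow> t' \<le> t + 6000 * (n + 1)^2 \<Longrightarrow> Q (r', m', t')"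
  shows "wp w s write_result1 Q (r, m, t)"
proof -
  define a b where "a = start A P i - 1" and "b = start B P j - 1"
  have sa: "start A P i = Suc a" "start B P j = Suc b" using regs by (auto simp: a_def b_def)
  have ab: "a \<le> n" "b \<le> n"
    using start_Suc[OF sa(1)] start_Suc[OF sa(2)] ij len by auto
  let ?r1 = "r(rStack := st, rO := ob, rSp := st + 2, rTop := 0, rLeft := 0)"
  let ?m1 = "m(st := a, st + 1 := b)"
  define S where "S = (n + 1)^2"
  have one: "1 \<le> (n + 1)^2" by simp
  have "wp w s hirschberg (wp w s write_result2 Q) (?r1, ?m1, t1)" if t1: "t1 \<le> t + 200" for t1
  proof (rule wp_hirschberg_run[where i = 0 and i' = a and c = 0 and c' = b and out = ob])
    show "0 \<le> a" "a \<le> n" "0 \<le> b" "b \<le> n" using ab by auto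
    show "input ?m1" using tables len unfolding tables_def input_def by (auto intro!: holds_frame[of m])
    show "?r1 rN = n" "?r1 rStack = st" "?r1 rTop = 0" "?r1 rLeft = 0" "?r1 rSp = st + 2" "?r1 rO = ob"
      using regs by auto
    show "?m1 st = a" "?m1 (st + 1) = b" by auto
    show "ob \<le> ob" "ob + (a - 0) < s" using ab s by auto
  next
    fix r2 m2 t2 Z1
    assume Z1: "common_subseq (slice A 0 a) (slice B 0 b) Z1" "length Z1 = lcs (slice A 0 a) (slice B 0 b)" "holds m2 ob Z1"
      and m2: "\<And>x. x < vb \<or> ob \<le> x \<and> x < ob \<Longrightarrow> m2 x = ?m1 x"
      and r2: "\<And>x. x \<notin> {10..21} \<union> {40..47} \<Longrightarrow> r2 x = ?r1 x" "r2 rSp = st" "r2 rO = ob + length Z1"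
      and t2: "t2 \<le> t1 + 2000 * (n + 1)^2"
    show "wp w s write_result2 Q (r2, m2, t2)"
    proof (rule wp_write_result2[where i = i and j = j and ?Z1.0 = Z1])
      show "tables m2"
        using tables m2 len unfolding tables_def input_def by (auto intro!: holds_frame[of m])
      show "r2 rN = n" "r2 rP = length P" "r2 rStack = st" "r2 rSp = st"
        "r2 rEndA = i" "r2 rEndB = j" "r2 rO = ob + length Z1" using r2 regs by auto
      show "i \<le> n" "j \<le> n" "holds m2 ob Z1" by fact+
      show "length Z1 \<le> n" using Z1(2) lcs_le1[of "take a A" "take b B"] ab by simp
    next
      fix r3 m3 t3 Z2
      assume Z2: "common_subseq (drop i A) (drop j B) Z2" "length Z2 = lcs (drop i A) (drop j B)"
        and res: "result r3 m3 = Some (Z1 @ P @ Z2)" "r3 1 + r3 2 \<le> s" and t3: "t3 \<le> t2 + 3000 * (n + 1)^2"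
      have "t3 \<le> t + 6000 * (n + 1)^2" using t1 t2 t3 one unfolding S_def[symmetric] by simp
      then show "Q (r3, m3, t3)"
        using Z1(1,2) Z2 res unfolding slice_0 a_def b_def by (intro Q)
    qed
  qed
  \<comment> \<open>The two inequalities on \<open>j\<close> say that the table entry at
    \<open>3 n + j\<close>, which is read after the first push, is not one of the stack
    words.\<close>
  moreover have "n + n + n + n + n + n < 2 ^ w" "n + n + n + n + n + n + n < 2 ^ w"
     "n + n + n + n + n + n + n + n < 2 ^ w" "ob < 2 ^ w" "st < 2 ^ w" "st + 1 < 2 ^ w" "st + 2 < 2 ^ w" "st < s" "st + 1 < s"
     "n + n + n + j < 2 ^ w" "n + n + n + j < s" "Suc a < 2 ^ w" "Suc b < 2 ^ w" "6 < (2::nat) ^ w" "3 < (2::nat) ^ w" "j \<noteq> 3 * n + 3" "j \<noteq> 3 * n + 4" using s ij ab by auto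
  moreover have "m (n + n + n + j) = Suc b" using tables ij sa by (simp add: tables_def)
  ultimately show ?thesis unfolding write_result1_def out_base_def using regs sa bounds
    by simp
qed

lemma wp_finish:
  assumes inv: "inv (n + 1) n (n + 1) a r m"
    and Q: "\<And>r' m' t'. is_str_ic_lcs A B P (result r' m') \<Longrightarrow> (result r' m' \<noteq> None \<Longrightarrow> r' 1 + r' 2 \<le> s) \<Longrightarrow>
        t' \<le> t + 7000 * (n + 1)^2 \<Longrightarrow> Q (r', m', t')"
  shows "wp w s finish Q (r, m, t)"
proof -
  define x where "x = m (vb + n)"
  have I: "r rN = n" "r rP = length P" "r rMM = (n + 1)^2" "tables m"
    and best: "best ((n + 1)^2) A B (seeds A B P (n + 1)) n n x"
    using inv unfolding inv_def x_def by auto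
  note opt = best_seeds[OF len(1,2) best]
  have mx: "m (Suc (Suc (n + n + n + n + n + n))) = x" by (simp add: x_def)
  have b: "vb + n < s" "vb + n < 2 ^ w" using s by auto
  define S where "S = (n + 1)^2"
  have one: "1 \<le> (n + 1)^2" "n + 1 \<le> (n + 1)^2" by (simp_all add: power2_eq_square)
  show ?thesis
  proof (cases "x = 0")
    case True
    have "Q (r(rX := 0, rN := 0), m, t')" if "t' \<le> t + 100" for t'
    proof (rule Q)
      show "is_str_ic_lcs A B P (result (r(rX := 0, rN := 0)) m)"
        using opt(1)[OF True] by (simp add: result_def)
      show "t' \<le> t + 7000 * (n + 1)^2" using that one unfolding S_def[symmetric] by simp
    qed (simp add: result_def)
    then show ?thesis unfolding finish_def using I b bounds True by (simp add: wps x_def)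
  next
    case False
    define i j where "i = x mod (n + 1)^2 div (n + 1)" and "j = x mod (n + 1)^2 mod (n + 1)"
    have ij: "i \<le> n" "j \<le> n" "0 < start A P i" "0 < start B P j"
      using opt(2)[OF _ i_def j_def] False by auto
    let ?r1 = "r(rX := x mod (n + 1)^2, rEndA := i, rEndB := j, rI := i, rBase := 0)"
    have "wp w s match (wp w s write_result1 Q) (?r1, m, t1)" if t1: "t1 \<le> t + 100" for t1
    proof (rule wp_match)
      have "length P * i \<le> (n + 1) * (n + 1)" using len ij by (intro mult_le_mono) auto
      then show "?r1 rP * ?r1 rI < 2 ^ w" using I bounds(11) by simp
      show "?r1 rN + ?r1 rN + ?r1 rP < s" "?r1 rBase + ?r1 rI < s" "s < 2 ^ w" using I len ij s by auto
    next
      fix r2 t2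
      assume res: "r2 rRes = match_back (\<lambda>i. m (?r1 rBase + i)) (\<lambda>i. m (?r1 rN + ?r1 rN + i)) (?r1 rP) (?r1 rI)"
        and r2: "\<And>x. x \<notin> {rRes, rK, rS} \<Longrightarrow> r2 x = ?r1 x" and t2: "t2 \<le> t1 + 40 * (?r1 rI + 1)"
      have res': "r2 rRes = start A P i"
        unfolding res start_def using I(4) ij len I
        by (simp, intro match_back_cong) (auto simp: tables_def input_def holds_def)
      show "wp w s write_result1 Q (r2, m, t2)"
      proof (rule wp_write_result1[where i = i and j = j])
        show "tables m" "r2 rRes = start A P i" "0 < start A P i" "0 < start B P j" "i \<le> n" "j \<le> n" by fact+
        show "r2 rN = n" "r2 rP = length P" "r2 rEndA = i" "r2 rEndB = j" using r2 I by auto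
      next
        fix r3 m3 t3 Z1 Z2
        assume Z: "common_subseq (take (start A P i - 1) A) (take (start B P j - 1) B) Z1"
          "length Z1 = lcs (take (start A P i - 1) A) (take (start B P j - 1) B)"
          "common_subseq (drop i A) (drop j B) Z2" "length Z2 = lcs (drop i A) (drop j B)"
          and res: "result r3 m3 = Some (Z1 @ P @ Z2)" "r3 1 + r3 2 \<le> s" and t3: "t3 \<le> t2 + 6000 * (n + 1)^2"
        have "is_str_ic_lcs A B P (Some (Z1 @ P @ Z2))"
          using opt(2)[OF _ i_def j_def] False Z by blast
        moreover have "t2 \<le> t1 + 40 * (n + 1)" using t2 ij by simp
        then have "t3 \<le> t + 7000 * (n + 1)^2" using t1 t3 one unfolding S_def[symmetric] by simp
        ultimately show "Q (r3, m3, t3)" using res by (intro Q) auto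
      qed
    qed
    then show ?thesis unfolding finish_def write_result_def
      using I b bounds False mx by (simp add: wps i_def j_def del: One_nat_def)
  qed
qed

text \<open>The three phases take at most 400, 700 and 7000 times \<open>(n + 1)^2\<close>
  steps.\<close>

theorem wp_str_ic_lcs:
  assumes "input m" "r rN = n" "r rP = length P"
  shows "wp w s str_ic_lcs (\<lambda>(r', m', t'). is_str_ic_lcs A B P (result r' m') \<and>
    (result r' m' \<noteq> None \<longrightarrow> r' 1 + r' 2 \<le> s) \<and> t' \<le> 9000 * (n + 1)^2) (r, m, 0)"
  unfolding str_ic_lcs_def wp_Seq
proof (rule wp_setup_tables[OF assms], rule wp_plant_seeds, assumption, rule wp_finish, assumption)
qed auto

end

section \<open>The machine program, its word size and its bounds\<close>

lemma legal_str_ic_lcs: "legal str_ic_lcs"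
  by (simp add: str_ic_lcs_def setup_tables_def setup_tables1_def setup_tables2_def setup_tables3_def ends_def
      plant_seeds_def seed_body_def seed_body1_def seed_body2_def seed_body3_def finish_def write_result_def
      write_result1_def write_result2_def write_result3_def out_base_def copy_pattern_def hirschberg_def
      hirschberg_body_def hirschberg_case_def pop_def scan_def bisect_def bisect2_def bisect3_def bisect4_def
      label_def match_def fill_def rows_def row_def row_body_def add_seeds_def tmp_def)

text \<open>The exponent 10 splits as 7 + 3: the factor \<open>(n + 2) ^ 7\<close> is at least 128,
  which absorbs all constants even for \<open>n = 0\<close>, and the cube covers the packed
  numbers.\<close>

lemma word_size_bound:
  assumes "10 * log 2 (real n + 2) \<le> real w"
  shows "12 * n + 20 < 2 ^ w" "4 * (n + 1) ^ 3 < 2 ^ w"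
proof -
  have "10 * log 2 (real n + 2) = log 2 ((real n + 2) ^ 10)" by (simp add: log_nat_power)
  then have "log 2 ((real n + 2) ^ 10) \<le> real w" using assms by simp
  then have "(real n + 2) ^ 10 \<le> 2 powr (real w)" by (simp add: log_le_iff)
  then have "real ((n + 2) ^ 10) \<le> real (2 ^ w)" by (simp add: powr_realpow add.commute)
  then have w: "(n + 2) ^ 10 \<le> 2 ^ w" by (simp only: of_nat_le_iff)
  have "2 ^ 7 * (n + 1) ^ 3 \<le> (n + 2) ^ 7 * (n + 2) ^ 3"
    by (intro mult_le_mono power_mono) auto
  also have "\<dots> = (n + 2) ^ 10" by (simp flip: power_add)
  finally have c: "128 * (n + 1) ^ 3 \<le> 2 ^ w" using w by simp
  have "n + 1 \<le> (n + 1) ^ 3" "0 < (n + 1) ^ 3" by (simp_all add: self_le_power)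
  then show "12 * n + 20 < 2 ^ w" "4 * (n + 1) ^ 3 < 2 ^ w" using c by linarith+
qed

theorem theorem1:
  "\<exists>(prog :: instr list) (c :: nat) (T :: nat \<Rightarrow> real) (K :: nat).
     T \<in> O(\<lambda>n. real n ^ 2) \<and>
     (\<forall>(n :: nat) (A :: nat list) (B :: nat list) (P :: nat list) (w :: nat).
        length A = n \<longrightarrow> length B = n \<longrightarrow> length P \<le> n \<longrightarrow>
        real c * log 2 (real n + 2) \<le> real w \<longrightarrow>
        (\<forall>x \<in> set A \<union> set B \<union> set P. x < 2 ^ w) \<longrightarrow>
        (\<exists>t s Z. computes w prog A B P t s Z \<and>
                 is_str_ic_lcs A B P Z \<and>
                 real t \<le> T n \<and>
                 s \<le> K * ((lcs A B + 1) * (n - lcs A B + 1))))"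
\<comment> \<open>The space factor 20 comes from
  \<open>12 * n + 20 \<le> 20 * (n + 1)\<close>.\<close>
proof (rule exI[of _ "ccom 0 str_ic_lcs"], rule exI[of _ 10], rule exI[of _ "\<lambda>n. real (9000 * (n + 1)^2)"],
    rule exI[of _ 20], intro conjI allI impI)
  show "(\<lambda>n. real (9000 * (n + 1)^2)) \<in> O(\<lambda>n. real n ^ 2)"
  proof (rule bigoI)
    show "\<forall>\<^sub>F n in sequentially. norm (real (9000 * (n + 1)^2)) \<le> 36000 * norm (real n ^ 2)"
    proof (rule eventually_sequentiallyI)
      fix n :: nat assume "1 \<le> n"
      \<comment> \<open>From 1 on, \<open>n + 1 \<le> 2 * n\<close>; squaring turns 9000 into
        36000.\<close>
      then have "(n + 1)^2 \<le> (2 * n)^2" by (intro power_mono) auto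
      then have "9000 * (n + 1)^2 \<le> 36000 * n^2" by (simp add: power_mult_distrib)
      then have "real (9000 * (n + 1)^2) \<le> real (36000 * n^2)" by (rule of_nat_mono)
      then show "norm (real (9000 * (n + 1)^2)) \<le> 36000 * norm (real n ^ 2)" by simp
    qed
  qed
next
  fix n w :: nat and A B P :: "nat list"
  assume len: "length A = n" "length B = n" "length P \<le> n"
    and w: "real 10 * log 2 (real n + 2) \<le> real w"
  define s where "s = 12 * n + 20"
  interpret str_ic_input A B P n w s
    using len word_size_bound[of n w] w by unfold_locales (simp_all add: s_def)
  let ?m = "mem (input_config A B P)" and ?r = "reg (input_config A B P)"
  have cfg: "input_config A B P = cfg 0 ?r ?m" by (simp add: input_config_def)
  have "input ?m"
    using len by (auto simp: input_def holds_def input_config_def nth_append)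
  then have "wp w s str_ic_lcs (\<lambda>(r', m', t'). is_str_ic_lcs A B P (result r' m') \<and>
    (result r' m' \<noteq> None \<longrightarrow> r' 1 + r' 2 \<le> s) \<and> t' \<le> 9000 * (n + 1)^2) (?r, ?m, 0)"
    using len by (intro wp_str_ic_lcs) (auto simp: input_config_def)
  then obtain r' m' t' where big: "big w s str_ic_lcs (?r, ?m, 0) (r', m', t')"
    and res: "is_str_ic_lcs A B P (result r' m')" "result r' m' \<noteq> None \<longrightarrow> r' 1 + r' 2 \<le> s" "t' \<le> 9000 * (n + 1)^2"
    unfolding wp_def by auto
  obtain t c where run: "runs w (ccom 0 str_ic_lcs) (input_config A B P) t s c" "t \<le> t'"
      "\<forall>x<tmp. reg c x = r' x" "mem c = m'"
    using runs_ccom[OF big legal_str_ic_lcs] cfg by auto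
  have eq: "result_of c = result r' m'" "reg c 1 = r' 1" "reg c 2 = r' 2"
    using run by (auto simp: result_of_def result_def tmp_def)
  have "computes w (ccom 0 str_ic_lcs) A B P t s (result r' m')"
    unfolding computes_def using run eq res len by (intro exI[of _ c]) (auto simp: s_def)
  moreover have "s \<le> 20 * ((lcs A B + 1) * (n - lcs A B + 1))"
  proof -
    have "lcs A B \<le> n" using lcs_le1[of A B] len by simp
    then obtain d where "n = lcs A B + d" using le_Suc_ex by blast
    \<comment> \<open>With \<open>n = l + d\<close> the product is
      \<open>(l + 1) * (d + 1) = n + 1 + l * d\<close>.\<close>
    then have "n + 1 \<le> (lcs A B + 1) * (n - lcs A B + 1)" by (simp add: algebra_simps)
    then show ?thesis by (simp add: s_def)
  qed
  moreover have "real t \<le> real (9000 * (n + 1)^2)" using run res by (intro of_nat_mono) simp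
  ultimately show "\<exists>t s Z. computes w (ccom 0 str_ic_lcs) A B P t s Z \<and> is_str_ic_lcs A B P Z \<and>
      real t \<le> real (9000 * (n + 1)^2) \<and> s \<le> 20 * ((lcs A B + 1) * (n - lcs A B + 1))"
    using res by blast
qed

end
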